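(* Consider long-range first-passage percolation on $\mathbb{Z}^d$ (setting in the context) with a nonnegative non-increasing rate function $r(k)=k^{-\alpha}L(k)$, $k\ge1$, where $\alpha>2d+1$ and $L$ is slowly varying at infinity with $L(1)=1$. Then for every $x\in\mathbb{Z}^d\setminus\{0\}$ there is $\nu(x)>0$ such that for every $\varepsilon>0$, $$\lim_{n\to\infty}\mathbb{P}\big((1-\varepsilon)\nu(x)\le n^{-1}T(0,nx)\le(1+\varepsilon)\nu(x)\big)=1.$$ Moreover, $\nu$ extends to a function $\boldsymbol\nu:\mathbb{R}^d\to[0,\infty)$ with $\boldsymbol\nu(y)\ne0$ whenever $y\ne0$, such that for every $\varepsilon>0$, $$\mathbb{P}\big(\{y\in\mathbb{R}^d:\boldsymbol\nu(y)\le1-\varepsilon\}\subseteq t^{-1}\mathcal{B}_t\subseteq\{y\in\mathbb{R}^d:\boldsymbol\nu(y)\le1+\varepsilon\}\text{ for all sufficiently large }t\big)=1.$$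
   Context: Let $d\ge1$ and $\|x\|_1=\sum_i|x_i|$. Let $\mathcal{E}$ be the set of unordered pairs $e=\langle xy\rangle$ of distinct points of $\mathbb{Z}^d$, with length $\|e\|_1=\|x-y\|_1$. Let $(\omega_e)$ be i.i.d. mean-one exponential random variables and $W_e=\omega_e/r(\|e\|_1)$. For a finite path $\pi=\langle x_0\dots x_k\rangle$ ($x_i\ne x_{i-1}$), $W_\pi=\sum_iW_{\langle x_{i-1}x_i\rangle}$; $T(x,y)$ is the infimum of $W_\pi$ over finite paths from $x$ to $y$; $\mathcal{B}_t=\{x\in\mathbb{Z}^d:T(0,x)\le t\}$, and $t^{-1}\mathcal{B}_t=\{x/t:x\in\mathcal{B}_t\}\subseteq\mathbb{R}^d$.
   Formalization: The left inclusion is proved only for points of t^{-1}Z^d, i.e. {ν ≤ 1−ε} ∩ t^{-1}Z^d ⊆ t^{-1}B_t, since B_t consists of lattice points and the inclusion as written fails (e.g. at a unit vector for non-integer t). *)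

theory Defs
  imports "HOL-Analysis.Analysis" "HOL-Probability.Probability"
begin

definition l1norm :: "int ^ 'd \<Rightarrow> int" where
  "l1norm x = (\<Sum>i\<in>UNIV. \<bar>x $ i\<bar>)"

definition lattice_edges :: "(int ^ 'd) set set" where
  "lattice_edges = {{x, y} | x y. x \<noteq> y}"

definition edge_weight ::
  "(nat \<Rightarrow> real) \<Rightarrow> ((int ^ 'd) set \<Rightarrow> real) \<Rightarrow> int ^ 'd \<Rightarrow> int ^ 'd \<Rightarrow> real" where
  "edge_weight r w x y = w {x, y} / r (nat (l1norm (x - y)))"

definition is_path :: "(int ^ 'd) list \<Rightarrow> int ^ 'd \<Rightarrow> int ^ 'd \<Rightarrow> bool" where
  "is_path p a b \<longleftrightarrow> p \<noteq> [] \<and> hd p = a \<and> last p = b \<and>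
     (\<forall>i. Suc i < length p \<longrightarrow> p ! i \<noteq> p ! Suc i)"

definition path_weight ::
  "(nat \<Rightarrow> real) \<Rightarrow> ((int ^ 'd) set \<Rightarrow> real) \<Rightarrow> (int ^ 'd) list \<Rightarrow> real" where
  "path_weight r w p = (\<Sum>i<length p - 1. edge_weight r w (p ! i) (p ! Suc i))"

definition passage_time ::
  "(nat \<Rightarrow> real) \<Rightarrow> ((int ^ 'd) set \<Rightarrow> real) \<Rightarrow> int ^ 'd \<Rightarrow> int ^ 'd \<Rightarrow> real" where
  "passage_time r w a b = Inf {path_weight r w p | p. is_path p a b}"

definition fpp_ball ::
  "(nat \<Rightarrow> real) \<Rightarrow> ((int ^ 'd) set \<Rightarrow> real) \<Rightarrow> real \<Rightarrow> (int ^ 'd) set" where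
  "fpp_ball r w t = {x. passage_time r w 0 x \<le> t}"

definition real_of_lattice :: "int ^ 'd \<Rightarrow> real ^ 'd" where
  "real_of_lattice x = (\<chi> i. real_of_int (x $ i))"

definition scale_lattice_set :: "real \<Rightarrow> (int ^ 'd) set \<Rightarrow> (real ^ 'd) set" where
  "scale_lattice_set t A = (\<lambda>x. (1 / t) *\<^sub>R real_of_lattice x) ` A"

definition lattice_smult :: "nat \<Rightarrow> int ^ 'd \<Rightarrow> int ^ 'd" where
  "lattice_smult n x = (\<chi> i. int n * x $ i)"

definition slowly_varying :: "(real \<Rightarrow> real) \<Rightarrow> bool" where
  "slowly_varying L \<longleftrightarrow> (\<forall>\<^sub>F x in at_top. L x > 0) \<and>
     (\<forall>c>0. ((\<lambda>x. L (c * x) / L x) \<longlongrightarrow> 1) at_top)"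

end

theory Submission
  imports Defs "HOL-Real_Asymp.Real_Asymp"
begin

text \<open>
  A configuration of weights is a point of the product of exponential laws, on which translations act
  measure-preservingly. Since \<open>T(0, nx)\<close> is subadditive in \<open>n\<close>, its mean divided by \<open>n\<close> has infimum
  \<open>\<nu>(x)\<close>. From above, \<open>T(0, nmx)\<close> is at most a sum of translates of a functional of finitely many
  edges whose mean is close to that of \<open>T(0, mx)\<close>; such a sum has finite-range dependence, so its
  variance is linear and Borel--Cantelli along squares gives the almost sure upper bound. From below,
  the covering argument of Katznelson and Weiss applies: if \<open>T(0, nx) < \<beta> n\<close> happened infinitely often
  for some \<open>\<beta> < \<nu>(x)\<close>, then long stretches could be covered greedily by fast segments, and on that event
  the mean would be too small.

  Positivity of \<open>\<nu>\<close> uses \<open>\<alpha> > 2d + 1\<close>. Call an edge of length \<open>\<ell>\<close> cheap if its weight is at most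
  \<open>c \<ell>\<close>. A vertex has a cheap edge of length about \<open>2\<^sup>j\<close> with probability \<open>O(c (\<sigma> / 2\<^sup>d)\<^sup>j)\<close> for some
  \<open>\<sigma> < 1\<close>, and a first moment bound over ordered tuples of such edges shows, as for greedy lattice
  animals, that for small \<open>c\<close> the cheap edges make up at most half of the length of any path. The
  remaining edges cost at least \<open>c\<close> per unit length.

  The shape theorem follows because an exponential moment bound for nearest-neighbour paths interpolates
  between finitely many directions.
\<close>

section \<open>Lattice norm and paths\<close>

text \<open>The exponent \<open>2d + 1\<close> is what the counting of chains demands. A vertex has
  about \<open>2 ^ (d j)\<close> edges of length about \<open>2 ^ j\<close>, each cheap with
  probability about \<open>c * 2 ^ j * r (2 ^ j)\<close>. If a path of length \<open>m\<close> may
  use \<open>a j * m\<close> such edges, they make up a share \<open>2 ^ j * a j\<close> of its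
  length. These shares must be summable, so \<open>a j\<close> has to lie slightly below
  \<open>2 ^ (- j)\<close>. The union bound over the steps between the edges costs
  \<open>a j ^ (- d)\<close>, a further factor slightly above \<open>2 ^ (d j)\<close>. So
  \<open>2 ^ ((2 d + 1) j) * r (2 ^ j)\<close> must decay geometrically, which is the condition
  \<alpha> > 2d + 1.

  In the lower bound the mean is split over the bad event and its complement. On the complement the
  upper bound has to hold in mean and not only almost surely. This is why the variance estimate
  serves twice: with Borel-Cantelli for the almost sure bound, and as a bound on the fluctuations in
  mean.\<close>

definition lnorm :: "int ^ 'd \<Rightarrow> nat" where
  "lnorm x = nat (l1norm x)"

lemma lnorm_alt: "int (lnorm x) = (\<Sum>i\<in>UNIV. \<bar>x $ i\<bar>)"
  by (simp add: lnorm_def l1norm_def sum_nonneg)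

lemma real_lnorm: "real (lnorm x) = (\<Sum>i\<in>UNIV. real_of_int \<bar>x $ i\<bar>)"
  using arg_cong[OF lnorm_alt[of x], of real_of_int] by simp

lemma lnorm_0 [simp]: "lnorm 0 = 0"
  by (simp add: lnorm_def l1norm_def)

lemma lnorm_eq_0_iff [simp]: "lnorm x = 0 \<longleftrightarrow> x = 0"
proof -
  have "lnorm x = 0 \<longleftrightarrow> int (lnorm x) = 0" by simp
  also have "\<dots> \<longleftrightarrow> (\<forall>i. x $ i = 0)"
    unfolding lnorm_alt by (subst sum_nonneg_eq_0_iff) auto
  finally show ?thesis by (simp add: vec_eq_iff)
qed

lemma lnorm_minus [simp]: "lnorm (- x) = lnorm x"
  by (simp add: lnorm_def l1norm_def)

lemma lnorm_minus_commute: "lnorm (x - y) = lnorm (y - x)"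
  using lnorm_minus[of "x - y"] by simp

lemma lnorm_triangle: "lnorm (x + y) \<le> lnorm x + lnorm y"
proof -
  have "int (lnorm (x + y)) \<le> int (lnorm x) + int (lnorm y)"
    unfolding lnorm_alt sum.distrib[symmetric] by (intro sum_mono) auto
  thus ?thesis by linarith
qed

lemma lnorm_triangle_sub: "lnorm (x - z) \<le> lnorm (x - y) + lnorm (y - z)"
  using lnorm_triangle[of "x - y" "y - z"] by simp

lemma lnorm_component_le: "\<bar>x $ i\<bar> \<le> int (lnorm x)"
  unfolding lnorm_alt by (rule member_le_sum) auto

lemma lnorm_pos_iff: "lnorm x \<ge> 1 \<longleftrightarrow> x \<noteq> 0"
  using lnorm_eq_0_iff[of x] by linarith

definition lbox :: "nat \<Rightarrow> (int ^ 'd) set" where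
  "lbox R = {y. \<forall>i. y $ i \<in> {- int R..int R}}"

lemma lbox_eq_image: "lbox R = vec_lambda ` (PiE UNIV (\<lambda>_. {- int R..int R}))"
proof -
  have "y \<in> vec_lambda ` (PiE UNIV (\<lambda>_. {- int R..int R}))" if "y \<in> lbox R" for y :: "int ^ 'd"
    using that by (intro image_eqI[of _ _ "vec_nth y"]) (auto simp: lbox_def)
  thus ?thesis by (force simp: lbox_def)
qed

lemma finite_lbox [simp]: "finite (lbox R)"
  unfolding lbox_eq_image by (intro finite_imageI finite_PiE) auto

lemma lnorm_le_subset_lbox: "{y. lnorm y \<le> R} \<subseteq> lbox R"
proof
  fix y :: "int ^ 'd" assume "y \<in> {y. lnorm y \<le> R}"
  hence "\<bar>y $ i\<bar> \<le> int R" for i using lnorm_component_le[of y i] by simp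
  thus "y \<in> lbox R" unfolding lbox_def by (auto simp: abs_le_iff) (metis minus_le_iff)
qed

lemma finite_lnorm_le [simp]: "finite {y. lnorm y \<le> R}"
  by (rule finite_subset[OF lnorm_le_subset_lbox]) simp

text \<open>With \<open>q = exp (- a)\<close>, the inequality \<open>1 + a \<le> exp a\<close> gives
  \<open>q / (1 - q) \<le> 1 / a\<close> for each of the two geometric tails, and
  \<open>a \<le> 1\<close> absorbs the middle term into \<open>3 / a\<close>.\<close>

lemma sum_int_exp_le:
  assumes "0 < a" "a \<le> 1"
  shows "(\<Sum>k = - int R..int R. exp (- a * real_of_int \<bar>k\<bar>)) \<le> 3 / a"
proof -
  define q where "q = exp (- a)"
  have q: "0 < q" "q < 1" using assms by (auto simp: q_def)
  have "exp (- a) * (1 + a) \<le> exp (- a) * exp a"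
    using exp_ge_add_one_self[of a] by (intro mult_left_mono) auto
  hence "q * (1 + a) \<le> 1" by (simp add: q_def exp_minus)
  hence q': "q * a \<le> 1 - q" by (simp add: algebra_simps)
  have e: "exp (- a * real k) = q ^ k" for k :: nat
    by (simp add: q_def exp_of_nat_mult[symmetric] mult.commute)
  have geo: "(\<Sum>k = 1..R. q ^ k) \<le> q / (1 - q)" for R
  proof -
    have "(\<Sum>k = 1..R. q ^ k) = (\<Sum>k<R. q ^ Suc k)"
      by (rule sum.reindex_bij_witness[of _ Suc "\<lambda>k. k - 1"]) auto
    also have "\<dots> = q * (\<Sum>k<R. q ^ k)" by (simp add: sum_distrib_left)
    also have "(\<Sum>k<R. q ^ k) = (1 - q ^ R) / (1 - q)" using q by (subst sum_gp_strict) auto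
    also have "q * \<dots> \<le> q * (1 / (1 - q))" using q by (intro mult_left_mono divide_right_mono) auto
    finally show ?thesis by simp
  qed
  have split: "{- int R..int R} = {0} \<union> (int ` {1..R} \<union> (\<lambda>k. - int k) ` {1..R})"
  proof (intro equalityI subsetI)
    fix k assume k: "k \<in> {- int R..int R}"
    consider "k = 0" | "k > 0" | "k < 0" by linarith
    thus "k \<in> {0} \<union> (int ` {1..R} \<union> (\<lambda>k. - int k) ` {1..R})"
    proof cases
      case 2 thus ?thesis using k by (intro UnI2 UnI1 image_eqI[of _ _ "nat k"]) auto
    next
      case 3 thus ?thesis using k by (intro UnI2 image_eqI[of _ _ "nat (-k)"]) auto
    qed auto
  qed auto
  have "(\<Sum>k = - int R..int R. exp (- a * real_of_int \<bar>k\<bar>)) =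
     1 + ((\<Sum>k\<in>int ` {1..R}. exp (- a * real_of_int \<bar>k\<bar>)) + (\<Sum>k\<in>(\<lambda>k. - int k) ` {1..R}. exp (- a * real_of_int \<bar>k\<bar>)))"
    unfolding split by (subst sum.union_disjoint, force, force, force)+ simp
  also have "\<dots> = 1 + 2 * (\<Sum>k = 1..R. q ^ k)"
    by (subst (1 2) sum.reindex) (auto simp: inj_on_def e[simplified])
  also have "\<dots> \<le> 1 + 2 * (q / (1 - q))" by (intro add_left_mono mult_left_mono geo) auto
  also have "q / (1 - q) \<le> 1 / a" using q q' assms by (simp add: field_simps)
  also have "1 + 2 * (1 / a) \<le> 3 / a" using assms by (simp add: field_simps)
  finally show ?thesis by simp
qed

text \<open>The exponential of the \<open>\<ell>\<^sup>1\<close> norm is a product over coordinates,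
  so after enlarging the ball to a box the sum factorises. The bound is uniform in \<open>R\<close>;
  it is the only counting of lattice points used below.\<close>

lemma sum_lnorm_exp_le:
  fixes R :: nat
  assumes "0 < a" "a \<le> 1"
  shows "(\<Sum>y | lnorm (y :: int ^ 'd) \<le> R. exp (- a * real (lnorm y))) \<le> (3 / a) ^ CARD('d)"
proof -
  have inj: "inj_on vec_lambda A" for A :: "('d \<Rightarrow> int) set"
    by (auto simp: inj_on_def vec_lambda_inject)
  have "(\<Sum>y | lnorm (y :: int ^ 'd) \<le> R. exp (- a * real (lnorm y))) \<le>
        (\<Sum>y\<in>(lbox R :: (int ^ 'd) set). exp (- a * real (lnorm y)))"
    by (intro sum_mono2 lnorm_le_subset_lbox) auto
  also have "\<dots> = (\<Sum>g\<in>PiE UNIV (\<lambda>_::'d. {- int R..int R}). exp (- a * real (lnorm (vec_lambda g))))"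
    unfolding lbox_eq_image by (subst sum.reindex[OF inj]) (simp add: o_def)
  also have "\<dots> = (\<Sum>g\<in>PiE UNIV (\<lambda>_::'d. {- int R..int R}). \<Prod>i\<in>UNIV. exp (- a * real_of_int \<bar>g i\<bar>))"
    by (intro sum.cong refl) (simp add: real_lnorm sum_distrib_left flip: exp_sum)
  also have "\<dots> = (\<Prod>i\<in>(UNIV::'d set). \<Sum>k = - int R..int R. exp (- a * real_of_int \<bar>k\<bar>))"
    by (subst prod_sum_PiE) auto
  also have "\<dots> = (\<Sum>k = - int R..int R. exp (- a * real_of_int \<bar>k\<bar>)) ^ CARD('d)"
    by simp
  also have "\<dots> \<le> (3 / a) ^ CARD('d)"
    using sum_int_exp_le[OF assms, of R] by (intro power_mono sum_nonneg) auto
  finally show ?thesis .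
qed

section \<open>Weights along vertex lists, and loop erasure\<close>

fun walk_wt :: "('v \<Rightarrow> 'v \<Rightarrow> real) \<Rightarrow> 'v list \<Rightarrow> real" where
  "walk_wt f (x # y # zs) = f x y + walk_wt f (y # zs)"
| "walk_wt f _ = 0"

lemma walk_wt_conv_sum: "walk_wt f p = (\<Sum>i<length p - 1. f (p ! i) (p ! Suc i))"
proof (induction f p rule: walk_wt.induct)
  case (1 f x y zs)
  show ?case unfolding walk_wt.simps 1
    by (simp add: sum.lessThan_Suc_shift del: sum.lessThan_Suc)
qed auto

lemma path_weight_eq: "path_weight r w p = walk_wt (edge_weight r w) p"
  by (simp add: path_weight_def walk_wt_conv_sum)

lemma walk_wt_join:
  "p \<noteq> [] \<Longrightarrow> q \<noteq> [] \<Longrightarrow> last p = hd q \<Longrightarrow> walk_wt f (p @ tl q) = walk_wt f p + walk_wt f q"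
proof (induction f p rule: walk_wt.induct)
  case ("2_2" f v)
  thus ?case by (cases q) auto
qed auto

lemma walk_wt_nonneg:
  assumes "successively (\<noteq>) p" "\<And>x y. x \<noteq> y \<Longrightarrow> f x y \<ge> 0"
  shows "walk_wt f p \<ge> 0"
  using assms by (induction f p rule: walk_wt.induct) auto

lemma walk_wt_mono:
  assumes "successively (\<noteq>) p" "\<And>x y. x \<noteq> y \<Longrightarrow> f x y \<le> g x y"
  shows "walk_wt f p \<le> walk_wt g p"
  using assms by (induction f p rule: walk_wt.induct) (auto intro: add_mono)

lemma walk_wt_map: "walk_wt f (map h p) = walk_wt (\<lambda>x y. f (h x) (h y)) p"
  by (induction "\<lambda>x y. f (h x) (h y)" p rule: walk_wt.induct) auto

lemma walk_wt_rev:
  assumes "\<And>x y. f x y = f y x"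
  shows "walk_wt f (rev p) = walk_wt f p"
proof (induction p rule: induct_list012)
  case (3 x y zs)
  have "walk_wt f (rev (x # y # zs)) = walk_wt f (rev (y # zs) @ tl [y, x])" by simp
  also have "\<dots> = walk_wt f (rev (y # zs)) + walk_wt f [y, x]"
    by (subst walk_wt_join) auto
  finally show ?case using 3 assms[of x y] by simp
qed auto

lemma is_path_alt: "is_path p a b \<longleftrightarrow> p \<noteq> [] \<and> hd p = a \<and> last p = b \<and> successively (\<noteq>) p"
  by (auto simp: is_path_def successively_conv_nth)

lemma is_path_join: "is_path p a b \<Longrightarrow> is_path q b c \<Longrightarrow> is_path (p @ tl q) a c"
  unfolding is_path_alt
  by (cases q) (auto simp: successively_append_iff successively_Cons last_ConsR split: if_splits)

lemma is_path_single [simp]: "is_path [a] a a"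
  by (simp add: is_path_alt)

lemma is_path_exists: "\<exists>p. is_path p a b"
proof (cases "a = b")
  case True thus ?thesis by (auto intro: exI[of _ "[a]"])
next
  case False
  hence "is_path [a, b] a b" by (simp add: is_path_alt)
  thus ?thesis by blast
qed

lemma is_path_rev: "is_path p a b \<Longrightarrow> is_path (rev p) b a"
proof -
  have "successively (\<noteq>) (rev p)" if "successively (\<noteq>) p" for p :: "(int ^ 'd) list"
  proof -
    have "successively (\<lambda>x y. y \<noteq> x) p"
      using that by (rule successively_mono) auto
    thus ?thesis by (simp add: successively_rev)
  qed
  thus "is_path p a b \<Longrightarrow> is_path (rev p) b a"
    by (auto simp: is_path_alt hd_rev last_rev)
qed

lemma is_path_translate: "is_path p a b \<Longrightarrow> is_path (map (\<lambda>x. x + v) p) (a + v) (b + v)"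
  by (auto simp: is_path_alt successively_map hd_map last_map)

text \<open>Loop erasure: cutting out the closed stretch between two visits to a vertex cannot raise
  a nonnegative weight. Distinct vertices make the edges of a path distinct, hence their weights
  independent, when chains of cheap edges are counted.\<close>

lemma exists_distinct_path:
  assumes "is_path p a b" "\<And>x y. x \<noteq> y \<Longrightarrow> f x y \<ge> 0"
  shows "\<exists>q. is_path q a b \<and> distinct q \<and> walk_wt f q \<le> walk_wt f p"
  using assms(1)
proof (induction "length p" arbitrary: p rule: less_induct)
  case less
  show ?case
  proof (cases "distinct p")
    case False
    then obtain xs ys zs y where p: "p = xs @ [y] @ ys @ [y] @ zs"
      using not_distinct_decomp by blast
    define q where "q = xs @ [y] @ zs"
    have q: "is_path q a b"
      using less.prems unfolding p q_def is_path_alt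
      by (cases xs; cases ys; cases zs)
         (auto simp: successively_append_iff successively_Cons hd_append split: if_splits)
    have s: "successively (\<noteq>) ((y # ys) @ [y])" using less.prems unfolding p is_path_alt
      by (cases ys) (auto simp: successively_append_iff successively_Cons hd_append split: if_splits)
    have "walk_wt f p = walk_wt f ((xs @ [y]) @ tl (((y # ys) @ [y]) @ tl (y # zs)))"
      by (simp add: p)
    also have "\<dots> = walk_wt f (xs @ [y]) + (walk_wt f ((y # ys) @ [y]) + walk_wt f (y # zs))"
      by (subst walk_wt_join, force, force, force, subst walk_wt_join) auto
    also have "\<dots> = walk_wt f q + walk_wt f ((y # ys) @ [y])"
      using walk_wt_join[of "xs @ [y]" "y # zs" f] by (simp add: q_def)
    finally have "walk_wt f q \<le> walk_wt f p"
      using walk_wt_nonneg[OF s, of f] assms(2) by simp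
    moreover have "length q < length p" by (simp add: p q_def)
    ultimately show ?thesis using less.hyps[of q] q by (meson order_trans)
  qed (use less.prems in blast)
qed

section \<open>Passage times and the space of configurations\<close>

text \<open>The absolute values are almost surely superfluous; they make the subadditivity of \<open>fpt\<close> hold for
  every configuration instead of almost every one.\<close>
definition fpt :: "(nat \<Rightarrow> real) \<Rightarrow> ((int ^ 'd) set \<Rightarrow> real) \<Rightarrow> int ^ 'd \<Rightarrow> int ^ 'd \<Rightarrow> real" where
  "fpt r w = passage_time r (\<lambda>e. \<bar>w e\<bar>)"

definition cost :: "(nat \<Rightarrow> real) \<Rightarrow> ((int ^ 'd) set \<Rightarrow> real) \<Rightarrow> int ^ 'd \<Rightarrow> int ^ 'd \<Rightarrow> real" where
  "cost r w = edge_weight r (\<lambda>e. \<bar>w e\<bar>)"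

lemma cost_alt: "cost r w x y = \<bar>w {x, y}\<bar> / r (lnorm (x - y))"
  by (simp add: cost_def edge_weight_def lnorm_def)

lemma cost_commute: "cost r w x y = cost r w y x"
  by (simp add: cost_alt insert_commute lnorm_minus_commute)

lemma fpt_alt: "fpt r w a b = (INF p\<in>{p. is_path p a b}. walk_wt (cost r w) p)"
  by (simp add: fpt_def passage_time_def path_weight_eq cost_def image_Collect)

text \<open>The restriction keeps the translated configuration extensional, so that it is again a
  point of the product space.\<close>

definition shift :: "int ^ 'd \<Rightarrow> ((int ^ 'd) set \<Rightarrow> real) \<Rightarrow> ((int ^ 'd) set \<Rightarrow> real)" where
  "shift v w = (\<lambda>e\<in>lattice_edges. w ((\<lambda>x. x + v) ` e))"

lemma pair_in_lattice_edges [simp]: "{x, y} \<in> lattice_edges \<longleftrightarrow> x \<noteq> y"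
  by (auto simp: lattice_edges_def doubleton_eq_iff)

lemma translate_in_lattice_edges: "(\<lambda>x. x + v) ` e \<in> lattice_edges \<longleftrightarrow> e \<in> lattice_edges"
proof
  assume "e \<in> lattice_edges"
  then obtain x y where e: "e = {x, y}" "x \<noteq> y" by (auto simp: lattice_edges_def)
  thus "(\<lambda>x. x + v) ` e \<in> lattice_edges" by simp
next
  assume "(\<lambda>x. x + v) ` e \<in> lattice_edges"
  then obtain x y where e: "(\<lambda>x. x + v) ` e = {x, y}" "x \<noteq> y" by (auto simp: lattice_edges_def)
  have "e = (\<lambda>x. x - v) ` (\<lambda>x. x + v) ` e" by (simp add: image_image)
  thus "e \<in> lattice_edges" unfolding e using e by simp
qed

lemma inj_translate: "inj_on (\<lambda>e. (\<lambda>x. x + v) ` e) A" for v :: "int ^ 'd"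
  by (intro inj_onI) (simp add: inj_image_eq_iff)

text \<open>Isolates what the construction of the time constant uses: \<open>r 1 = 1\<close> gives
  nearest-neighbour edges the cost \<open>|w e|\<close>. Monotonicity and decay of \<open>r\<close>
  enter separately, in the positivity argument.\<close>

locale fpp_rate =
  fixes r :: "nat \<Rightarrow> real"
  assumes r_pos: "k \<ge> 1 \<Longrightarrow> r k > 0" and r_1: "r 1 = 1"
begin

lemma r_lnorm_pos: "x \<noteq> y \<Longrightarrow> r (lnorm (x - y)) > 0"
  using r_pos[of "lnorm (x - y)"] lnorm_pos_iff[of "x - y"] by simp

lemma cost_nonneg: "x \<noteq> y \<Longrightarrow> cost r w x y \<ge> 0"
  unfolding cost_alt using r_lnorm_pos[of x y] by simp

lemma walk_cost_nonneg: "is_path p a b \<Longrightarrow> walk_wt (cost r w) p \<ge> 0"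
  by (intro walk_wt_nonneg) (auto simp: is_path_alt cost_nonneg)

lemma fpt_le: "is_path p a b \<Longrightarrow> fpt r w a b \<le> walk_wt (cost r w) p"
  unfolding fpt_alt by (intro cINF_lower bdd_belowI2[of _ 0]) (auto simp: walk_cost_nonneg)

lemma fpt_greatest: "(\<And>p. is_path p a b \<Longrightarrow> c \<le> walk_wt (cost r w) p) \<Longrightarrow> c \<le> fpt r w a b"
  unfolding fpt_alt using is_path_exists[of a b] by (intro cINF_greatest) auto

lemma fpt_nonneg: "fpt r w a b \<ge> 0"
  by (intro fpt_greatest walk_cost_nonneg)

lemma fpt_lessE:
  assumes "fpt r w a b < c"
  obtains p where "is_path p a b" "distinct p" "walk_wt (cost r w) p < c"
proof -
  obtain q where q: "is_path q a b" "walk_wt (cost r w) q < c"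
    using fpt_greatest[of a b c w] assms by (meson not_le)
  from exists_distinct_path[OF q(1), of "cost r w"] cost_nonneg q(2) that show ?thesis
    by (metis order_le_less_trans)
qed

lemma fpt_self [simp]: "fpt r w a a = 0"
  using fpt_le[of "[a]" a a w] fpt_nonneg[of w a a] by simp

lemma fpt_triangle: "fpt r w a c \<le> fpt r w a b + fpt r w b c"
proof -
  have "fpt r w a c - fpt r w b c \<le> walk_wt (cost r w) p" if p: "is_path p a b" for p
  proof -
    have "fpt r w a c - walk_wt (cost r w) p \<le> walk_wt (cost r w) q" if q: "is_path q b c" for q
      using fpt_le[OF is_path_join[OF p q], of w] p q
      by (subst (asm) walk_wt_join) (auto simp: is_path_alt)
    thus ?thesis using fpt_greatest[of b c "fpt r w a c - walk_wt (cost r w) p" w] by force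
  qed
  thus ?thesis using fpt_greatest[of a b "fpt r w a c - fpt r w b c" w] by force
qed

lemma fpt_commute: "fpt r w a b = fpt r w b a"
proof -
  have "fpt r w a b \<le> fpt r w b a" for a b
    using fpt_le[OF is_path_rev, of _ b a w]
    by (intro fpt_greatest) (simp add: walk_wt_rev[OF cost_commute])
  thus ?thesis by (simp add: antisym)
qed

lemma walk_wt_shift:
  "is_path p a b \<Longrightarrow> walk_wt (cost r (shift v w)) p = walk_wt (cost r w) (map (\<lambda>x. x + v) p)"
  unfolding walk_wt_map is_path_alt
  \<comment> \<open>Two inequalities in place of a congruence: \<open>shift\<close> agrees with
    translation only on genuine edges, and \<open>walk_wt_mono\<close> compares weights only
    there.\<close>
  by (intro order_antisym walk_wt_mono) (auto simp: cost_alt shift_def)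

lemma fpt_shift: "fpt r (shift v w) a b = fpt r w (a + v) (b + v)"
proof (rule antisym)
  show "fpt r w (a + v) (b + v) \<le> fpt r (shift v w) a b"
    by (rule fpt_greatest) (auto simp: walk_wt_shift intro!: fpt_le is_path_translate)
  show "fpt r (shift v w) a b \<le> fpt r w (a + v) (b + v)"
  proof (rule fpt_greatest)
    fix p assume p: "is_path p (a + v) (b + v)"
    define q where "q = map (\<lambda>x. x + (- v)) p"
    have q: "is_path q a b" using is_path_translate[OF p, of "- v"] by (simp add: q_def)
    have "map (\<lambda>x. x + v) q = p" by (simp add: q_def o_def)
    thus "fpt r (shift v w) a b \<le> walk_wt (cost r w) p"
      using fpt_le[OF q, of "shift v w"] walk_wt_shift[OF q, of v w] by simp
  qed
qed

end

section \<open>The product space of edge weights and its translations\<close>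

definition edge_law :: "real measure" where
  "edge_law = density lborel (exponential_density 1)"

definition conf :: "((int ^ 'd) set \<Rightarrow> real) measure" where
  "conf = PiM lattice_edges (\<lambda>_. edge_law)"

lemma sets_edge_law [simp, measurable_cong]: "sets edge_law = sets borel"
  by (simp add: edge_law_def)

lemma space_edge_law [simp]: "space edge_law = UNIV"
  by (simp add: edge_law_def)

lemma prob_space_edge_law: "prob_space edge_law"
  unfolding edge_law_def by (rule prob_space_exponential_density) simp

interpretation edge_law: prob_space edge_law by (rule prob_space_edge_law)

interpretation conf_prod: product_prob_space "\<lambda>_. edge_law" "lattice_edges :: (int ^ 'd) set set"
  by unfold_locales

lemma prob_space_conf: "prob_space conf"
  unfolding conf_def by (rule prob_space_PiM) (rule prob_space_edge_law)

interpretation conf: prob_space "conf :: ((int ^ 'd) set \<Rightarrow> real) measure"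
  by (rule prob_space_conf)

lemma space_conf: "space conf = PiE lattice_edges (\<lambda>_. UNIV)"
  by (simp add: conf_def space_PiM)

lemma measurable_coord [measurable]: "e \<in> lattice_edges \<Longrightarrow> (\<lambda>w. w e) \<in> borel_measurable conf"
proof -
  assume "e \<in> lattice_edges"
  hence "(\<lambda>w. w e) \<in> measurable conf edge_law"
    unfolding conf_def by (rule measurable_component_singleton)
  thus ?thesis by (simp cong: measurable_cong_sets)
qed

lemma measurable_cost: "x \<noteq> y \<Longrightarrow> (\<lambda>w. cost r w x y) \<in> borel_measurable conf"
  unfolding cost_alt by measurable

lemma measurable_walk_wt:
  assumes "successively (\<noteq>) p" "\<And>x y. x \<noteq> y \<Longrightarrow> (\<lambda>w. f w x y) \<in> borel_measurable M"
  shows "(\<lambda>w. walk_wt (f w) p) \<in> borel_measurable M"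
  using assms(1) by (induction p rule: induct_list012) (auto intro!: borel_measurable_add assms(2))

lemma measurable_passage_time:
  assumes "\<And>x y. x \<noteq> y \<Longrightarrow> (\<lambda>s. edge_weight r (w s) x y) \<in> borel_measurable M"
  shows "(\<lambda>s. passage_time r (w s) a b) \<in> borel_measurable M"
proof -
  have "(\<lambda>s. INF p\<in>{p. is_path p a b}. walk_wt (edge_weight r (w s)) p) \<in> borel_measurable M"
    by (intro borel_measurable_cINF_real countable_Collect measurable_walk_wt assms)
       (auto simp: is_path_alt intro: countableI_type)
  thus ?thesis by (simp add: passage_time_def path_weight_eq image_Collect)
qed

lemma measurable_fpt [measurable]: "(\<lambda>w. fpt r w a b) \<in> borel_measurable conf"
  unfolding fpt_def
  by (rule measurable_passage_time) (use measurable_cost[of _ _ r] in \<open>simp add: cost_def\<close>)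

lemma measurable_shift [measurable]: "shift v \<in> measurable conf conf"
  unfolding shift_def[abs_def] conf_def
  by (intro measurable_restrict measurable_component_singleton)
     (simp add: translate_in_lattice_edges)

lemma distr_shift: "distr conf conf (shift v) = conf"
  using distr_PiM_reindex[of lattice_edges "\<lambda>_. edge_law" "\<lambda>e. (\<lambda>x. x + v) ` e" lattice_edges]
  by (auto simp: conf_def shift_def[abs_def] inj_translate translate_in_lattice_edges prob_space_edge_law)

lemma integral_shift:
  fixes f :: "((int ^ 'd) set \<Rightarrow> real) \<Rightarrow> real"
  assumes [measurable]: "f \<in> borel_measurable conf"
  shows "(\<integral>w. f (shift v w) \<partial>conf) = (\<integral>w. f w \<partial>conf)"
  by (subst (2) distr_shift[of v, symmetric], subst integral_distr) auto

lemma integrable_shift: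
  fixes f :: "((int ^ 'd) set \<Rightarrow> real) \<Rightarrow> real"
  assumes "integrable conf f"
  shows "integrable conf (\<lambda>w. f (shift v w))"
  using assms by (intro integrable_distr[OF measurable_shift]) (simp add: distr_shift)

lemma measure_shift:
  assumes "{w \<in> space conf. P w} \<in> sets conf"
  shows "measure conf {w \<in> space conf. P (shift v w)} = measure conf {w \<in> space conf. P w}"
proof -
  have "measure conf {w \<in> space conf. P w} = measure (distr conf conf (shift v)) {w \<in> space conf. P w}"
    by (simp add: distr_shift)
  also have "\<dots> = measure conf (shift v -` {w \<in> space conf. P w} \<inter> space conf)"
    using assms by (intro measure_distr) auto
  also have "shift v -` {w \<in> space conf. P w} \<inter> space conf = {w \<in> space conf. P (shift v w)}"
    using measurable_space[OF measurable_shift] by auto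
  finally show ?thesis by simp
qed

lemma lattice_edges_nonempty: "(lattice_edges :: (int ^ 'd) set set) \<noteq> {}"
proof -
  have "(0 :: int ^ 'd) \<noteq> 1" by (simp add: vec_eq_iff)
  thus ?thesis using pair_in_lattice_edges by blast
qed

lemma indep_coords: "conf.indep_vars (\<lambda>_. borel) (\<lambda>e w. w e) (lattice_edges :: (int ^ 'd) set set)"
proof -
  have m: "(\<lambda>w. w e) \<in> measurable conf edge_law" if "e \<in> lattice_edges" for e :: "(int ^ 'd) set"
    using measurable_coord[OF that] by (simp cong: measurable_cong_sets)
  \<comment> \<open>Restricting a configuration to the edges is the shift by 0.\<close>
  have "distr conf conf (\<lambda>w. \<lambda>e\<in>lattice_edges. w e) = (conf :: ((int ^ 'd) set \<Rightarrow> real) measure)"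
    using distr_shift[of "0 :: int ^ 'd"] by (simp add: shift_def[abs_def])
  also have "\<dots> = PiM lattice_edges (\<lambda>e. distr conf edge_law (\<lambda>w. w e))"
    unfolding conf_def by (intro PiM_cong refl conf_prod.PiM_component[symmetric])
  finally have "conf.indep_vars (\<lambda>_. edge_law) (\<lambda>e w. w e) (lattice_edges :: (int ^ 'd) set set)"
    using m lattice_edges_nonempty
    by (subst conf.indep_vars_iff_distr_eq_PiM') (auto simp: conf_def)
  from conf.indep_vars_compose2[OF this, of "\<lambda>_ x. x" "\<lambda>_. borel"] show ?thesis
    by (auto simp: measurable_def)
qed

lemma indep_functionals:
  fixes f g :: "((int ^ 'd) set \<Rightarrow> real) \<Rightarrow> real"
  assumes "A \<inter> B = {}" "A \<subseteq> lattice_edges" "B \<subseteq> lattice_edges"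
    and "f \<in> borel_measurable (PiM A (\<lambda>_. borel))" "g \<in> borel_measurable (PiM B (\<lambda>_. borel))"
    and "\<And>w. f (restrict w A) = f w" "\<And>w. g (restrict w B) = g w"
  shows "conf.indep_var borel f borel g"
  using conf.indep_var_compose[OF conf.indep_var_restrict[OF indep_coords assms(1-3)] assms(4,5)] assms(6,7)
  by (simp add: o_def)

lemma nn_integral_edge_law_exp: "(\<integral>\<^sup>+x. ennreal (exp (\<bar>x\<bar> / 2)) \<partial>edge_law) = 2"
proof -
  have "(\<integral>\<^sup>+x. ennreal (exp (\<bar>x\<bar> / 2)) \<partial>edge_law) =
        (\<integral>\<^sup>+x. ennreal (exponential_density 1 x) * ennreal (exp (\<bar>x\<bar> / 2)) \<partial>lborel)"
    unfolding edge_law_def by (subst nn_integral_density) auto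
  \<comment> \<open>On the half-line, \<open>exp (- x) * exp (x / 2)\<close> is twice the
    exponential density of rate 1/2.\<close>
  also have "\<dots> = (\<integral>\<^sup>+x. ennreal 2 * ennreal (exponential_density (1/2) x) \<partial>lborel)"
    by (intro nn_integral_cong, subst (1 2) ennreal_mult[symmetric])
       (auto simp: exponential_density_def simp flip: exp_add)
  also have "\<dots> = ennreal 2 * (\<integral>\<^sup>+x. ennreal (exponential_density (1/2) x) \<partial>lborel)"
    by (intro nn_integral_cmult) auto
  also have "(\<integral>\<^sup>+x. ennreal (exponential_density (1/2) x) \<partial>lborel) = 1"
    using prob_space.emeasure_space_1[OF prob_space_exponential_density[of "1/2"]]
    by (simp add: emeasure_density)
  finally show ?thesis by simp
qed

lemma AE_edge_law_nonneg: "AE x in edge_law. x \<ge> 0"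
  unfolding edge_law_def by (subst AE_density) (auto simp: exponential_density_def)

lemma measure_edge_law_le:
  assumes "u \<ge> 0"
  shows "measure edge_law {x. \<bar>x\<bar> \<le> u} \<le> u"
proof -
  have "distributed edge_law lborel (\<lambda>x. x) (exponential_density 1)"
    unfolding distributed_def edge_law_def 
      by (auto simp: distr_id2 exponential_density_nonneg)
  from edge_law.exponential_distributedD_le[OF this assms]
  have "measure edge_law {x. x \<le> u} = 1 - exp (- u)" by simp
  also have "\<dots> \<le> u" using exp_ge_add_one_self[of "- u"] by simp
  finally have "measure edge_law {x. x \<le> u} \<le> u" .
  moreover have "measure edge_law {x. \<bar>x\<bar> \<le> u} \<le> measure edge_law {x. x \<le> u}"
    by (intro edge_law.finite_measure_mono) auto
  ultimately show ?thesis by linarith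
qed

lemma AE_conf_nonneg: "AE w in conf. \<forall>e\<in>(lattice_edges :: (int ^ 'd) set set). w e \<ge> 0"
proof -
  have "lattice_edges \<subseteq> range (\<lambda>(x, y). {x, y :: int ^ 'd})"
    by (auto simp: lattice_edges_def)
  hence "countable (lattice_edges :: (int ^ 'd) set set)"
    by (rule countable_subset) auto
  moreover have "AE w in conf. w e \<ge> 0" if "e \<in> lattice_edges" for e :: "(int ^ 'd) set"
    unfolding conf_def using that AE_edge_law_nonneg by (rule conf_prod.AE_component)
  ultimately show ?thesis by (subst AE_ball_countable) auto
qed

lemma AE_fpt_eq: "AE w in conf. \<forall>a b. passage_time r w a b = fpt r w a b"
proof -
  have "passage_time r w a b = fpt r w a b" if w: "\<forall>e\<in>lattice_edges. w e \<ge> 0" for w and a b :: "int ^ 'd"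
  proof -
    have "walk_wt (edge_weight r w) p = walk_wt (edge_weight r (\<lambda>e. \<bar>w e\<bar>)) p" if "is_path p a b" for p
      using that w by (intro order_antisym walk_wt_mono) (auto simp: is_path_alt edge_weight_def)
    thus ?thesis unfolding fpt_def passage_time_def path_weight_eq
      by (intro arg_cong[where f = Inf]) (metis (no_types, lifting))
  qed
  thus ?thesis by (intro eventually_mono[OF AE_conf_nonneg]) blast
qed

lemma measure_conf_finite:
  assumes "finite J" "J \<subseteq> (lattice_edges :: (int ^ 'd) set set)" "\<And>e. e \<in> J \<Longrightarrow> u e \<ge> 0"
  shows "measure conf {w \<in> space conf. \<forall>e\<in>J. \<bar>w e\<bar> \<le> u e} \<le> (\<Prod>e\<in>J. u e)"
proof -
  have "{w \<in> space conf. \<forall>e\<in>J. \<bar>w e\<bar> \<le> u e} =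
        prod_emb lattice_edges (\<lambda>_. edge_law) J (PiE J (\<lambda>e. {x. \<bar>x\<bar> \<le> u e}))"
    using assms(2) by (auto simp: prod_emb_def space_conf PiE_iff extensional_def)
  hence "measure conf {w \<in> space conf. \<forall>e\<in>J. \<bar>w e\<bar> \<le> u e} = (\<Prod>e\<in>J. measure edge_law {x. \<bar>x\<bar> \<le> u e})"
    unfolding conf_def using assms by (simp add: conf_prod.measure_PiM_emb)
  also have "\<dots> \<le> (\<Prod>e\<in>J. u e)"
    using assms by (intro prod_mono) (auto intro: measure_edge_law_le)
  finally show ?thesis .
qed

section \<open>Nearest-neighbour paths\<close>

lemma lattice_smult_0 [simp]: "lattice_smult 0 z = 0" "lattice_smult n 0 = 0"
  by (simp_all add: lattice_smult_def vec_eq_iff)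

lemma lattice_smult_Suc: "lattice_smult (Suc n) z = lattice_smult n z + z"
  by (simp add: lattice_smult_def vec_eq_iff algebra_simps)

lemma lattice_smult_add: "lattice_smult (m + n) z = lattice_smult m z + lattice_smult n z"
  by (simp add: lattice_smult_def vec_eq_iff algebra_simps)

lemma lattice_smult_mult: "lattice_smult (m * n) z = lattice_smult m (lattice_smult n z)"
  by (simp add: lattice_smult_def vec_eq_iff algebra_simps)

lemma lattice_smult_diff: "lattice_smult n (x - y) = lattice_smult n x - lattice_smult n y"
  by (simp add: lattice_smult_def vec_eq_iff algebra_simps)

lemma lnorm_smult: "lnorm (lattice_smult n z) = n * lnorm z"
proof -
  have "int (lnorm (lattice_smult n z)) = int (n * lnorm z)"
    by (simp add: lnorm_alt lattice_smult_def abs_mult sum_distrib_left)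
  thus ?thesis by linarith
qed

lemma lnorm_step:
  assumes "lnorm (x :: int ^ 'd) = Suc n"
  shows "\<exists>y. lnorm y = n \<and> lnorm (x - y) = 1"
proof -
  from assms have "x \<noteq> 0" by auto
  then obtain i where i: "x $ i \<noteq> 0" by (auto simp: vec_eq_iff)
  define y where "y = x - axis i (sgn (x $ i))"
  have s: "(\<Sum>j\<in>UNIV. \<bar>z $ j\<bar>) = \<bar>z $ i\<bar> + (\<Sum>j\<in>UNIV - {i}. \<bar>z $ j\<bar>)" for z :: "int ^ 'd"
    by (subst sum.remove[of UNIV i]) auto
  have "int (lnorm (x - y)) = 1"
    unfolding lnorm_alt s using i by (auto simp: y_def axis_def sgn_if)
  moreover have "int (lnorm y) = int n"
  proof -
    have "int (lnorm x) = \<bar>x $ i\<bar> + (\<Sum>j\<in>UNIV - {i}. \<bar>x $ j\<bar>)" unfolding lnorm_alt s ..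
    moreover have "int (lnorm y) = \<bar>x $ i - sgn (x $ i)\<bar> + (\<Sum>j\<in>UNIV - {i}. \<bar>x $ j\<bar>)"
      unfolding lnorm_alt s by (intro arg_cong2[where f = "(+)"] sum.cong) (auto simp: y_def axis_def)
    moreover have "\<bar>x $ i - sgn (x $ i)\<bar> = \<bar>x $ i\<bar> - 1" using i by (auto simp: sgn_if)
    ultimately show ?thesis using assms by simp
  qed
  ultimately show ?thesis by (intro exI[of _ y]) simp
qed

text \<open>The path is built backwards from \<open>x\<close> by lowering one coordinate at a time.
  The norms along it are recorded because those of the endpoints of an edge reveal its position: the
  edges are therefore distinct and their weights independent.\<close>

lemma nn_path_exists:
  "\<exists>p. is_path p 0 x \<and> length p = Suc (lnorm x) \<and> (\<forall>i<length p. lnorm (p ! i) = i) \<and>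
     (\<forall>i. Suc i < length p \<longrightarrow> lnorm (p ! i - p ! Suc i) = 1)"
proof (induction "lnorm x" arbitrary: x)
  case 0
  thus ?case by (intro exI[of _ "[0]"]) auto
next
  case (Suc n)
  from lnorm_step[OF Suc.hyps(2)[symmetric]] obtain y where y: "lnorm y = n" "lnorm (x - y) = 1" by blast
  from Suc.hyps(1)[of y] y(1) obtain p where p: "is_path p 0 y" "length p = Suc n"
    "\<And>i. i < length p \<Longrightarrow> lnorm (p ! i) = i"
    "\<And>i. Suc i < length p \<Longrightarrow> lnorm (p ! i - p ! Suc i) = 1" by auto
  have l: "p ! n = y" using p(1,2) by (auto simp: is_path_def last_conv_nth)
  have "x \<noteq> y" using y by auto
  hence "is_path (p @ [x]) 0 x"
    using p(1) by (auto simp: is_path_alt successively_append_iff)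
  moreover have "lnorm ((p @ [x]) ! i) = i" if "i < length (p @ [x])" for i
    using that p(2,3) Suc.hyps(2) by (auto simp: nth_append less_Suc_eq)
  moreover have "lnorm ((p @ [x]) ! i - (p @ [x]) ! Suc i) = 1" if "Suc i < length (p @ [x])" for i
    using that p(2,4) l y(2) by (auto simp: nth_append less_Suc_eq lnorm_minus_commute[of x y])
  ultimately show ?case using p(2) Suc.hyps(2)
    by (intro exI[of _ "p @ [x]"]) simp
qed

lemma (in fpp_rate) fpt_le_nn_sum:
  "\<exists>J. finite J \<and> J \<subseteq> lattice_edges \<and> card J = lnorm x \<and> (\<forall>w. fpt r w 0 x \<le> (\<Sum>e\<in>J. \<bar>w e\<bar>))"
proof -
  obtain p where p: "is_path p 0 x" "length p = Suc (lnorm x)"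
    "\<And>i. i < length p \<Longrightarrow> lnorm (p ! i) = i"
    "\<And>i. Suc i < length p \<Longrightarrow> lnorm (p ! i - p ! Suc i) = 1"
    using nn_path_exists[of x] by blast
  define e where "e = (\<lambda>i. {p ! i, p ! Suc i})"
  have inj: "inj_on e {..<lnorm x}"
  proof (rule inj_onI)
    fix i j assume ij: "i \<in> {..<lnorm x}" "j \<in> {..<lnorm x}" "e i = e j"
    have "lnorm ` e i = {i, Suc i}" if "i < lnorm x" for i
      using p(2) p(3)[of i] p(3)[of "Suc i"] that by (simp add: e_def)
    hence "{i, Suc i} = {j, Suc j}" using ij by (metis lessThan_iff)
    thus "i = j" by (auto simp: doubleton_eq_iff)
  qed
  have "fpt r w 0 x \<le> (\<Sum>e\<in>e ` {..<lnorm x}. \<bar>w e\<bar>)" for w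
  proof -
    have "fpt r w 0 x \<le> (\<Sum>i<lnorm x. cost r w (p ! i) (p ! Suc i))"
      using fpt_le[OF p(1), of w] p(2) by (simp add: walk_wt_conv_sum)
    also have "\<dots> = (\<Sum>i<lnorm x. \<bar>w (e i)\<bar>)"
      using p(2,4) r_1 by (intro sum.cong) (auto simp: cost_alt e_def)
    also have "\<dots> = (\<Sum>e\<in>e ` {..<lnorm x}. \<bar>w e\<bar>)"
      by (subst sum.reindex[OF inj]) simp
    finally show ?thesis .
  qed
  moreover have "e ` {..<lnorm x} \<subseteq> lattice_edges"
    using p(1,2) by (auto simp: e_def is_path_def)
  ultimately show ?thesis using inj by (intro exI[of _ "e ` {..<lnorm x}"]) (auto simp: card_image)
qed

lemma nn_integral_conf_exp:
  assumes "e \<in> lattice_edges"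
  shows "(\<integral>\<^sup>+w. ennreal (exp (\<bar>w e\<bar> / 2)) \<partial>conf) = 2"
proof -
  have "(\<integral>\<^sup>+w. ennreal (exp (\<bar>w e\<bar> / 2)) \<partial>conf) =
        (\<integral>\<^sup>+x. ennreal (exp (\<bar>x\<bar> / 2)) \<partial>distr conf edge_law (\<lambda>w. w e))"
    using measurable_coord[OF assms] by (subst nn_integral_distr) (auto cong: measurable_cong_sets)
  also have "distr conf edge_law (\<lambda>w. w e) = edge_law"
    unfolding conf_def by (rule conf_prod.PiM_component[OF assms])
  finally show ?thesis by (simp add: nn_integral_edge_law_exp)
qed

lemma integrable_conf_exp:
  assumes "e \<in> lattice_edges"
  shows "integrable conf (\<lambda>w. exp (\<bar>w e\<bar> / 2))"
  using assms nn_integral_conf_exp[OF assms] by (intro integrableI_nonneg) (auto simp: measurable_coord)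

section \<open>Square-integrable functionals of the weights, and the tail of a passage time\<close>

definition sqint :: "(((int ^ 'd) set \<Rightarrow> real) \<Rightarrow> real) \<Rightarrow> bool" where
  "sqint f \<longleftrightarrow> f \<in> borel_measurable conf \<and> integrable conf (\<lambda>w. (f w)\<^sup>2)"

lemma sqint_measurable: "sqint f \<Longrightarrow> f \<in> borel_measurable conf"
  by (simp add: sqint_def)

lemma sqint_integrable: "sqint f \<Longrightarrow> integrable conf f"
  unfolding sqint_def by (blast intro: conf.square_integrable_imp_integrable)

lemma sqint_bounded:
  assumes "f \<in> borel_measurable conf" "sqint g" "\<And>w. \<bar>f w\<bar> \<le> \<bar>g w\<bar>"
  shows "sqint f"
  using assms unfolding sqint_def
  by (auto intro!: Bochner_Integration.integrable_bound[of conf "\<lambda>w. (g w)\<^sup>2" "\<lambda>w. (f w)\<^sup>2"]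
           simp: abs_le_square_iff)

lemma sqint_add: "sqint f \<Longrightarrow> sqint g \<Longrightarrow> sqint (\<lambda>w. f w + g w)"
proof -
  assume f: "sqint f" and g: "sqint g"
  have "(a + b)\<^sup>2 \<le> 2 * a\<^sup>2 + 2 * b\<^sup>2" for a b :: real
    using zero_le_power2[of "a - b"] by (simp add: power2_eq_square algebra_simps)
  moreover have "integrable conf (\<lambda>w. 2 * (f w)\<^sup>2 + 2 * (g w)\<^sup>2)"
    using f g by (auto simp: sqint_def)
  ultimately have "integrable conf (\<lambda>w. (f w + g w)\<^sup>2)"
    using f g by (elim Bochner_Integration.integrable_bound) (auto simp: sqint_def)
  thus ?thesis using f g by (auto simp: sqint_def intro!: borel_measurable_add)
qed

lemma sqint_const: "sqint (\<lambda>w. c)"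
  by (simp add: sqint_def)

lemma sqint_mult_const: "sqint f \<Longrightarrow> sqint (\<lambda>w. c * f w)"
  by (auto simp: sqint_def power_mult_distrib intro!: borel_measurable_times)

lemma sqint_shift: "sqint f \<Longrightarrow> sqint (\<lambda>w. f (shift v w))"
  unfolding sqint_def using integrable_shift[of "\<lambda>w. (f w)\<^sup>2" v]
  by (auto intro: measurable_compose[OF measurable_shift])

lemma sqint_coord:
  assumes "e \<in> lattice_edges"
  shows "sqint (\<lambda>w. \<bar>w e\<bar>)"
proof -
  \<comment> \<open>From \<open>1 + s + s\<^sup>2 / 2 \<le> exp s\<close> at
    \<open>s = |t| / 2\<close>.\<close>
  have b: "t\<^sup>2 \<le> 8 * exp (\<bar>t\<bar> / 2)" for t :: real
    using exp_lower_Taylor_quadratic[of "\<bar>t\<bar> / 2"] by (simp add: power2_eq_square abs_mult_self)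
  have "integrable conf (\<lambda>w. 8 * exp (\<bar>w e\<bar> / 2))"
    using integrable_conf_exp[OF assms] by simp
  hence "integrable conf (\<lambda>w. \<bar>w e\<bar>\<^sup>2)"
    by (rule Bochner_Integration.integrable_bound)
       (use assms b in \<open>auto simp: measurable_coord intro!: borel_measurable_power\<close>)
  thus ?thesis using assms by (simp add: sqint_def measurable_coord)
qed

context fpp_rate begin

lemma sqint_walk:
  assumes "successively (\<noteq>) p"
  shows "sqint (\<lambda>w. walk_wt (cost r w) p)"
  using assms
proof (induction p rule: induct_list012)
  case (3 x y zs)
  have "sqint (\<lambda>w. 1 / r (lnorm (x - y)) * \<bar>w {x, y}\<bar>)"
    using 3 by (intro sqint_mult_const sqint_coord) auto
  hence "sqint (\<lambda>w. cost r w x y)" by (simp add: cost_alt)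
  thus ?case using 3 by (auto intro: sqint_add)
qed (auto intro: sqint_const)

lemma sqint_fpt: "sqint (\<lambda>w. fpt r w a b)"
proof -
  obtain p where p: "is_path p a b" using is_path_exists by blast
  show ?thesis
    by (rule sqint_bounded[OF measurable_fpt sqint_walk[of p]])
       (use p fpt_le[OF p] in \<open>auto simp: is_path_alt fpt_nonneg walk_cost_nonneg[OF p]\<close>)
qed

text \<open>Exponential Markov inequality with parameter 1/2 along a nearest-neighbour path: its
  \<open>lnorm y\<close> weights are independent, and each contributes the exponential moment
  2.\<close>

lemma fpt_tail:
  "measure conf {w \<in> space conf. fpt r w a (a + y) > u} \<le> 2 ^ lnorm y * exp (- u / 2)"
proof -
  obtain J where J: "finite J" "J \<subseteq> lattice_edges" "card J = lnorm y"
    "\<And>w. fpt r w 0 y \<le> (\<Sum>e\<in>J. \<bar>w e\<bar>)"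
    using fpt_le_nn_sum[of y] by blast
  have [measurable]: "(\<lambda>w. \<bar>w e\<bar>) \<in> borel_measurable conf" if "e \<in> J" for e
    using measurable_coord[of e] that J by auto
  have ind: "conf.indep_vars (\<lambda>_. borel) (\<lambda>e w. ennreal (exp (\<bar>w e\<bar> / 2))) J"
    by (rule conf.indep_vars_compose2[OF conf.indep_vars_subset[OF indep_coords J(2)],
        of "\<lambda>_ x. ennreal (exp (\<bar>x\<bar> / 2))"]) simp
  have "measure conf {w \<in> space conf. fpt r w a (a + y) > u} =
        measure conf {w \<in> space conf. fpt r (shift a w) 0 y > u}"
    by (simp add: fpt_shift add.commute)
  also have "\<dots> = measure conf {w \<in> space conf. fpt r w 0 y > u}"
    by (rule measure_shift) measurable
  also have "ennreal \<dots> = emeasure conf {w \<in> space conf. fpt r w 0 y > u}"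
    by (simp add: conf.emeasure_eq_measure)
  also have "\<dots> \<le> emeasure conf {w \<in> space conf. 1 \<le> ennreal (exp (- u / 2)) * ennreal (exp ((\<Sum>e\<in>J. \<bar>w e\<bar>) / 2))}"
  proof (intro emeasure_mono)
    show "{w \<in> space conf. u < fpt r w 0 y} \<subseteq>
      {w \<in> space conf. 1 \<le> ennreal (exp (- u / 2)) * ennreal (exp ((\<Sum>e\<in>J. \<bar>w e\<bar>) / 2))}"
    proof clarify
      fix w assume "u < fpt r w 0 y"
      hence "0 \<le> - u / 2 + (\<Sum>e\<in>J. \<bar>w e\<bar>) / 2" using J(4)[of w] by simp
      hence "1 \<le> exp (- u / 2) * exp ((\<Sum>e\<in>J. \<bar>w e\<bar>) / 2)"
        by (simp flip: exp_add)
      thus "1 \<le> ennreal (exp (- u / 2)) * ennreal (exp ((\<Sum>e\<in>J. \<bar>w e\<bar>) / 2))"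
        by (simp flip: ennreal_mult)
    qed
  qed measurable
  also have "\<dots> \<le> ennreal (exp (- u / 2)) * (\<integral>\<^sup>+w. ennreal (exp ((\<Sum>e\<in>J. \<bar>w e\<bar>) / 2)) * indicator (space conf) w \<partial>conf)"
    by (rule order_trans[OF _ nn_integral_Markov_inequality]) (auto intro!: emeasure_mono)
  also have "(\<integral>\<^sup>+w. ennreal (exp ((\<Sum>e\<in>J. \<bar>w e\<bar>) / 2)) * indicator (space conf) w \<partial>conf) =
     (\<integral>\<^sup>+w. (\<Prod>e\<in>J. ennreal (exp (\<bar>w e\<bar> / 2))) \<partial>conf)"
    using J(1) by (intro nn_integral_cong) (simp add: prod_ennreal sum_divide_distrib exp_sum)
  also have "\<dots> = (\<Prod>e\<in>J. \<integral>\<^sup>+w. ennreal (exp (\<bar>w e\<bar> / 2)) \<partial>conf)"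
    by (rule conf.indep_vars_nn_integral[OF J(1) ind]) simp
  also have "\<dots> = (\<Prod>e\<in>J. 2)" using J(2) by (intro prod.cong) (auto intro: nn_integral_conf_exp)
  also have "\<dots> = ennreal (2 ^ lnorm y)" using J(3) by (simp flip: ennreal_power)
  finally show ?thesis by (simp add: mult.commute flip: ennreal_mult)
qed

text \<open>With slope 4, \<open>fpt_tail\<close> yields
  \<open>2 ^ l * exp (- 2 * l) \<le> exp (- l)\<close> at norm \<open>l\<close>, which is summable
  over the lattice, while \<open>\<eta> * n\<close> makes the union bound summable in
  \<open>n\<close>, so that Borel-Cantelli applies. The same 4 becomes the Lipschitz constant of the
  time constant.\<close>

lemma fpt_interpolation:
  fixes z :: "int ^ 'd"
  assumes "\<eta> > 0"
  shows "AE w in conf. \<forall>\<^sub>F n in sequentially. \<forall>y. lnorm y \<le> R * n \<longrightarrow>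
           fpt r w (lattice_smult n z) (lattice_smult n z + y) \<le> \<eta> * real n + 4 * real (lnorm y)"
proof -
  define B where "B = (\<lambda>n y. {w \<in> space conf. fpt r w (lattice_smult n z) (lattice_smult n z + y) > \<eta> * real n + 4 * real (lnorm y)})"
  define A where "A = (\<lambda>n. \<Union>y\<in>{y. lnorm y \<le> R * n}. B n y)"
  have [measurable]: "B n y \<in> sets conf" for n y unfolding B_def by measurable
  have [measurable]: "A n \<in> sets conf" for n unfolding A_def by (intro sets.finite_UN) auto
  have bound: "measure conf (A n) \<le> 3 ^ CARD('d) * exp (- \<eta> / 2) ^ n" for n
  proof -
    have "measure conf (A n) \<le> (\<Sum>y | lnorm y \<le> R * n. measure conf (B n y))"
      unfolding A_def by (intro conf.finite_measure_subadditive_finite) auto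
    also have "\<dots> \<le> (\<Sum>y | lnorm (y :: int ^ 'd) \<le> R * n. exp (- \<eta> / 2) ^ n * exp (- 1 * real (lnorm y)))"
    proof (intro sum_mono)
      fix y :: "int ^ 'd"
      have "measure conf (B n y) \<le> 2 ^ lnorm y * exp (- (\<eta> * real n + 4 * real (lnorm y)) / 2)"
        unfolding B_def by (rule fpt_tail)
      also have "\<dots> \<le> exp 1 ^ lnorm y * exp (- (\<eta> * real n + 4 * real (lnorm y)) / 2)"
        using exp_ge_add_one_self[of 1] by (intro mult_right_mono power_mono) auto
      also have "\<dots> = exp (- \<eta> / 2) ^ n * exp (- 1 * real (lnorm y))"
        by (simp flip: exp_of_nat_mult exp_add) (simp add: field_simps)
      finally show "measure conf (B n y) \<le> exp (- \<eta> / 2) ^ n * exp (- 1 * real (lnorm y))" .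
    qed
    also have "\<dots> = exp (- \<eta> / 2) ^ n * (\<Sum>y | lnorm (y :: int ^ 'd) \<le> R * n. exp (- 1 * real (lnorm y)))"
      by (simp add: sum_distrib_left)
    also have "\<dots> \<le> exp (- \<eta> / 2) ^ n * (3 / 1) ^ CARD('d)"
      by (intro mult_left_mono sum_lnorm_exp_le) auto
    finally show ?thesis by (simp add: mult.commute)
  qed
  have "summable (\<lambda>n. measure conf (A n))"
  proof (rule summable_comparison_test)
    show "summable (\<lambda>n. 3 ^ CARD('d) * exp (- \<eta> / 2) ^ n)"
      using assms by (intro summable_mult summable_geometric) auto
  qed (use bound in auto)
  hence "AE w in conf. \<forall>\<^sub>F n in sequentially. w \<in> space conf - A n"
    by (intro borel_cantelli_AE1) (auto simp: conf.emeasure_eq_measure)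
  thus ?thesis
    by (rule eventually_mono) (auto elim!: eventually_mono simp: A_def B_def not_less)
qed

end

section \<open>Upper bound by sums with finite-range dependence\<close>

text \<open>Covariances vanish at index distance at least \<open>D\<close>, so each index has at
  most \<open>2 * D\<close> partners, and by the inequality between arithmetic and geometric means
  every covariance is at most \<open>V\<close>.\<close>

lemma (in prob_space) finite_range_dependence_variance:
  fixes X :: "nat \<Rightarrow> 'a \<Rightarrow> real"
  assumes X [measurable]: "\<And>i. X i \<in> borel_measurable M"
    and int: "\<And>i. integrable M (\<lambda>s. (X i s)\<^sup>2)"
    and mean: "\<And>i. expectation (X i) = \<mu>"
    and sq: "\<And>i. expectation (\<lambda>s. (X i s)\<^sup>2) \<le> V"
    and indep: "\<And>i j. i + D \<le> j \<Longrightarrow> expectation (\<lambda>s. X i s * X j s) = \<mu>\<^sup>2"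
  shows "expectation (\<lambda>s. ((\<Sum>i<n. X i s) - real n * \<mu>)\<^sup>2) \<le> real n * (2 * real D * V)"
proof -
  define Z where "Z i s = X i s - \<mu>" for i s
  have iX: "integrable M (X i)" for i
    by (rule square_integrable_imp_integrable[OF X int])
  have prod_bound: "\<bar>a * b\<bar> \<le> (a\<^sup>2 + b\<^sup>2) / 2" for a b :: real
    using zero_le_power2[of "\<bar>a\<bar> - \<bar>b\<bar>"] by (simp add: power2_eq_square algebra_simps abs_mult)
  have iXX: "integrable M (\<lambda>s. X i s * X j s)" for i j
    by (rule Bochner_Integration.integrable_bound[of M "\<lambda>s. ((X i s)\<^sup>2 + (X j s)\<^sup>2) / 2"])
       (use prod_bound int in auto)
  have ZZ: "Z i s * Z j s = X i s * X j s - \<mu> * X i s - \<mu> * X j s + \<mu>\<^sup>2" for i j s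
    by (simp add: Z_def algebra_simps power2_eq_square)
  have iZZ: "integrable M (\<lambda>s. Z i s * Z j s)" for i j
    unfolding ZZ using iX iXX by auto
  have EZZ: "expectation (\<lambda>s. Z i s * Z j s) = expectation (\<lambda>s. X i s * X j s) - \<mu>\<^sup>2" for i j
    unfolding ZZ using iX[of i] iX[of j] iXX[of i j] mean
    by (simp add: prob_space power2_eq_square)
  have V: "V \<ge> 0" using sq[of 0] order_trans[OF _ sq[of 0]] by (auto intro: Bochner_Integration.integral_nonneg)
  have le: "expectation (\<lambda>s. Z i s * Z j s) \<le> V" for i j
  proof -
    have "expectation (\<lambda>s. X i s * X j s) \<le> expectation (\<lambda>s. ((X i s)\<^sup>2 + (X j s)\<^sup>2) / 2)"
      using abs_le_D1[OF prod_bound] int iXX by (intro integral_mono) auto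
    also have "\<dots> \<le> V" using int sq[of i] sq[of j] by simp
    finally show ?thesis unfolding EZZ using zero_le_power2[of \<mu>] by linarith
  qed
  have zero: "expectation (\<lambda>s. Z i s * Z j s) = 0" if "i + D \<le> j \<or> j + D \<le> i" for i j
    using that indep[of i j] indep[of j i] unfolding EZZ by (auto simp: mult.commute)
  have "(\<Sum>i<n. X i s) - real n * \<mu> = (\<Sum>i<n. Z i s)" for s
    by (simp add: Z_def sum_subtractf)
  hence "expectation (\<lambda>s. ((\<Sum>i<n. X i s) - real n * \<mu>)\<^sup>2) = expectation (\<lambda>s. \<Sum>i<n. \<Sum>j<n. Z i s * Z j s)"
    by (simp add: power2_eq_square sum_product)
  also have "\<dots> = (\<Sum>i<n. \<Sum>j<n. expectation (\<lambda>s. Z i s * Z j s))"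
    using iZZ by (simp add: Bochner_Integration.integral_sum)
  also have "\<dots> \<le> (\<Sum>i<n. 2 * real D * V)"
  proof (intro sum_mono)
    fix i
    define N where "N = {j. j < n \<and> i < j + D \<and> j < i + D}"
    have N: "N \<subseteq> {i + 1 - D..<i + D}" by (auto simp: N_def)
    have "card N \<le> card {i + 1 - D..<i + D}" by (intro card_mono N) auto
    also have "\<dots> \<le> 2 * D" by simp
    finally have cN: "real (card N) \<le> 2 * real D" by linarith
    have "(\<Sum>j<n. expectation (\<lambda>s. Z i s * Z j s)) = (\<Sum>j\<in>N. expectation (\<lambda>s. Z i s * Z j s))"
      by (intro sum.mono_neutral_right) (auto simp: N_def intro!: zero)
    also have "\<dots> \<le> real (card N) * V" using le by (intro sum_bounded_above) auto
    also have "\<dots> \<le> 2 * real D * V" using cN V by (intro mult_right_mono) auto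
    finally show "(\<Sum>j<n. expectation (\<lambda>s. Z i s * Z j s)) \<le> 2 * real D * V" .
  qed
  finally show ?thesis by simp
qed

section \<open>Functionals of the edges inside a vertex set\<close>

definition edges_in :: "(int ^ 'd) set \<Rightarrow> (int ^ 'd) set set" where
  "edges_in V = {e \<in> lattice_edges. e \<subseteq> V}"

text \<open>Locality is indexed by vertices, since translations act on them and disjoint vertex sets
  span disjoint edge sets. The two conjuncts are the form in which \<open>indep_functionals\<close>
  takes its arguments.\<close>

definition local_fun :: "(int ^ 'd) set \<Rightarrow> (((int ^ 'd) set \<Rightarrow> real) \<Rightarrow> real) \<Rightarrow> bool" where
  "local_fun V f \<longleftrightarrow> f \<in> borel_measurable (PiM (edges_in V) (\<lambda>_. borel)) \<and>
     (\<forall>w. f (restrict w (edges_in V)) = f w)"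

lemma edges_in_disjoint: "V \<inter> V' = {} \<Longrightarrow> edges_in V \<inter> edges_in V' = {}"
  by (fastforce simp: edges_in_def lattice_edges_def)

lemma local_fun_walk:
  assumes "successively (\<noteq>) p" "set p \<subseteq> V"
  shows "local_fun V (\<lambda>w. walk_wt (cost r w) p)"
  unfolding local_fun_def
proof
  show "(\<lambda>w. walk_wt (cost r w) p) \<in> borel_measurable (PiM (edges_in V) (\<lambda>_. borel))"
    using assms
  proof (induction p rule: induct_list012)
    case (3 x y zs)
    hence "{x, y} \<in> edges_in V" by (auto simp: edges_in_def)
    hence [measurable]: "(\<lambda>w. w {x, y}) \<in> borel_measurable (PiM (edges_in V) (\<lambda>_. borel))"
      by (rule measurable_component_singleton)
    have "(\<lambda>w. cost r w x y) \<in> borel_measurable (PiM (edges_in V) (\<lambda>_. borel))"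
      unfolding cost_alt by measurable
    thus ?case using 3 by (auto intro!: borel_measurable_add)
  qed auto
  show "\<forall>w. walk_wt (cost r (restrict w (edges_in V))) p = walk_wt (cost r w) p"
    using assms
    by (induction p rule: induct_list012) (auto simp: cost_alt edges_in_def)
qed

lemma local_fun_min: "local_fun V f \<Longrightarrow> local_fun V g \<Longrightarrow> local_fun V (\<lambda>w. min (f w) (g w))"
  by (auto simp: local_fun_def)

lemma local_fun_mono:
  assumes "local_fun V f" "V \<subseteq> V'"
  shows "local_fun V' f"
proof -
  have sub: "edges_in V \<subseteq> edges_in V'" using assms(2) by (auto simp: edges_in_def)
  have f: "f (restrict w (edges_in V)) = f w" for w using assms(1) by (simp add: local_fun_def)
  have "(\<lambda>w. f (restrict w (edges_in V))) \<in> borel_measurable (PiM (edges_in V') (\<lambda>_. borel))"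
    using assms(1) by (intro measurable_compose[OF measurable_restrict_subset[OF sub]]) (simp add: local_fun_def)
  moreover have "f (restrict w (edges_in V')) = f w" for w
    using f[of w] f[of "restrict w (edges_in V')"] sub by (simp add: Int_absorb1 restrict_restrict)
  ultimately show ?thesis by (simp add: local_fun_def f)
qed

lemma local_fun_shift:
  assumes "local_fun V f"
  shows "local_fun ((\<lambda>x. x + v) ` V) (\<lambda>w. f (shift v w))"
proof -
  let ?V' = "(\<lambda>x. x + v) ` V"
  have f: "f (restrict w (edges_in V)) = f w" for w using assms by (simp add: local_fun_def)
  have e: "(\<lambda>x. x + v) ` e \<in> edges_in ?V'" if "e \<in> edges_in V" for e
    using that by (auto simp: edges_in_def translate_in_lattice_edges)
  have s: "restrict (shift v w) (edges_in V) = (\<lambda>e\<in>edges_in V. w ((\<lambda>x. x + v) ` e))" for w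
    by (auto simp: shift_def edges_in_def fun_eq_iff)
  have "(\<lambda>w. f (\<lambda>e\<in>edges_in V. w ((\<lambda>x. x + v) ` e))) \<in> borel_measurable (PiM (edges_in ?V') (\<lambda>_. borel))"
  proof -
    have "(\<lambda>w. \<lambda>e\<in>edges_in V. w ((\<lambda>x. x + v) ` e)) \<in>
        measurable (PiM (edges_in ?V') (\<lambda>_. borel :: real measure)) (PiM (edges_in V) (\<lambda>_. borel))"
      using e by (intro measurable_restrict measurable_component_singleton)
    from measurable_compose[OF this, of f borel] show ?thesis
      using assms by (simp add: local_fun_def)
  qed
  moreover have "f (\<lambda>e\<in>edges_in V. w ((\<lambda>x. x + v) ` e)) = f (shift v w)" for w
    using f[of "shift v w"] by (simp add: s)
  moreover have "restrict (shift v (restrict w (edges_in ?V'))) (edges_in V) = restrict (shift v w) (edges_in V)" for w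
    unfolding s using e by (auto simp: fun_eq_iff)
  hence "f (shift v (restrict w (edges_in ?V'))) = f (shift v w)" for w
    using f by metis
  ultimately show ?thesis by (simp add: local_fun_def)
qed

lemma local_fun_indep:
  assumes "local_fun V f" "local_fun V' g" "V \<inter> V' = {}" "integrable conf f" "integrable conf g"
  shows "(\<integral>w. f w * g w \<partial>conf) = (\<integral>w. f w \<partial>conf) * (\<integral>w. g w \<partial>conf)"
proof (rule conf.indep_var_lebesgue_integral)
  show "conf.indep_var borel f borel g"
    using assms(1,2) edges_in_disjoint[OF assms(3)]
    by (intro indep_functionals[of "edges_in V" "edges_in V'"])
       (auto simp: local_fun_def edges_in_def)
qed fact+

text \<open>A common point of two translates would bound
  \<open>lnorm (lattice_smult (j - i) z)\<close>, which is at least \<open>j - i\<close>, by the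
  diameter of \<open>V\<close>.\<close>

lemma translates_disjoint:
  fixes V :: "(int ^ 'd) set"
  assumes "finite V" "z \<noteq> 0"
  shows "\<exists>D. \<forall>i j. i + D \<le> j \<longrightarrow>
    (\<lambda>x. x + lattice_smult i z) ` V \<inter> (\<lambda>x. x + lattice_smult j z) ` V = {}"
proof -
  define B where "B = Max (insert 0 ((\<lambda>(x, y). lnorm (x - y)) ` (V \<times> V)))"
  have B: "lnorm (x - y) \<le> B" if "x \<in> V" "y \<in> V" for x y
    unfolding B_def using that assms by (intro Max_ge) auto
  have "(\<lambda>x. x + lattice_smult i z) ` V \<inter> (\<lambda>x. x + lattice_smult j z) ` V = {}" if "i + Suc B \<le> j" for i j
  proof (rule ccontr)
    assume "\<not> ?thesis"
    then obtain x y where xy: "x \<in> V" "y \<in> V" "x + lattice_smult i z = y + lattice_smult j z" by auto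
    have "lattice_smult j z = lattice_smult i z + lattice_smult (j - i) z"
      using that by (simp flip: lattice_smult_add)
    with xy(3) have "x - y = lattice_smult (j - i) z" by (simp add: algebra_simps)
    hence "(j - i) * lnorm z \<le> B" using B[OF xy(1,2)] by (simp add: lnorm_smult)
    moreover have "j - i \<le> (j - i) * lnorm z"
      using assms(2) lnorm_pos_iff[of z] mult_le_mono2[of 1 "lnorm z" "j - i"] by simp
    ultimately show False using that by linarith
  qed
  thus ?thesis by blast
qed

lemma sqint_sum: "(\<And>i. i \<in> A \<Longrightarrow> sqint (f i)) \<Longrightarrow> sqint (\<lambda>w. \<Sum>i\<in>A. f i w)"
  by (induction A rule: infinite_finite_induct) (auto intro: sqint_const sqint_add)

context fpp_rate begin

lemma fpt_smult_le_sum: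
  "fpt r w 0 (lattice_smult n z) \<le> (\<Sum>i<n. fpt r (shift (lattice_smult i z) w) 0 z)"
proof (induction n)
  case (Suc n)
  have "fpt r w 0 (lattice_smult (Suc n) z) \<le>
        fpt r w 0 (lattice_smult n z) + fpt r w (lattice_smult n z) (lattice_smult (Suc n) z)"
    by (rule fpt_triangle)
  also have "fpt r w (lattice_smult n z) (lattice_smult (Suc n) z) = fpt r (shift (lattice_smult n z) w) 0 z"
    by (simp add: fpt_shift lattice_smult_Suc add.commute)
  finally show ?case using Suc by simp
qed simp

text \<open>There are countably many paths, so the minima over initial segments of an enumeration
  decrease to the infimum. Each minimum sees finitely many vertices, and dominated convergence, with
  the first path as majorant, carries the limit over to the means.\<close>

lemma local_approximation:
  assumes "\<eta> > 0"
  shows "\<exists>Y V. finite V \<and> local_fun V Y \<and> sqint Y \<and> (\<forall>w. fpt r w 0 z \<le> Y w) \<and>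
           (\<integral>w. Y w \<partial>conf) \<le> (\<integral>w. fpt r w 0 z \<partial>conf) + \<eta>"
proof -
  define P where "P = {p. is_path p 0 z}"
  have P: "P \<noteq> {}" "countable P" using is_path_exists[of 0 z] by (auto simp: P_def)
  define f where "f = from_nat_into P"
  have f: "is_path (f k) 0 z" for k using from_nat_into[OF P(1), of k] by (simp add: f_def P_def)
  have f_surj: "\<exists>k. f k = p" if "is_path p 0 z" for p
  proof -
    have "p \<in> range (from_nat_into P)" using range_from_nat_into[OF P] that by (simp add: P_def)
    thus ?thesis by (auto simp: f_def)
  qed
  define Y where "Y = rec_nat (\<lambda>w. walk_wt (cost r w) (f 0)) (\<lambda>k Yk w. min (Yk w) (walk_wt (cost r w) (f (Suc k))))"
  have Y0: "Y 0 w = walk_wt (cost r w) (f 0)" and YS: "Y (Suc k) w = min (Y k w) (walk_wt (cost r w) (f (Suc k)))" for k w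
    by (simp_all add: Y_def)
  define V where "V K = (\<Union>k\<le>K. set (f k))" for K
  have loc: "local_fun (V K) (Y K)" for K
  proof (induction K)
    case 0
    show ?case unfolding Y0[abs_def] V_def using f[of 0]
      by (intro local_fun_walk) (auto simp: is_path_alt)
  next
    case (Suc K)
    show ?case unfolding YS[abs_def]
    proof (intro local_fun_min local_fun_mono[OF Suc] local_fun_walk)
      show "V K \<subseteq> V (Suc K)" unfolding V_def by (intro UN_mono) auto
    qed (use f[of "Suc K"] in \<open>auto simp: is_path_alt V_def\<close>)
  qed
  have meas: "Y K \<in> borel_measurable conf" for K
  proof (induction K)
    case 0 show ?case unfolding Y0[abs_def] using f[of 0]
      by (intro measurable_walk_wt measurable_cost) (auto simp: is_path_alt)
  next
    case (Suc K) show ?case unfolding YS[abs_def] using f[of "Suc K"] Suc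
      by (intro borel_measurable_min measurable_walk_wt measurable_cost) (auto simp: is_path_alt)
  qed
  have le: "Y K w \<le> walk_wt (cost r w) (f k)" if "k \<le> K" for k K w
    using that by (induction K) (auto simp: Y0 YS le_Suc_eq min_le_iff_disj)
  have ge: "fpt r w 0 z \<le> Y K w" for K w
    by (induction K) (auto simp: Y0 YS intro: fpt_le f)
  have sq0: "sqint (Y 0)" unfolding Y0[abs_def] using f[of 0] by (intro sqint_walk) (auto simp: is_path_alt)
  have nn: "Y K w \<ge> 0" for K w using ge[of w K] fpt_nonneg[of w 0 z] by linarith
  have le0: "Y K w \<le> Y 0 w" for K w using le[of 0 K w] by (simp add: Y0)
  have sq: "sqint (Y K)" for K
    by (rule sqint_bounded[OF meas sq0]) (use nn le0 in auto)
  have lim: "(\<lambda>K. Y K w) \<longlonglongrightarrow> fpt r w 0 z" for w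
  proof (rule LIMSEQ_I)
    fix e :: real assume "e > 0"
    then obtain p where p: "is_path p 0 z" "walk_wt (cost r w) p < fpt r w 0 z + e"
      using fpt_lessE[of w 0 z "fpt r w 0 z + e"] by auto
    then obtain k where "f k = p" using f_surj by blast
    hence "norm (Y K w - fpt r w 0 z) < e" if "K \<ge> k" for K
      using le[OF that, of w] ge[of w K] p by auto
    thus "\<exists>no. \<forall>n\<ge>no. norm (Y n w - fpt r w 0 z) < e" by blast
  qed
  have "(\<lambda>K. \<integral>w. Y K w \<partial>conf) \<longlonglongrightarrow> (\<integral>w. fpt r w 0 z \<partial>conf)"
    by (rule integral_dominated_convergence[where w = "Y 0"])
       (use meas lim nn le0 sqint_integrable[OF sq0] in auto)
  hence "\<forall>\<^sub>F K in sequentially. (\<integral>w. Y K w \<partial>conf) < (\<integral>w. fpt r w 0 z \<partial>conf) + \<eta>"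
    using assms by (intro order_tendstoD) auto
  then obtain K where "(\<integral>w. Y K w \<partial>conf) < (\<integral>w. fpt r w 0 z \<partial>conf) + \<eta>"
    using eventually_happens trivial_limit_sequentially by blast
  thus ?thesis using loc[of K] sq[of K] ge by (intro exI[of _ "Y K"] exI[of _ "V K"]) (auto simp: V_def)
qed

text \<open>\<open>S n\<close> is the sum of \<open>n\<close> translates of one local functional
  with mean \<open>\<mu>\<close>. Monotonicity in \<open>n\<close> fills the gaps between squares in
  the almost sure upper bound; the mean-square estimate serves there and again in
  \<open>fpt_mean_on_event\<close>.\<close>

lemma block_sums:
  fixes z :: "int ^ 'd"
  assumes "\<eta> > 0" "z \<noteq> 0"
  shows "\<exists>S \<mu> V. (\<forall>n w. fpt r w 0 (lattice_smult n z) \<le> S n w) \<and> (\<forall>w. mono (\<lambda>n. S n w)) \<and>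
    (\<forall>n. sqint (S n)) \<and> (\<forall>n. (\<integral>w. (S n w - real n * \<mu>)\<^sup>2 \<partial>conf) \<le> real n * V) \<and>
    0 \<le> \<mu> \<and> \<mu> \<le> (\<integral>w. fpt r w 0 z \<partial>conf) + \<eta>"
proof -
  obtain Y V where Y: "finite V" "local_fun V Y" "sqint Y" "\<And>w. fpt r w 0 z \<le> Y w"
     "(\<integral>w. Y w \<partial>conf) \<le> (\<integral>w. fpt r w 0 z \<partial>conf) + \<eta>"
    using local_approximation[OF assms(1), of z] by blast
  obtain D where D: "\<And>i j. i + D \<le> j \<Longrightarrow>
     (\<lambda>x. x + lattice_smult i z) ` V \<inter> (\<lambda>x. x + lattice_smult j z) ` V = {}"
    using translates_disjoint[OF Y(1) assms(2)] by blast
  define X where "X i w = Y (shift (lattice_smult i z) w)" for i w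
  define \<mu> where "\<mu> = (\<integral>w. Y w \<partial>conf)"
  have nn: "Y w \<ge> 0" for w using Y(4)[of w] fpt_nonneg[of w 0 z] by linarith
  have sqX: "sqint (X i)" for i unfolding X_def[abs_def] by (rule sqint_shift[OF Y(3)])
  have mean: "(\<integral>w. X i w \<partial>conf) = \<mu>" for i
    unfolding X_def \<mu>_def by (rule integral_shift[OF sqint_measurable[OF Y(3)]])
  have "(\<integral>w. ((\<Sum>i<n. X i w) - real n * \<mu>)\<^sup>2 \<partial>conf) \<le> real n * (2 * real D * (\<integral>w. (Y w)\<^sup>2 \<partial>conf))" for n
  proof (rule conf.finite_range_dependence_variance)
    show "(\<integral>w. (X i w)\<^sup>2 \<partial>conf) \<le> (\<integral>w. (Y w)\<^sup>2 \<partial>conf)" for i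
      unfolding X_def using sqint_measurable[OF Y(3)] by (subst integral_shift[of "\<lambda>w. (Y w)\<^sup>2"]) auto
    show "(\<integral>w. X i w * X j w \<partial>conf) = \<mu>\<^sup>2" if "i + D \<le> j" for i j
    proof -
      have "(\<integral>w. X i w * X j w \<partial>conf) = (\<integral>w. X i w \<partial>conf) * (\<integral>w. X j w \<partial>conf)"
        using D[OF that] sqX[THEN sqint_integrable] unfolding X_def
        by (intro local_fun_indep[OF local_fun_shift[OF Y(2)] local_fun_shift[OF Y(2)]])
      thus ?thesis by (simp add: mean power2_eq_square)
    qed
  qed (use sqX mean in \<open>auto simp: sqint_def\<close>)
  moreover have "fpt r w 0 (lattice_smult n z) \<le> (\<Sum>i<n. X i w)" for n w
    using fpt_smult_le_sum[of w n z] Y(4) unfolding X_def by (meson order_trans sum_mono)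
  moreover have "mono (\<lambda>n. \<Sum>i<n. X i w)" for w
    by (rule incseq_SucI) (simp add: X_def nn)
  moreover have "sqint (\<lambda>w. \<Sum>i<n. X i w)" for n by (intro sqint_sum sqX)
  moreover have "0 \<le> \<mu>" unfolding \<mu>_def using nn by (intro Bochner_Integration.integral_nonneg)
  ultimately show ?thesis using Y(5) \<mu>_def
    by - (rule exI[of _ "\<lambda>n w. \<Sum>i<n. X i w"], rule exI[of _ \<mu>],
        rule exI[of _ "2 * real D * (\<integral>w. (Y w)\<^sup>2 \<partial>conf)"], blast)
qed

text \<open>Linear variance gives failure probabilities of order \<open>1 / n\<close>, which become
  summable along \<open>n = l\<^sup>2\<close>. Consecutive squares have ratio tending to 1, so
  monotone interpolation loses an arbitrarily small fraction.\<close>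

lemma fpt_eventually_le_mean:
  fixes z :: "int ^ 'd"
  assumes "\<eta> > 0"
  shows "AE w in conf. \<forall>\<^sub>F n in sequentially.
    fpt r w 0 (lattice_smult n z) \<le> real n * ((\<integral>w. fpt r w 0 z \<partial>conf) + \<eta>)"
proof (cases "z = 0")
  case True
  have "(\<integral>w. fpt r w 0 z \<partial>conf) \<ge> 0" by (intro Bochner_Integration.integral_nonneg fpt_nonneg)
  thus ?thesis using True assms by simp
next
  case False
  \<comment> \<open>One third each for the local approximation, the deviation of \<open>S\<close>
    from its mean, and the rounding up to a square.\<close>
  define \<delta> where "\<delta> = \<eta> / 3"
  have \<delta>: "\<delta> > 0" using assms by (simp add: \<delta>_def)
  obtain S \<mu> V where S: "\<And>n w. fpt r w 0 (lattice_smult n z) \<le> S n w" "\<And>w. mono (\<lambda>n. S n w)"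
    "\<And>n. sqint (S n)" "\<And>n. (\<integral>w. (S n w - real n * \<mu>)\<^sup>2 \<partial>conf) \<le> real n * V"
    "0 \<le> \<mu>" "\<mu> \<le> (\<integral>w. fpt r w 0 z \<partial>conf) + \<delta>"
    using block_sums[OF \<delta> False] by blast
  have [measurable]: "S n \<in> borel_measurable conf" for n by (rule sqint_measurable[OF S(3)])
  define B where "B l = {w \<in> space conf. S (l\<^sup>2) w - real (l\<^sup>2) * \<mu> \<ge> \<delta> * real (l\<^sup>2)}" for l
  have [measurable]: "B l \<in> sets conf" for l unfolding B_def by measurable
  have PB: "measure conf (B l) \<le> V / \<delta>\<^sup>2 * (1 / real l ^ 2)" if "l > 0" for l
  proof -
    have "sqint (\<lambda>w. S (l\<^sup>2) w + - (real (l\<^sup>2) * \<mu>))"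
      by (intro sqint_add S(3) sqint_const)
    hence int: "integrable conf (\<lambda>w. (S (l\<^sup>2) w - real (l\<^sup>2) * \<mu>)\<^sup>2)" by (simp add: sqint_def)
    have pos: "\<delta> * real (l\<^sup>2) > 0" using \<delta> that by simp
    have "B l \<subseteq> {w \<in> space conf. (S (l\<^sup>2) w - real (l\<^sup>2) * \<mu>)\<^sup>2 \<ge> (\<delta> * real (l\<^sup>2))\<^sup>2}"
      using pos unfolding B_def by (auto intro!: power_mono)
    hence "measure conf (B l) \<le> measure conf {w \<in> space conf. (S (l\<^sup>2) w - real (l\<^sup>2) * \<mu>)\<^sup>2 \<ge> (\<delta> * real (l\<^sup>2))\<^sup>2}"
      by (intro conf.finite_measure_mono) measurable
    also have "\<dots> \<le> (\<integral>w. (S (l\<^sup>2) w - real (l\<^sup>2) * \<mu>)\<^sup>2 \<partial>conf) / (\<delta> * real (l\<^sup>2))\<^sup>2"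
      by (rule integral_Markov_inequality_measure[OF int, of "{}"]) (use pos that in auto)
    also have "\<dots> \<le> (real (l\<^sup>2) * V) / (\<delta> * real (l\<^sup>2))\<^sup>2"
      using S(4)[of "l\<^sup>2"] by (intro divide_right_mono) auto
    also have "\<dots> = V / \<delta>\<^sup>2 * (1 / real l ^ 2)"
      using that \<delta> by (simp add: field_simps power2_eq_square)
    finally show ?thesis .
  qed
  have "summable (\<lambda>l. measure conf (B l))"
  proof (rule summable_comparison_test_ev)
    show "\<forall>\<^sub>F l in sequentially. norm (measure conf (B l)) \<le> V / \<delta>\<^sup>2 * (1 / real l ^ 2)"
      using eventually_gt_at_top[of 0] by eventually_elim (use PB in auto)
    show "summable (\<lambda>l. V / \<delta>\<^sup>2 * (1 / real l ^ 2))"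
      using inverse_power_summable[of 2, where 'a = real] by (intro summable_mult) (simp add: field_simps)
  qed
  hence "AE w in conf. \<forall>\<^sub>F l in sequentially. w \<in> space conf - B l"
    by (intro borel_cantelli_AE1) (auto simp: conf.emeasure_eq_measure)
  thus ?thesis
  proof (rule eventually_mono)
    fix w assume "\<forall>\<^sub>F l in sequentially. w \<in> space conf - B l"
    hence ev: "\<forall>\<^sub>F l in sequentially. S (l\<^sup>2) w \<le> real (l\<^sup>2) * (\<mu> + \<delta>)"
      by (rule eventually_mono) (auto simp: B_def algebra_simps)
    \<comment> \<open>The least integer whose square is at least \<open>n\<close>.\<close>
    define l where "l n = nat \<lceil>sqrt (real n)\<rceil>" for n
    have "filterlim l at_top sequentially" unfolding l_def by real_asymp
    with ev have ev': "\<forall>\<^sub>F n in sequentially. S ((l n)\<^sup>2) w \<le> real ((l n)\<^sup>2) * (\<mu> + \<delta>)"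
      by (rule eventually_compose_filterlim)
    have "(\<lambda>n. (sqrt (real n) + 1)\<^sup>2 / real n * (\<mu> + \<delta>)) \<longlonglongrightarrow> 1 * (\<mu> + \<delta>)"
      by (intro tendsto_mult tendsto_const) real_asymp
    hence "\<forall>\<^sub>F n in sequentially. (sqrt (real n) + 1)\<^sup>2 / real n * (\<mu> + \<delta>) < \<mu> + 2 * \<delta>"
      using \<delta> by (intro order_tendstoD) auto
    with ev' eventually_gt_at_top[of 0]
    show "\<forall>\<^sub>F n in sequentially. fpt r w 0 (lattice_smult n z) \<le> real n * ((\<integral>w. fpt r w 0 z \<partial>conf) + \<eta>)"
    proof eventually_elim
      case (elim n)
      have l1: "sqrt (real n) \<le> real (l n)" "real (l n) \<le> sqrt (real n) + 1"
        unfolding l_def by (simp_all add: of_nat_nat)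
      have "(sqrt (real n))\<^sup>2 \<le> (real (l n))\<^sup>2" using l1 by (intro power_mono) auto
      hence "real n \<le> real ((l n)\<^sup>2)" by simp
      hence nl: "n \<le> (l n)\<^sup>2" by (simp only: of_nat_le_iff)
      have "fpt r w 0 (lattice_smult n z) \<le> S n w" by (rule S(1))
      also have "\<dots> \<le> S ((l n)\<^sup>2) w" using S(2)[of w] nl by (simp add: mono_def)
      also have "\<dots> \<le> real ((l n)\<^sup>2) * (\<mu> + \<delta>)" by (rule elim)
      also have "\<dots> \<le> (sqrt (real n) + 1)\<^sup>2 * (\<mu> + \<delta>)"
        using l1 S(5) \<delta> by (intro mult_right_mono) (auto intro!: power_mono)
      also have "\<dots> \<le> real n * (\<mu> + 2 * \<delta>)" using elim by (simp add: field_simps)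
      also have "\<dots> \<le> real n * ((\<integral>w. fpt r w 0 z \<partial>conf) + \<eta>)"
        using S(6) by (intro mult_left_mono) (auto simp: \<delta>_def)
      finally show ?case .
    qed
  qed
qed

end

section \<open>Lower bound by greedy covering\<close>

text \<open>Walk from \<open>i\<close> to \<open>K\<close>: at a point of \<open>G\<close> jump
  along a cheap segment at price \<open>\<beta>\<close> per unit, elsewhere make a unit step at its
  actual price. The condition \<open>j + N \<le> K\<close> prevents a jump from overshooting
  \<open>K\<close>.\<close>

lemma greedy_cover:
  fixes f :: "nat \<Rightarrow> nat \<Rightarrow> real"
  assumes diag: "\<And>i. f i i = 0" and tri: "\<And>i j k. f i k \<le> f i j + f j k"
    and nonneg: "\<And>i j. f i j \<ge> 0" and \<beta>: "\<beta> \<ge> 0"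
    and good: "\<And>i. i \<in> G \<Longrightarrow> \<exists>n\<in>{1..N}. f i (i + n) \<le> \<beta> * real n"
    and "i \<le> K"
  shows "f i K \<le> \<beta> * real (K - i) + (\<Sum>j\<in>{i..<K}. if j \<in> G \<and> j + N \<le> K then 0 else f j (Suc j))"
    (is "_ \<le> _ + sum ?g _")
  using assms(6)
proof (induction "K - i" arbitrary: i rule: less_induct)
  case less
  show ?case
  proof (cases "i = K")
    case True thus ?thesis by (simp add: diag)
  next
    case False
    hence iK: "i < K" using less.prems by simp
    show ?thesis
    proof (cases "i \<in> G \<and> i + N \<le> K")
      case True
      then obtain n where n: "n \<in> {1..N}" "f i (i + n) \<le> \<beta> * real n" using good by blast
      have "f i K \<le> \<beta> * real n + f (i + n) K" using tri[of i K "i + n"] n by simp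
      also have "f (i + n) K \<le> \<beta> * real (K - (i + n)) + sum ?g {i + n..<K}"
        using n True iK by (intro less.hyps) auto
      also have "sum ?g {i + n..<K} \<le> sum ?g {i..<K}"
        using nonneg by (intro sum_mono2) auto
      also have "\<beta> * real n + (\<beta> * real (K - (i + n)) + sum ?g {i..<K}) = \<beta> * real (K - i) + sum ?g {i..<K}"
        using n True by (simp add: of_nat_diff algebra_simps)
      finally show ?thesis by simp
    next
      case False
      have "f i K \<le> f i (Suc i) + f (Suc i) K" by (rule tri)
      also have "f (Suc i) K \<le> \<beta> * real (K - Suc i) + sum ?g {Suc i..<K}"
        using iK by (intro less.hyps) auto
      also have "\<beta> * real (K - Suc i) \<le> \<beta> * real (K - i)" using \<beta> by (intro mult_left_mono) auto
      also have "f i (Suc i) + (\<beta> * real (K - i) + sum ?g {Suc i..<K}) = \<beta> * real (K - i) + sum ?g {i..<K}"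
        using iK False by (auto simp: sum.atLeast_Suc_lessThan)
      finally show ?thesis by simp
    qed
  qed
qed

lemma linear_le_sqrt_imp_nonpos:
  fixes a c d :: real
  assumes "\<And>n::nat. n \<ge> 1 \<Longrightarrow> a * real n \<le> c + d * sqrt (real n)"
  shows "a \<le> 0"
proof (rule LIMSEQ_le_const)
  show "(\<lambda>n. (c + d * sqrt (real n)) / real n) \<longlonglongrightarrow> 0" by real_asymp
  show "\<exists>N. \<forall>n\<ge>N. a \<le> (c + d * sqrt (real n)) / real n"
    using assms by (intro exI[of _ 1]) (auto simp: field_simps)
qed

text \<open>The inequality \<open>2 * |x| * t \<le> x\<^sup>2 + t\<^sup>2\<close> in place of
  Cauchy-Schwarz; it will be used with \<open>t = sqrt n\<close>, the order of the standard
  deviation of \<open>S n\<close>.\<close>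

lemma (in prob_space) expectation_abs_le:
  fixes X :: "'a \<Rightarrow> real"
  assumes [measurable]: "X \<in> borel_measurable M" and "integrable M (\<lambda>s. (X s)\<^sup>2)" "t > 0"
  shows "expectation (\<lambda>s. \<bar>X s\<bar>) \<le> (expectation (\<lambda>s. (X s)\<^sup>2) / t + t) / 2"
proof -
  have "\<bar>x\<bar> \<le> (x\<^sup>2 / t + t) / 2" for x :: real
  proof -
    have "2 * \<bar>x\<bar> * t \<le> x\<^sup>2 + t * t"
      using zero_le_power2[of "\<bar>x\<bar> - t"] by (simp add: power2_eq_square algebra_simps)
    thus ?thesis using assms(3) by (simp add: field_simps)
  qed
  hence "expectation (\<lambda>s. \<bar>X s\<bar>) \<le> expectation (\<lambda>s. ((X s)\<^sup>2 / t + t) / 2)"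
    using assms square_integrable_imp_integrable[OF assms(1,2)]
    by (intro integral_mono) auto
  also have "\<dots> = (expectation (\<lambda>s. (X s)\<^sup>2) / t + t) / 2"
    using assms by (simp add: prob_space)
  finally show ?thesis .
qed

text \<open>By subadditivity the infimum is also the limit of these means. As an infimum it bounds
  the mean from below at every \<open>n\<close>, and this is what the covering argument
  contradicts.\<close>

definition time_const :: "(nat \<Rightarrow> real) \<Rightarrow> int ^ 'd \<Rightarrow> real" where
  "time_const r z = (INF n\<in>{1..}. (\<integral>w. fpt r w 0 (lattice_smult n z) \<partial>conf) / real n)"

context fpp_rate begin

lemma mean_fpt_nonneg: "0 \<le> (\<integral>w. fpt r w a b \<partial>conf)"
  by (intro Bochner_Integration.integral_nonneg fpt_nonneg)

lemma time_const_le: "n \<ge> 1 \<Longrightarrow> time_const r z * real n \<le> (\<integral>w. fpt r w 0 (lattice_smult n z) \<partial>conf)"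
proof -
  assume n: "n \<ge> 1"
  have "time_const r z \<le> (\<integral>w. fpt r w 0 (lattice_smult n z) \<partial>conf) / real n"
    unfolding time_const_def using n
    by (intro cINF_lower bdd_belowI2[of _ 0]) (auto intro!: divide_nonneg_nonneg mean_fpt_nonneg)
  thus ?thesis using n by (simp add: field_simps)
qed

lemma time_const_ge:
  "(\<And>n. n \<ge> 1 \<Longrightarrow> c * real n \<le> (\<integral>w. fpt r w 0 (lattice_smult n z) \<partial>conf)) \<Longrightarrow> c \<le> time_const r z"
  unfolding time_const_def by (intro cINF_greatest) (auto simp: field_simps)

lemma time_const_nonneg: "0 \<le> time_const r z"
  by (rule time_const_ge) (simp add: mean_fpt_nonneg)

lemma time_const_approx:
  assumes "\<eta> > 0"
  obtains m where "m \<ge> 1" "(\<integral>w. fpt r w 0 (lattice_smult m z) \<partial>conf) < (time_const r z + \<eta>) * real m"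
proof -
  have "\<exists>m\<ge>1. \<not> (time_const r z + \<eta>) * real m \<le> (\<integral>w. fpt r w 0 (lattice_smult m z) \<partial>conf)"
    using time_const_ge[of "time_const r z + \<eta>" z] assms by force
  with that show ?thesis by (auto simp: not_le)
qed

text \<open>At multiples of a well-chosen \<open>m\<close> the previous bound, applied to
  \<open>lattice_smult m z\<close>, is nearly optimal. The remainder of \<open>n\<close> modulo
  \<open>m\<close> is bridged by \<open>fpt_interpolation\<close> at bounded distance.\<close>

lemma fpt_eventually_le:
  fixes z :: "int ^ 'd"
  assumes "\<eta> > 0"
  shows "AE w in conf. \<forall>\<^sub>F n in sequentially. fpt r w 0 (lattice_smult n z) \<le> real n * (time_const r z + \<eta>)"
proof -
  \<comment> \<open>Four errors: the choice of \<open>m\<close>, the bound along its multiples, and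
    the two terms of the interpolation.\<close>
  define \<delta> where "\<delta> = \<eta> / 4"
  have \<delta>: "\<delta> > 0" using assms by (simp add: \<delta>_def)
  obtain m where m: "m \<ge> 1" "(\<integral>w. fpt r w 0 (lattice_smult m z) \<partial>conf) < (time_const r z + \<delta>) * real m"
    using time_const_approx[OF \<delta>] by blast
  define v where "v = lattice_smult m z"
  have "AE w in conf. \<forall>\<^sub>F k in sequentially.
     fpt r w 0 (lattice_smult k v) \<le> real k * ((\<integral>w. fpt r w 0 v \<partial>conf) + \<delta> * real m)"
    using \<delta> m by (intro fpt_eventually_le_mean) simp
  moreover have "AE w in conf. \<forall>\<^sub>F k in sequentially. \<forall>y. lnorm y \<le> (m * lnorm z) * k \<longrightarrow>
           fpt r w (lattice_smult k v) (lattice_smult k v + y) \<le> \<delta> * real k + 4 * real (lnorm y)"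
    by (rule fpt_interpolation[OF \<delta>])
  ultimately show ?thesis
  proof eventually_elim
    fix w
    assume ev1: "\<forall>\<^sub>F k in sequentially. fpt r w 0 (lattice_smult k v) \<le> real k * ((\<integral>w. fpt r w 0 v \<partial>conf) + \<delta> * real m)"
      and ev2: "\<forall>\<^sub>F k in sequentially. \<forall>y. lnorm y \<le> (m * lnorm z) * k \<longrightarrow>
           fpt r w (lattice_smult k v) (lattice_smult k v + y) \<le> \<delta> * real k + 4 * real (lnorm y)"
    have lim: "filterlim (\<lambda>n. n div m) at_top sequentially"
      using m by (intro filterlim_at_top_div_const_nat) auto
    have "\<forall>\<^sub>F n in sequentially. 4 * real m * real (lnorm z) \<le> \<delta> * real n"
      using \<delta> by real_asymp
    with eventually_compose_filterlim[OF ev1 lim] eventually_compose_filterlim[OF ev2 lim] eventually_ge_at_top[of m]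
    show "\<forall>\<^sub>F n in sequentially. fpt r w 0 (lattice_smult n z) \<le> real n * (time_const r z + \<eta>)"
    proof eventually_elim
      case (elim n)
      define k where "k = n div m"
      define j where "j = n mod m"
      have n: "n = k * m + j" by (simp add: k_def j_def)
      have j: "j \<le> m" using m by (simp add: j_def less_imp_le)
      have k: "k \<ge> 1" using elim(3) m by (simp add: k_def div_greater_zero_iff Suc_le_eq)
      have nz: "lattice_smult n z = lattice_smult k v + lattice_smult j z"
        by (simp add: n v_def lattice_smult_add lattice_smult_mult)
      have jz: "lnorm (lattice_smult j z) \<le> m * lnorm z" using j by (simp add: lnorm_smult)
      have "m * lnorm z \<le> m * lnorm z * k" using k by simp
      hence "fpt r w (lattice_smult k v) (lattice_smult k v + lattice_smult j z) \<le> \<delta> * real k + 4 * real (lnorm (lattice_smult j z))"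
        using elim(2) jz unfolding k_def[symmetric] by (meson order_trans)
      also have "\<dots> \<le> \<delta> * real k + 4 * (real m * real (lnorm z))"
        using jz by (simp flip: of_nat_mult)
      also have "real k \<le> real n" using n m by (simp add: k_def)
      finally have 2: "fpt r w (lattice_smult k v) (lattice_smult n z) \<le> \<delta> * real n + 4 * (real m * real (lnorm z))"
        using \<delta> by (simp add: nz)
      have "fpt r w 0 (lattice_smult k v) \<le> real k * ((\<integral>w. fpt r w 0 v \<partial>conf) + \<delta> * real m)"
        using elim(1) by (simp add: k_def)
      also have "\<dots> \<le> real k * ((time_const r z + \<delta>) * real m + \<delta> * real m)"
        using m by (intro mult_left_mono) (auto simp: v_def)
      also have "\<dots> = real (k * m) * (time_const r z + 2 * \<delta>)" by (simp add: algebra_simps)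
      also have "\<dots> \<le> real n * (time_const r z + 2 * \<delta>)"
        using n \<delta> time_const_nonneg[of z] by (intro mult_right_mono) auto
      finally have "fpt r w 0 (lattice_smult k v) \<le> real n * (time_const r z + 2 * \<delta>)" .
      with 2 elim(4) fpt_triangle[of w 0 "lattice_smult n z" "lattice_smult k v"]
      have "fpt r w 0 (lattice_smult n z) \<le> real n * (time_const r z + 2 * \<delta>) + \<delta> * real n + \<delta> * real n" by simp
      also have "\<dots> = real n * (time_const r z + \<eta>)" by (simp add: \<delta>_def algebra_simps)
      finally show ?case .
    qed
  qed
qed

text \<open>The fluctuations of \<open>S n\<close> are of order \<open>sqrt n\<close> in mean, so
  restricting to any event \<open>A\<close> multiplies the main term by its probability up to such
  an error. An almost sure bound alone would not control these means.\<close>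

lemma fpt_mean_on_event:
  fixes z :: "int ^ 'd"
  assumes "\<eta> > 0" "z \<noteq> 0" and A [measurable]: "A \<in> sets conf"
  shows "\<exists>m\<ge>1. \<exists>c. \<forall>n\<ge>1. (\<integral>w. indicator A w * fpt r w 0 (lattice_smult (n * m) z) \<partial>conf)
           \<le> real (n * m) * (time_const r z + \<eta>) * measure conf A + c * sqrt (real n)"
proof -
  define \<delta> where "\<delta> = \<eta> / 2"
  have \<delta>: "\<delta> > 0" using assms by (simp add: \<delta>_def)
  obtain m where m: "m \<ge> 1" "(\<integral>w. fpt r w 0 (lattice_smult m z) \<partial>conf) < (time_const r z + \<delta>) * real m"
    using time_const_approx[OF \<delta>] by blast
  define v where "v = lattice_smult m z"
  have "lnorm v \<ge> 1" using m(1) assms(2) lnorm_pos_iff[of z] by (simp add: v_def lnorm_smult del: lnorm_eq_0_iff)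
  hence v0: "v \<noteq> 0" by auto
  have \<delta>m: "\<delta> * real m > 0" using \<delta> m by simp
  obtain S \<mu> V where S: "\<And>n w. fpt r w 0 (lattice_smult n v) \<le> S n w"
    "\<And>n. sqint (S n)" "\<And>n. (\<integral>w. (S n w - real n * \<mu>)\<^sup>2 \<partial>conf) \<le> real n * V"
    "\<mu> \<le> (\<integral>w. fpt r w 0 v \<partial>conf) + \<delta> * real m"
    using block_sums[OF \<delta>m v0] by blast
  have [measurable]: "S n \<in> borel_measurable conf" for n by (rule sqint_measurable[OF S(2)])
  have \<mu>: "\<mu> \<le> real m * (time_const r z + \<eta>)"
    using S(4) m(2) by (simp add: v_def \<delta>_def algebra_simps)
  have "(\<integral>w. indicator A w * fpt r w 0 (lattice_smult (n * m) z) \<partial>conf)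
           \<le> real (n * m) * (time_const r z + \<eta>) * measure conf A + ((V + 1) / 2) * sqrt (real n)" if n: "n \<ge> 1" for n
  proof -
    define X where "X w = S n w - real n * \<mu>" for w
    have sqX: "sqint X"
      using sqint_add[OF S(2)[of n] sqint_const[of "- (real n * \<mu>)"]] by (simp add: X_def[abs_def])
    have iX: "integrable conf X" by (rule sqint_integrable[OF sqX])
    have i1: "integrable conf (\<lambda>w. indicator A w * fpt r w 0 (lattice_smult (n * m) z))"
      by (rule integrable_real_mult_indicator[OF A sqint_integrable[OF sqint_fpt], simplified mult.commute])
    have "(\<integral>w. indicator A w * fpt r w 0 (lattice_smult (n * m) z) \<partial>conf) \<le>
          (\<integral>w. real n * \<mu> * indicator A w + \<bar>X w\<bar> \<partial>conf)"
    proof (intro integral_mono i1)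
      fix w
      have "fpt r w 0 (lattice_smult (n * m) z) \<le> real n * \<mu> + X w"
        using S(1)[of w n] by (simp add: X_def v_def lattice_smult_mult)
      thus "indicator A w * fpt r w 0 (lattice_smult (n * m) z) \<le> real n * \<mu> * indicator A w + \<bar>X w\<bar>"
        by (auto simp: indicator_def)
    qed (use iX in \<open>auto simp: conf.emeasure_eq_measure\<close>)
    also have "\<dots> = real n * \<mu> * measure conf A + (\<integral>w. \<bar>X w\<bar> \<partial>conf)"
      using iX by (subst Bochner_Integration.integral_add) (auto simp: conf.emeasure_eq_measure)
    also have "(\<integral>w. \<bar>X w\<bar> \<partial>conf) \<le> ((\<integral>w. (X w)\<^sup>2 \<partial>conf) / sqrt (real n) + sqrt (real n)) / 2"
      using n sqX by (intro conf.expectation_abs_le) (auto simp: sqint_def)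
    also have "(\<integral>w. (X w)\<^sup>2 \<partial>conf) \<le> real n * V" using S(3)[of n] by (simp add: X_def)
    also have "(real n * V / sqrt (real n) + sqrt (real n)) / 2 = ((V + 1) / 2) * sqrt (real n)"
    proof -
      have "real n * V / sqrt (real n) = V * sqrt (real n)"
        using real_div_sqrt[of "real n"] by (simp add: mult.commute flip: times_divide_eq_right)
      thus ?thesis by (simp only:) (simp add: ring_distribs)
    qed
    also have "real n * \<mu> * measure conf A \<le> real n * (real m * (time_const r z + \<eta>)) * measure conf A"
      using \<mu> by (intro mult_right_mono mult_left_mono) auto
    finally show ?thesis using n by (simp add: divide_right_mono mult.assoc)
  qed
  thus ?thesis using m(1) by blast
qed

text \<open>Let \<open>p\<close> be the probability of the event \<open>A\<close> that the bound
  fails infinitely often. On \<open>A\<close> the covering bounds the mean by about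
  \<open>\<gamma> * K * p\<close>, and off \<open>A\<close> it is at most about
  \<open>time_const r z * K * (1 - p)\<close>. As the whole mean is at least
  \<open>time_const r z * K\<close>, this forces
  \<open>p * (time_const r z - \<gamma>) \<le> 0\<close>.\<close>

lemma fpt_eventually_ge:
  fixes z :: "int ^ 'd"
  assumes "\<beta> < time_const r z" "z \<noteq> 0"
  shows "AE w in conf. \<forall>\<^sub>F n in sequentially. \<beta> * real n \<le> fpt r w 0 (lattice_smult n z)"
proof (cases "\<beta> < 0")
  case True
  have "\<beta> * real n \<le> fpt r w 0 (lattice_smult n z)" for n w
    using True fpt_nonneg[of w 0 "lattice_smult n z"] mult_nonpos_nonneg[of \<beta> "real n"] by linarith
  thus ?thesis by simp
next
  case False
  \<comment> \<open>The gap above \<open>\<beta>\<close> pays for moving the starting point from 0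
    to \<open>i\<close>; the gap below the time constant gives the contradiction.\<close>
  define \<gamma> where "\<gamma> = (\<beta> + time_const r z) / 2"
  have \<gamma>: "0 \<le> \<gamma>" "\<beta> < \<gamma>" "\<gamma> < time_const r z" using assms False by (auto simp: \<gamma>_def)
  define T where "T w i j = fpt r w (lattice_smult i z) (lattice_smult j z)" for w i j
  have T_shift: "T w i (i + n) = T (shift (lattice_smult i z) w) 0 n" for w i n
    by (simp add: T_def fpt_shift lattice_smult_add add.commute)
  have [measurable]: "(\<lambda>w. T w i j) \<in> borel_measurable conf" for i j unfolding T_def by measurable
  have iT: "integrable conf (\<lambda>w. T w i j)" for i j
    unfolding T_def by (rule sqint_integrable[OF sqint_fpt])
  have T0: "T w i j \<ge> 0" for w i j unfolding T_def by (rule fpt_nonneg)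
  have Tt: "T w i k \<le> T w i j + T w j k" for w i j k unfolding T_def by (rule fpt_triangle)
  \<comment> \<open>The growth of \<open>T\<close> is slow when \<open>T\<close> falls below rate
    \<open>\<gamma>\<close> at arbitrarily long range. Unlike \<open>A\<close>, which is anchored at
    0, this condition at \<open>i\<close> is the one at 0 for the translated configuration, so the
    errors of the covering are the same at every \<open>i\<close>.\<close>
  define slow where "slow w i \<longleftrightarrow> (\<forall>N. \<exists>n\<ge>N. T w i (i + n) < \<gamma> * real n)" for w i
  define short where "short N w i \<longleftrightarrow> (\<exists>n\<in>{1..N}. T w i (i + n) < \<gamma> * real n)" for N w i
  define A where "A = {w \<in> space conf. \<forall>N. \<exists>n\<ge>N. T w 0 n < \<beta> * real n}"
  have [measurable]: "A \<in> sets conf" unfolding A_def by measurable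
  have [measurable]: "Measurable.pred conf (\<lambda>w. slow w i)" for i unfolding slow_def by measurable
  have [measurable]: "Measurable.pred conf (\<lambda>w. short N w i)" for i N unfolding short_def by measurable
  have A_slow: "slow w i" if "w \<in> A" for w i
    unfolding slow_def
  proof
    fix N
    have "\<forall>\<^sub>F n in sequentially. T w i 0 + \<beta> * (real i + real n) < \<gamma> * real n"
    proof -
      have "\<forall>\<^sub>F n in sequentially. (T w i 0 + \<beta> * real i) / (\<gamma> - \<beta>) < real n"
        using filterlim_real_sequentially by (simp add: filterlim_at_top_dense)
      thus ?thesis
      proof eventually_elim
        case (elim n)
        have "\<gamma> - \<beta> > 0" using \<gamma> by simp
        with elim have "T w i 0 + \<beta> * real i < real n * (\<gamma> - \<beta>)" by (subst (asm) pos_divide_less_eq)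
        thus ?case by argo
      qed
    qed
    then obtain N' where N': "\<And>n. n \<ge> N' \<Longrightarrow> T w i 0 + \<beta> * (real i + real n) < \<gamma> * real n"
      by (auto simp: eventually_sequentially)
    have "\<exists>n\<ge>i + N + N'. T w 0 n < \<beta> * real n" using that by (simp add: A_def)
    then obtain n where n: "n \<ge> i + N + N'" "T w 0 n < \<beta> * real n" by blast
    have "T w i (i + (n - i)) \<le> T w i 0 + T w 0 n" using Tt[of w i n 0] n by simp
    also have "\<dots> < \<gamma> * real (n - i)"
    proof -
      have "N' \<le> n - i" "i \<le> n" using n by linarith+
      from N'[OF this(1)] this n show ?thesis by (simp add: of_nat_diff)
    qed
    finally show "\<exists>n\<ge>N. T w i (i + n) < \<gamma> * real n" using n by (intro exI[of _ "n - i"]) auto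
  qed
  \<comment> \<open>The mean price of a unit step forced at a point whose favourable segments are
    all longer than \<open>N\<close>. It tends to 0 because each slow point has some favourable
    segment.\<close>
  define \<epsilon> where "\<epsilon> N = (\<integral>w. (if slow w 0 \<and> \<not> short N w 0 then T w 0 1 else 0) \<partial>conf)" for N
  have slow_eps: "(\<integral>w. (if slow w i \<and> \<not> short N w i then T w i (Suc i) else 0) \<partial>conf) = \<epsilon> N" for i N
  proof -
    have "(\<integral>w. (if slow w i \<and> \<not> short N w i then T w i (Suc i) else 0) \<partial>conf) =
      (\<integral>w. (\<lambda>w. if slow w 0 \<and> \<not> short N w 0 then T w 0 1 else 0) (shift (lattice_smult i z) w) \<partial>conf)"
    proof (intro Bochner_Integration.integral_cong refl)
      fix w
      have "slow w i = slow (shift (lattice_smult i z) w) 0" "short N w i = short N (shift (lattice_smult i z) w) 0"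
        unfolding slow_def short_def T_shift[of w i] by simp_all
      moreover have "T w i (Suc i) = T (shift (lattice_smult i z) w) 0 1" using T_shift[of w i 1] by simp
      ultimately show "(if slow w i \<and> \<not> short N w i then T w i (Suc i) else 0) =
        (\<lambda>w. if slow w 0 \<and> \<not> short N w 0 then T w 0 1 else 0) (shift (lattice_smult i z) w)" by simp
    qed
    also have "\<dots> = \<epsilon> N" unfolding \<epsilon>_def by (rule integral_shift) measurable
    finally show ?thesis .
  qed
  have eps_lim: "\<epsilon> \<longlonglongrightarrow> 0"
  proof -
    have "(\<lambda>N. \<integral>w. (if slow w 0 \<and> \<not> short N w 0 then T w 0 1 else 0) \<partial>conf) \<longlonglongrightarrow> (\<integral>w. 0 \<partial>(conf :: ((int ^ 'd) set \<Rightarrow> real) measure))"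
    proof (rule integral_dominated_convergence[where w = "\<lambda>w. T w 0 1"])
      show "AE w in conf. (\<lambda>N. if slow w 0 \<and> \<not> short N w 0 then T w 0 1 else 0) \<longlonglongrightarrow> 0"
      proof (intro AE_I2)
        fix w
        have "\<forall>\<^sub>F N in sequentially. \<not> (slow w 0 \<and> \<not> short N w 0)"
        proof (cases "slow w 0")
          case True
          then obtain n where n: "n \<ge> 1" "T w 0 (0 + n) < \<gamma> * real n" unfolding slow_def by blast
          show ?thesis using eventually_ge_at_top[of n]
            by eventually_elim (use n in \<open>auto simp: short_def\<close>)
        qed simp
        hence "\<forall>\<^sub>F N in sequentially. (if slow w 0 \<and> \<not> short N w 0 then T w 0 1 else 0) = 0"
          by eventually_elim auto
        thus "(\<lambda>N. if slow w 0 \<and> \<not> short N w 0 then T w 0 1 else 0) \<longlonglongrightarrow> 0"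
          by (rule tendsto_eventually)
      qed
    qed (use iT T0 in auto)
    thus ?thesis by (simp add: \<epsilon>_def[abs_def])
  qed
  have upper: "(\<integral>w. indicator A w * T w 0 K \<partial>conf) \<le> \<gamma> * real K * measure conf A + real K * \<epsilon> N + real N * (\<integral>w. T w 0 1 \<partial>conf)" for K N
  proof -
    define h where "h j w = (if slow w j \<and> \<not> short N w j then T w j (Suc j) else 0)" for j w
    have ih: "integrable conf (h j)" for j
      unfolding h_def[abs_def] by (rule Bochner_Integration.integrable_bound[OF iT[of j "Suc j"]]) auto
    have iA: "integrable conf (\<lambda>w. indicator A w * T w 0 K)"
      by (rule integrable_real_mult_indicator[OF _ iT, simplified mult.commute]) measurable
    \<comment> \<open>The last starting points, from which a segment of length up to
      \<open>N\<close> could overshoot \<open>K\<close>. There are at most \<open>N\<close> of them,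
      so their cost does not grow with \<open>K\<close>.\<close>
    define L where "L = {j. j < K \<and> K < j + N}"
    have "L \<subseteq> {K + 1 - N..<K}" by (auto simp: L_def)
    from card_mono[OF _ this] have cL: "card L \<le> N" by simp
    have [simp]: "finite L" by (simp add: L_def)
    have mT: "(\<integral>w. T w j (Suc j) \<partial>conf) = (\<integral>w. T w 0 1 \<partial>conf)" for j
      using T_shift[of _ j 1] integral_shift[of "\<lambda>w. T w 0 1" "lattice_smult j z"] by simp
    have "indicator A w * T w 0 K \<le> \<gamma> * real K * indicator A w + (\<Sum>j<K. h j w) + (\<Sum>j\<in>L. T w j (Suc j))" for w
    proof (cases "w \<in> A")
      case True
      have "T w 0 K \<le> \<gamma> * real (K - 0) + (\<Sum>j\<in>{0..<K}. if j \<in> {j. short N w j} \<and> j + N \<le> K then 0 else T w j (Suc j))"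
        by (rule greedy_cover[OF _ Tt T0 \<gamma>(1)]) (auto simp: T_def short_def intro: less_imp_le)
      also have "(\<Sum>j\<in>{0..<K}. if j \<in> {j. short N w j} \<and> j + N \<le> K then 0 else T w j (Suc j)) \<le>
                 (\<Sum>j\<in>{0..<K}. h j w + (if K < j + N then T w j (Suc j) else 0))"
        using A_slow[OF True] T0 by (intro sum_mono) (auto simp: h_def)
      also have "\<dots> = (\<Sum>j<K. h j w) + (\<Sum>j\<in>L. T w j (Suc j))"
        unfolding sum.distrib atLeast0LessThan
        by (subst sum.inter_filter[symmetric]) (auto simp: L_def lessThan_def)
      finally show ?thesis using True by simp
    next
      case False
      have "0 \<le> (\<Sum>j<K. h j w)" "0 \<le> (\<Sum>j\<in>L. T w j (Suc j))" by (auto intro!: sum_nonneg simp: h_def T0)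
      thus ?thesis using False by simp
    qed
    hence "(\<integral>w. indicator A w * T w 0 K \<partial>conf) \<le>
      (\<integral>w. \<gamma> * real K * indicator A w + (\<Sum>j<K. h j w) + (\<Sum>j\<in>L. T w j (Suc j)) \<partial>conf)"
      using iA ih iT by (intro integral_mono) (auto simp: conf.emeasure_eq_measure)
    also have "\<dots> = \<gamma> * real K * measure conf A + (\<Sum>j<K. \<integral>w. h j w \<partial>conf) + (\<Sum>j\<in>L. \<integral>w. T w j (Suc j) \<partial>conf)"
      using ih iT by (simp add: Bochner_Integration.integral_sum conf.emeasure_eq_measure)
    also have "\<dots> = \<gamma> * real K * measure conf A + real K * \<epsilon> N + real (card L) * (\<integral>w. T w 0 1 \<partial>conf)"
      unfolding h_def slow_eps mT by simp
    also have "real (card L) * (\<integral>w. T w 0 1 \<partial>conf) \<le> real N * (\<integral>w. T w 0 1 \<partial>conf)"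
      using cL T0 by (intro mult_right_mono Bochner_Integration.integral_nonneg) auto
    finally show ?thesis by simp
  qed
  define p where "p = measure conf A"
  have p01: "0 \<le> p" "p \<le> 1" unfolding p_def by auto
  \<comment> \<open>Taking \<open>K = n * m\<close> with \<open>n\<close> tending to infinity
    removes the boundary term of order 1 and the fluctuation of order \<open>sqrt n\<close>.\<close>
  have key: "p * (time_const r z - \<gamma>) \<le> \<epsilon> N + \<eta>" if pos: "\<eta> > 0" for \<eta> N
  proof -
    obtain m c where m: "m \<ge> 1" and mc: "\<And>n. n \<ge> 1 \<Longrightarrow>
        (\<integral>w. indicator (space conf - A) w * fpt r w 0 (lattice_smult (n * m) z) \<partial>conf)
           \<le> real (n * m) * (time_const r z + \<eta>) * measure conf (space conf - A) + c * sqrt (real n)"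
      using fpt_mean_on_event[OF pos assms(2), of "space conf - A"] by auto
    have "(time_const r z - \<gamma> * p - \<epsilon> N - (time_const r z + \<eta>) * (1 - p)) * real m \<le> 0"
    proof (rule linear_le_sqrt_imp_nonpos)
      fix n :: nat assume n: "n \<ge> 1"
      define K where "K = n * m"
      have K: "K \<ge> 1" using n m by (simp add: K_def)
      have iA: "integrable conf (\<lambda>w. indicator B w * T w 0 K)" if "B \<in> sets conf" for B
        by (rule integrable_real_mult_indicator[OF that iT, simplified mult.commute])
      have "time_const r z * real K \<le> (\<integral>w. T w 0 K \<partial>conf)"
        using time_const_le[OF K, of z] by (simp add: T_def)
      also have "\<dots> = (\<integral>w. indicator A w * T w 0 K + indicator (space conf - A) w * T w 0 K \<partial>conf)"
        by (intro Bochner_Integration.integral_cong) (auto simp: indicator_def)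
      also have "\<dots> = (\<integral>w. indicator A w * T w 0 K \<partial>conf) + (\<integral>w. indicator (space conf - A) w * T w 0 K \<partial>conf)"
        using iA by (intro Bochner_Integration.integral_add) auto
      also have "\<dots> \<le> (\<gamma> * real K * p + real K * \<epsilon> N + real N * (\<integral>w. T w 0 1 \<partial>conf)) +
          (real K * (time_const r z + \<eta>) * (1 - p) + c * sqrt (real n))"
        using upper[of K N] mc[OF n] by (simp add: K_def T_def p_def conf.prob_compl)
      finally show "(time_const r z - \<gamma> * p - \<epsilon> N - (time_const r z + \<eta>) * (1 - p)) * real m * real n
         \<le> real N * (\<integral>w. T w 0 1 \<partial>conf) + c * sqrt (real n)"
        by (simp add: K_def algebra_simps)
    qed
    hence "time_const r z - \<gamma> * p - \<epsilon> N - (time_const r z + \<eta>) * (1 - p) \<le> 0"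
      using m by (simp add: mult_le_0_iff)
    moreover have "\<eta> * (1 - p) \<le> \<eta> * 1" using p01 pos by (intro mult_left_mono) auto
    ultimately show ?thesis by (simp add: algebra_simps)
  qed
  have "p * (time_const r z - \<gamma>) \<le> 0"
  proof (rule field_le_epsilon)
    fix \<eta> :: real assume \<eta>: "\<eta> > 0"
    have "(\<lambda>N. \<epsilon> N + \<eta>) \<longlonglongrightarrow> 0 + \<eta>" by (intro tendsto_add eps_lim tendsto_const)
    thus "p * (time_const r z - \<gamma>) \<le> 0 + \<eta>"
      by (rule LIMSEQ_le_const) (use key[OF \<eta>] in auto)
  qed
  hence "p \<le> 0" using \<gamma> by (simp add: mult_le_0_iff)
  hence "measure conf A = 0" using p01(1) unfolding p_def by (rule antisym)
  hence "A \<in> null_sets conf" by (simp add: null_sets_def conf.emeasure_eq_measure)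
  hence "AE w in conf. w \<notin> A" by (rule AE_not_in)
  with AE_space show ?thesis
  proof eventually_elim
    case (elim w)
    then obtain N where "\<forall>n\<ge>N. \<not> T w 0 n < \<beta> * real n" by (auto simp: A_def)
    thus ?case by (auto simp: eventually_sequentially T_def not_less)
  qed
qed

lemma fpt_radial_limit:
  fixes z :: "int ^ 'd"
  shows "AE w in conf. (\<lambda>n. fpt r w 0 (lattice_smult n z) / real n) \<longlonglongrightarrow> time_const r z"
proof (cases "z = 0")
  case True
  have "time_const r z = 0"
    using time_const_le[of 1 z] time_const_nonneg[of z] True by simp
  thus ?thesis using True by simp
next
  case False
  have "AE w in conf. \<forall>k::nat. (\<forall>\<^sub>F n in sequentially. fpt r w 0 (lattice_smult n z) \<le> real n * (time_const r z + 1 / real (Suc k))) \<and>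
     (\<forall>\<^sub>F n in sequentially. (time_const r z - 1 / real (Suc k)) * real n \<le> fpt r w 0 (lattice_smult n z))"
    unfolding AE_all_countable
  proof (intro allI AE_conjI)
    fix k show "AE w in conf. \<forall>\<^sub>F n in sequentially. fpt r w 0 (lattice_smult n z) \<le> real n * (time_const r z + 1 / real (Suc k))"
      by (rule fpt_eventually_le) simp
    show "AE w in conf. \<forall>\<^sub>F n in sequentially. (time_const r z - 1 / real (Suc k)) * real n \<le> fpt r w 0 (lattice_smult n z)"
      by (rule fpt_eventually_ge) (use False in auto)
  qed
  thus ?thesis
  proof eventually_elim
    case (elim w)
    show ?case
    proof (rule LIMSEQ_I)
      fix e :: real assume "e > 0"
      then obtain k where k: "1 / real (Suc k) < e" using nat_approx_posE by blast
      have "\<forall>\<^sub>F n in sequentially. norm (fpt r w 0 (lattice_smult n z) / real n - time_const r z) < e"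
        using elim[rule_format, of k, THEN conjunct1] elim[rule_format, of k, THEN conjunct2] eventually_gt_at_top[of 0]
      proof eventually_elim
        case (elim n)
        have "fpt r w 0 (lattice_smult n z) / real n \<le> time_const r z + 1 / real (Suc k)"
             "time_const r z - 1 / real (Suc k) \<le> fpt r w 0 (lattice_smult n z) / real n"
          using elim by (auto simp: pos_divide_le_eq pos_le_divide_eq mult.commute)
        thus ?case using k by (simp add: abs_less_iff)
      qed
      thus "\<exists>no. \<forall>n\<ge>no. norm (fpt r w 0 (lattice_smult n z) / real n - time_const r z) < e"
        by (simp add: eventually_sequentially)
    qed
  qed
qed

end

section \<open>Few cheap edges on a path\<close>

lemma measure_conf_indexed:
  assumes "finite I" "inj_on e I" "\<And>i. i \<in> I \<Longrightarrow> e i \<in> (lattice_edges :: (int ^ 'd) set set)" "\<And>i. i \<in> I \<Longrightarrow> u i \<ge> 0"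
  shows "measure conf {w \<in> space conf. \<forall>i\<in>I. \<bar>w (e i)\<bar> \<le> u i} \<le> (\<Prod>i\<in>I. u i)"
proof -
  have "measure conf {w \<in> space conf. \<forall>f\<in>e ` I. \<bar>w f\<bar> \<le> u (inv_into I e f)} \<le> (\<Prod>f\<in>e ` I. u (inv_into I e f))"
    using assms by (intro measure_conf_finite) auto
  also have "\<dots> = (\<Prod>i\<in>I. u i)" using assms by (subst prod.reindex) auto
  also have "{w \<in> space conf. \<forall>f\<in>e ` I. \<bar>w f\<bar> \<le> u (inv_into I e f)} = {w \<in> space conf. \<forall>i\<in>I. \<bar>w (e i)\<bar> \<le> u i}"
    using assms by auto
  finally show ?thesis .
qed

definition chain_pos :: "(nat \<Rightarrow> int ^ 'd) \<Rightarrow> nat \<Rightarrow> int ^ 'd" where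
  "chain_pos y i = (\<Sum>l\<le>i. y l)"

definition chain_edge :: "(nat \<Rightarrow> int ^ 'd) \<Rightarrow> (nat \<Rightarrow> int ^ 'd) \<Rightarrow> nat \<Rightarrow> (int ^ 'd) set" where
  "chain_edge y z i = {chain_pos y i, chain_pos y i + z i}"

text \<open>A chain lists \<open>k\<close> distinct edges in the order in which a path meets them: the \<open>i\<close>-th one has displacement
  \<open>z i\<close>, and \<open>y i\<close> is the step from the start of the previous edge (the origin for \<open>i = 0\<close>) to its start.\<close>
definition jump_chains :: "(int ^ 'd) set \<Rightarrow> nat \<Rightarrow> nat \<Rightarrow> ((nat \<Rightarrow> int ^ 'd) \<times> (nat \<Rightarrow> int ^ 'd)) set" where
  "jump_chains Z k m = {(y, z). y \<in> PiE {..<k} (\<lambda>_. {x. lnorm x \<le> m}) \<and> z \<in> PiE {..<k} (\<lambda>_. Z) \<and>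
     (\<Sum>i<k. lnorm (y i)) \<le> m \<and> inj_on (chain_edge y z) {..<k}}"

definition chain_event :: "(int ^ 'd \<Rightarrow> real) \<Rightarrow> (int ^ 'd) set \<Rightarrow> nat \<Rightarrow> nat \<Rightarrow> ((int ^ 'd) set \<Rightarrow> real) set" where
  "chain_event u Z k m = (\<Union>(y, z)\<in>jump_chains Z k m. {w \<in> space conf. \<forall>i\<in>{..<k}. \<bar>w (chain_edge y z i)\<bar> \<le> u (z i)})"

lemma bounded_edges_sets:
  assumes "finite I" "\<And>i. i \<in> I \<Longrightarrow> e i \<in> (lattice_edges :: (int ^ 'd) set set)"
  shows "{w \<in> space conf. \<forall>i\<in>I. \<bar>w (e i)\<bar> \<le> u i} \<in> sets conf"
proof (rule sets.sets_Collect_finite_All)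
  fix i assume "i \<in> I"
  with assms have [measurable]: "(\<lambda>w. w (e i)) \<in> borel_measurable conf" by (intro measurable_coord) auto
  show "{w \<in> space conf. \<bar>w (e i)\<bar> \<le> u i} \<in> sets conf" by measurable
qed fact

lemma finite_jump_chains: "finite Z \<Longrightarrow> finite (jump_chains Z k m)"
proof -
  assume Z: "finite Z"
  have "jump_chains Z k m \<subseteq> PiE {..<k} (\<lambda>_. {x. lnorm x \<le> m}) \<times> PiE {..<k} (\<lambda>_. Z)"
    by (auto simp: jump_chains_def)
  thus ?thesis by (rule finite_subset) (use Z in \<open>auto intro!: finite_PiE\<close>)
qed

lemma chain_edge_in_lattice_edges:
  assumes "(y, z) \<in> jump_chains Z k m" "0 \<notin> Z" "i < k"
  shows "chain_edge y z i \<in> lattice_edges"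
proof -
  have "z i \<in> Z" using assms by (auto simp: jump_chains_def)
  hence "z i \<noteq> 0" using assms by auto
  thus ?thesis by (simp add: chain_edge_def)
qed

lemma chain_slice_sets:
  assumes "b \<in> jump_chains Z k m" "0 \<notin> Z"
  shows "(case b of (y, z) \<Rightarrow> {w \<in> space conf. \<forall>i\<in>{..<k}. \<bar>w (chain_edge y z i)\<bar> \<le> u (z i)}) \<in> sets conf"
proof -
  obtain y z where b: "b = (y, z)" by (cases b)
  have "chain_edge y z i \<in> lattice_edges" if "i \<in> {..<k}" for i
    using chain_edge_in_lattice_edges[of y z Z k m i] assms that b by simp
  hence "{w \<in> space conf. \<forall>i\<in>{..<k}. \<bar>w (chain_edge y z i)\<bar> \<le> u (z i)} \<in> sets conf"
    by (intro bounded_edges_sets) simp_all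
  thus ?thesis by (simp only: b prod.case)
qed

lemma chain_event_sets:
  assumes "finite Z" "0 \<notin> Z"
  shows "chain_event u Z k m \<in> sets conf"
  unfolding chain_event_def
  by (rule sets.finite_UN[OF finite_jump_chains[OF assms(1)] chain_slice_sets[OF _ assms(2)]])

text \<open>Union bound over all chains: since the steps of a chain have total length at most \<open>m\<close>, the factor
  \<open>exp (a * m) * (\<Prod>i<k. exp (- a * lnorm (y i)))\<close> is at least 1 and makes the sum over chains factorise.\<close>
lemma chain_event_prob:
  fixes Z :: "(int ^ 'd) set"
  assumes Z: "finite Z" "0 \<notin> Z" and u: "\<And>z. z \<in> Z \<Longrightarrow> u z \<ge> 0" and a: "0 < a" "a \<le> 1"
  shows "measure conf (chain_event u Z k m) \<le> exp (a * real m) * ((3 / a) ^ CARD('d) * (\<Sum>z\<in>Z. u z)) ^ k"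
proof -
  define Ev where "Ev = (\<lambda>(y, z). {w \<in> space conf. \<forall>i\<in>{..<k}. \<bar>w (chain_edge y z i)\<bar> \<le> u (z i)})"
  have Ev_sets: "Ev b \<in> sets conf" if "b \<in> jump_chains Z k m" for b
    unfolding Ev_def by (rule chain_slice_sets[OF that Z(2)])
  let ?Y = "PiE {..<k} (\<lambda>_. {x :: int ^ 'd. lnorm x \<le> m})" and ?Z = "PiE {..<k} (\<lambda>_. Z)"
  have fin: "finite ?Y" "finite ?Z" using Z by (auto intro!: finite_PiE)
  have sub: "jump_chains Z k m \<subseteq> ?Y \<times> ?Z" by (auto simp: jump_chains_def)
  have us: "0 \<le> sum u Z" using u by (intro sum_nonneg)
  have eq: "chain_event u Z k m = (\<Union>b\<in>jump_chains Z k m. Ev b)"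
    by (simp add: chain_event_def Ev_def)
  have "measure conf (chain_event u Z k m) \<le> (\<Sum>b\<in>jump_chains Z k m. measure conf (Ev b))"
    unfolding eq using Ev_sets finite_jump_chains[OF Z(1)] by (intro conf.finite_measure_subadditive_finite) auto
  also have "\<dots> \<le> (\<Sum>(y, z)\<in>jump_chains Z k m. exp (a * real m) * ((\<Prod>i<k. exp (- a * real (lnorm (y i)))) * (\<Prod>i<k. u (z i))))"
  proof (intro sum_mono, clarify)
    fix y z assume yz: "(y, z) \<in> jump_chains Z k m"
    have zZ: "z i \<in> Z" if "i < k" for i using yz that by (auto simp: jump_chains_def)
    have "measure conf (Ev (y, z)) \<le> (\<Prod>i<k. u (z i))"
      unfolding Ev_def prod.case
      using yz u zZ chain_edge_in_lattice_edges[OF yz Z(2)]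
      by (intro measure_conf_indexed) (auto simp: jump_chains_def)
    also have "\<dots> = 1 * (\<Prod>i<k. u (z i))" by simp
    also have "\<dots> \<le> (exp (a * real m) * (\<Prod>i<k. exp (- a * real (lnorm (y i))))) * (\<Prod>i<k. u (z i))"
    proof (intro mult_right_mono prod_nonneg)
      have "real (\<Sum>i<k. lnorm (y i)) \<le> real m" using yz by (simp add: jump_chains_def del: of_nat_sum)
      hence "0 \<le> a * (real m - (\<Sum>i<k. real (lnorm (y i))))" using a by simp
      hence "1 \<le> exp (a * (real m - (\<Sum>i<k. real (lnorm (y i)))))" by simp
      also have "\<dots> = exp (a * real m) * (\<Prod>i<k. exp (- a * real (lnorm (y i))))"
        by (simp add: exp_sum[symmetric] sum_negf sum_distrib_left right_diff_distrib flip: exp_add)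
      finally show "1 \<le> exp (a * real m) * (\<Prod>i<k. exp (- a * real (lnorm (y i))))" .
    qed (use u zZ in auto)
    finally show "measure conf (Ev (y, z)) \<le> exp (a * real m) * ((\<Prod>i<k. exp (- a * real (lnorm (y i)))) * (\<Prod>i<k. u (z i)))"
      by (simp add: mult.assoc)
  qed
  also have "\<dots> \<le> (\<Sum>(y, z)\<in>?Y \<times> ?Z. exp (a * real m) * ((\<Prod>i<k. exp (- a * real (lnorm (y i)))) * (\<Prod>i<k. u (z i))))"
    using fin sub by (intro sum_mono2) (auto intro!: mult_nonneg_nonneg prod_nonneg u dest: PiE_mem)
  also have "\<dots> = exp (a * real m) * ((\<Sum>y\<in>?Y. \<Prod>i<k. exp (- a * real (lnorm (y i)))) * (\<Sum>z\<in>?Z. \<Prod>i<k. u (z i)))"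
    by (subst sum.cartesian_product[symmetric], subst sum_product) (simp only: sum_distrib_left)
  also have "(\<Sum>y\<in>?Y. \<Prod>i<k. exp (- a * real (lnorm (y i)))) = (\<Sum>y | lnorm (y :: int ^ 'd) \<le> m. exp (- a * real (lnorm y))) ^ k"
    by (subst prod_sum_PiE[symmetric]) auto
  also have "(\<Sum>z\<in>?Z. \<Prod>i<k. u (z i)) = (\<Sum>z\<in>Z. u z) ^ k"
    using Z by (subst prod_sum_PiE[symmetric]) auto
  also have "exp (a * real m) * ((\<Sum>y | lnorm (y :: int ^ 'd) \<le> m. exp (- a * real (lnorm y))) ^ k * (\<Sum>z\<in>Z. u z) ^ k) \<le>
     exp (a * real m) * (((3 / a) ^ CARD('d)) ^ k * (\<Sum>z\<in>Z. u z) ^ k)"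
  proof (rule mult_left_mono[OF mult_right_mono[OF power_mono]])
    show "(\<Sum>y | lnorm (y :: int ^ 'd) \<le> m. exp (- a * real (lnorm y))) \<le> (3 / a) ^ CARD('d)"
      by (rule sum_lnorm_exp_le[OF a])
    show "0 \<le> (\<Sum>y | lnorm (y :: int ^ 'd) \<le> m. exp (- a * real (lnorm y)))"
      by (intro sum_nonneg) simp
  qed (use us in simp_all)
  finally show ?thesis by (simp add: power_mult_distrib)
qed

lemma lnorm_path_le:
  assumes "i \<le> j"
  shows "lnorm (p ! j - p ! i) \<le> (\<Sum>l\<in>{i..<j}. lnorm (p ! Suc l - p ! l))"
  using assms
proof (induction j rule: dec_induct)
  case (step n)
  have "lnorm (p ! Suc n - p ! i) \<le> lnorm (p ! Suc n - p ! n) + lnorm (p ! n - p ! i)"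
    by (rule lnorm_triangle_sub)
  thus ?case using step by simp
qed simp

text \<open>Any \<open>k\<close> of the positions in \<open>H\<close>, listed increasingly, form a
  chain: the steps between successive starts telescope below the length walked up to the last start.
  Only the lengths before each start are bounded by \<open>m\<close>, so the last edge itself may be
  much longer.\<close>

lemma path_in_chain_event:
  assumes w: "w \<in> space conf" and p: "distinct p" "p ! 0 = 0"
    and H: "finite H" "k \<le> card H" "\<And>i. i \<in> H \<Longrightarrow> Suc i < length p"
    and len: "\<And>i. i \<in> H \<Longrightarrow> (\<Sum>l<i. lnorm (p ! Suc l - p ! l)) \<le> m"
    and Z: "\<And>i. i \<in> H \<Longrightarrow> p ! Suc i - p ! i \<in> Z"
    and u: "\<And>i. i \<in> H \<Longrightarrow> \<bar>w {p ! i, p ! Suc i}\<bar> \<le> u (p ! Suc i - p ! i)"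
  shows "w \<in> chain_event u Z k m"
proof -
  obtain H' where H': "H' \<subseteq> H" "card H' = k" "finite H'"
    using obtain_subset_with_card_n[OF H(2)] H(1) finite_subset by metis
  obtain h where h: "bij_betw h {..<k} H'" "strict_mono_on {..<k} h"
    using ex_bij_betw_strict_mono_card[OF H'(3)] H'(2) by metis
  have hH: "h i \<in> H" if "i < k" for i using h(1) H'(1) that by (auto simp: bij_betw_def)
  have h_less: "h i < h j" if "i < j" "j < k" for i j
    using h(2) that by (auto simp: strict_mono_on_def)
  define y where "y = (\<lambda>i\<in>{..<k}. p ! (h i) - (if i = 0 then 0 else p ! (h (i - 1))))"
  define z where "z = (\<lambda>i\<in>{..<k}. p ! Suc (h i) - p ! (h i))"
  define cum where "cum i = (\<Sum>l<i. lnorm (p ! Suc l - p ! l))" for i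
  have pos: "chain_pos y i = p ! h i" if "i < k" for i
    using that
  proof (induction i)
    case (Suc i)
    thus ?case by (simp add: chain_pos_def y_def)
  qed (simp add: chain_pos_def y_def)
  have cum_diff: "lnorm (p ! j - p ! i) + cum i \<le> cum j" if "i \<le> j" for i j
  proof -
    have "cum j = cum i + (\<Sum>l\<in>{i..<j}. lnorm (p ! Suc l - p ! l))"
      unfolding cum_def using that by (simp add: lessThan_atLeast0 sum.atLeastLessThan_concat)
    thus ?thesis using lnorm_path_le[OF that, of p] by simp
  qed
  have sum_le: "(\<Sum>l\<le>i. lnorm (y l)) \<le> cum (h i)" if "i < k" for i
    using that
  proof (induction i)
    case 0
    thus ?case using cum_diff[of 0 "h 0"] p(2) by (simp add: y_def cum_def)
  next
    case (Suc i)
    have "lnorm (y (Suc i)) + cum (h i) \<le> cum (h (Suc i))"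
      using cum_diff[of "h i" "h (Suc i)"] h_less[of i "Suc i"] Suc.prems by (simp add: y_def)
    thus ?case using Suc by simp
  qed
  have tot: "(\<Sum>i<k. lnorm (y i)) \<le> m"
  proof (cases k)
    case (Suc k')
    have "(\<Sum>i<k. lnorm (y i)) \<le> cum (h k')" using sum_le[of k'] by (simp add: Suc lessThan_Suc_atMost)
    also have "\<dots> \<le> m" using len[OF hH, of k'] by (simp add: cum_def Suc)
    finally show ?thesis .
  qed simp
  have edge: "chain_edge y z i = {p ! h i, p ! Suc (h i)}" if "i < k" for i
    using that by (simp add: chain_edge_def pos z_def)
  have "inj_on (chain_edge y z) {..<k}"
  proof (rule inj_onI)
    fix i j assume ij: "i \<in> {..<k}" "j \<in> {..<k}" "chain_edge y z i = chain_edge y z j"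
    have "Suc (h i) < length p" "Suc (h j) < length p" using H(3) hH ij by auto
    hence "h i = h j" using ij p(1) by (auto simp: edge doubleton_eq_iff nth_eq_iff_index_eq)
    thus "i = j" using h(1) ij by (auto simp: bij_betw_def inj_on_def)
  qed
  moreover have "lnorm (y i) \<le> m" if "i < k" for i
  proof -
    have "lnorm (y i) \<le> (\<Sum>i<k. lnorm (y i))" using that by (intro member_le_sum) auto
    thus ?thesis using tot by simp
  qed
  moreover have "y \<in> extensional {..<k}" "z \<in> extensional {..<k}" by (simp_all add: y_def z_def)
  moreover have "z i \<in> Z" if "i < k" for i using Z[OF hH[OF that]] that by (simp add: z_def)
  ultimately have "(y, z) \<in> jump_chains Z k m"
    using tot by (simp add: jump_chains_def PiE_iff)
  moreover have "\<forall>i<k. \<bar>w (chain_edge y z i)\<bar> \<le> u (z i)"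
    using u hH by (simp add: edge) (simp add: z_def)
  ultimately show ?thesis using w unfolding chain_event_def by auto
qed

section \<open>Dyadic shells of displacements, and the deterministic lower bound\<close>

definition shell :: "nat \<Rightarrow> (int ^ 'd) set" where
  "shell j = {z. 2 ^ j \<le> lnorm z \<and> lnorm z < 2 ^ Suc j}"

lemma finite_shell [simp]: "finite (shell j)"
  by (rule finite_subset[OF _ finite_lnorm_le[of "2 ^ Suc j"]]) (auto simp: shell_def)

lemma zero_notin_shell [simp]: "0 \<notin> shell j"
  by (simp add: shell_def)

text \<open>For \<open>lnorm z \<le> N\<close> the weight \<open>exp (- lnorm z / N)\<close> is at
  least \<open>exp (- 1)\<close>, so the exponential sum with \<open>a = 1 / N\<close> counts points
  up to this factor.\<close>

lemma card_shell: "real (card (shell j :: (int ^ 'd) set)) \<le> exp 1 * (3 * 2 ^ Suc j) ^ CARD('d)"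
proof -
  define N where "N = (2 :: nat) ^ Suc j"
  have N: "N \<ge> 1" by (simp add: N_def)
  have "real (card (shell j :: (int ^ 'd) set)) * exp (- 1) = (\<Sum>z\<in>(shell j :: (int ^ 'd) set). exp (- 1))"
    by simp
  also have "\<dots> \<le> (\<Sum>z\<in>(shell j :: (int ^ 'd) set). exp (- (1 / real N) * real (lnorm z)))"
  proof (intro sum_mono)
    fix z :: "int ^ 'd" assume "z \<in> shell j"
    hence "lnorm z \<le> N" by (simp add: shell_def N_def)
    hence "real (lnorm z) / real N \<le> 1" using N by simp
    thus "exp (- 1) \<le> exp (- (1 / real N) * real (lnorm z))" by simp
  qed
  also have "\<dots> \<le> (\<Sum>z | lnorm (z :: int ^ 'd) \<le> N. exp (- (1 / real N) * real (lnorm z)))"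
    by (intro sum_mono2) (auto simp: shell_def N_def)
  also have "\<dots> \<le> (3 / (1 / real N)) ^ CARD('d)"
    using N by (intro sum_lnorm_exp_le) auto
  finally show ?thesis by (simp add: N_def exp_minus field_simps)
qed

text \<open>The length contributed by the surplus \<open>J - j\<close> in the thresholds of
  \<open>fpt_linear_growth\<close>: it stays of order \<open>2 ^ J\<close>, without a factor
  \<open>J\<close>.\<close>

lemma sum_power2_countdown: "(\<Sum>j<J. 2 ^ j * (real J - real j)) \<le> 2 * 2 ^ J"
proof -
  have "(\<Sum>j<J. 2 ^ j * (real J - real j)) = 2 * 2 ^ J - 2 - real J"
  proof (induction J)
    case (Suc J)
    have "(\<Sum>j<Suc J. 2 ^ j * (real (Suc J) - real j)) = (\<Sum>j<J. 2 ^ j * (real J - real j)) + (\<Sum>j<Suc J. 2 ^ j)"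
      by (simp add: sum.distrib algebra_simps sum_subtractf)
    also have "(\<Sum>j<Suc J. (2::real) ^ j) = 2 ^ Suc J - 1" by (simp only: sum_gp_strict) simp
    finally show ?case using Suc by simp
  qed simp
  thus ?thesis by simp
qed

lemma path_prefix_sum:
  fixes a :: "nat \<Rightarrow> nat"
  assumes "m \<le> (\<Sum>l<n. a l)"
  obtains q where "q \<le> n" "m \<le> (\<Sum>l<q. a l)" "\<And>i. i < q \<Longrightarrow> (\<Sum>l<i. a l) < m"
proof
  define q where "q = (LEAST q. m \<le> (\<Sum>l<q. a l))"
  show "m \<le> (\<Sum>l<q. a l)" unfolding q_def using assms by (rule LeastI)
  show "q \<le> n" unfolding q_def using assms by (rule Least_le)
  show "(\<Sum>l<i. a l) < m" if "i < q" for i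
    using not_less_Least[of i "\<lambda>q. m \<le> (\<Sum>l<q. a l)"] that unfolding q_def by (simp add: not_le)
qed

lemma ex_shell: "x \<noteq> 0 \<Longrightarrow> \<exists>j. x \<in> shell j"
proof -
  assume "x \<noteq> 0"
  hence "lnorm x \<ge> 1" using lnorm_pos_iff by blast
  from ex_power_ivl1[OF order.refl this] show ?thesis by (auto simp: shell_def)
qed

lemma shell_unique: "x \<in> shell i \<Longrightarrow> x \<in> shell j \<Longrightarrow> i = j"
proof -
  have False if "x \<in> shell i" "x \<in> shell j" "i < j" for i j
  proof -
    have "(2::nat) ^ Suc i \<le> 2 ^ j" using that(3) by (intro power_increasing) auto
    thus False using that by (simp add: shell_def)
  qed
  thus "x \<in> shell i \<Longrightarrow> x \<in> shell j \<Longrightarrow> i = j" by (metis nat_neq_iff)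
qed

text \<open>The 32 makes the additive parts of the thresholds, which amount to a length
  \<open>8 * 2 ^ J\<close>, at most \<open>m / 4\<close>. The 64 gives
  \<open>3 * m \<le> 192 * 2 ^ j\<close> for all \<open>j \<ge> J\<close>.\<close>

lemma exists_dyadic_scale:
  assumes "m \<ge> (64 :: nat)"
  obtains J where "32 * 2 ^ J \<le> m" "m < 64 * 2 ^ J"
proof -
  have "m div 32 \<ge> 1" using assms by linarith
  from ex_power_ivl1[OF order.refl this] obtain J where J: "2 ^ J \<le> m div 32" "m div 32 < 2 ^ Suc J" by auto
  have "32 * 2 ^ J \<le> m" using J(1) by linarith
  moreover have "m < 64 * 2 ^ J" using J(2) by simp
  ultimately show ?thesis by (rule that)
qed

text \<open>At most \<open>k j - 1\<close> cheap edges lie in shell \<open>j\<close>, each shorter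
  than \<open>2 ^ Suc j\<close>, so the assumption on the sum says that cheap edges cover at most
  half of the length \<open>m\<close>.\<close>

lemma (in fpp_rate) fpt_ge_of_few_long_jumps:
  fixes x :: "int ^ 'd" and m :: nat and k :: "nat \<Rightarrow> nat"
  assumes w: "w \<in> space conf" and c: "c > 0"
    and good: "\<And>j. w \<notin> chain_event (\<lambda>z. c * real (lnorm z) * r (lnorm z)) (shell j) (k j) m"
    and k: "\<And>j. j \<ge> J \<Longrightarrow> k j = 1" "\<And>j. k j \<ge> 1"
    and sum: "(\<Sum>j<J. 2 ^ Suc j * (real (k j) - 1)) \<le> real m / 2"
    and x: "lnorm x \<ge> m"
  shows "c * real m / 2 \<le> fpt r w 0 x"
proof (rule ccontr)
  assume "\<not> ?thesis"
  then obtain p where p: "is_path p 0 x" "distinct p" "walk_wt (cost r w) p < c * real m / 2"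
    using fpt_lessE[of w 0 x "c * real m / 2"] by (auto simp: not_le)
  define len where "len l = lnorm (p ! Suc l - p ! l)" for l
  define n where "n = length p - 1"
  have p0: "p ! 0 = 0" "p ! n = x" using p(1) by (auto simp: is_path_def hd_conv_nth last_conv_nth n_def)
  have "m \<le> (\<Sum>l<n. len l)"
    using x lnorm_path_le[of 0 n p] p0 by (simp add: len_def lessThan_atLeast0)
  \<comment> \<open>The path is cut where its length first reaches \<open>m\<close>. Every remaining
    edge then starts within length \<open>m\<close>, as the chain event requires, although the last
    one may end beyond it.\<close>
  then obtain q where q: "q \<le> n" "m \<le> (\<Sum>l<q. len l)" "\<And>i. i < q \<Longrightarrow> (\<Sum>l<i. len l) < m"
    by (rule path_prefix_sum) auto
  have nz: "p ! i \<noteq> p ! Suc i" if "i < n" for i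
    using p(1) that by (auto simp: is_path_def n_def)
  define H where "H = {i. i < q \<and> \<bar>w {p ! i, p ! Suc i}\<bar> \<le> c * real (len i) * r (len i)}"
  define Hj where "Hj j = {i\<in>H. p ! Suc i - p ! i \<in> shell j}" for j
  have fin: "finite H" "finite (Hj j)" for j by (auto simp: H_def Hj_def)
  have cardH: "card (Hj j) < k j" for j
  proof (rule ccontr)
    assume "\<not> card (Hj j) < k j"
    hence "w \<in> chain_event (\<lambda>z. c * real (lnorm z) * r (lnorm z)) (shell j) (k j) m"
      using q n_def
      by (intro path_in_chain_event[OF w p(2) p0(1) fin(2)[of j]])
         (auto simp: Hj_def H_def len_def intro: less_imp_le)
    with good show False by blast
  qed
  \<comment> \<open>From shell \<open>J\<close> on, \<open>k j = 1\<close> excludes even a single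
    cheap edge.\<close>
  have Hun: "H = (\<Union>j<J. Hj j)"
  proof (intro equalityI subsetI)
    fix i assume i: "i \<in> H"
    hence "p ! Suc i - p ! i \<noteq> 0" using nz[of i] q(1) by (auto simp: H_def)
    from ex_shell[OF this] obtain j where j: "p ! Suc i - p ! i \<in> shell j" by blast
    hence ij: "i \<in> Hj j" using i by (simp add: Hj_def)
    have "j < J"
    proof (rule ccontr)
      assume "\<not> j < J"
      hence "card (Hj j) = 0" using cardH[of j] k(1)[of j] by simp
      thus False using ij fin(2)[of j] by auto
    qed
    thus "i \<in> (\<Union>j<J. Hj j)" using ij by blast
  qed (auto simp: Hj_def)
  have disj: "Hj i \<inter> Hj j = {}" if "i \<noteq> j" for i j
    using that shell_unique unfolding Hj_def by blast
  have "(\<Sum>i\<in>H. real (len i)) = (\<Sum>j<J. \<Sum>i\<in>Hj j. real (len i))"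
    unfolding Hun by (rule sum.UNION_disjoint) (use fin(2) disj in auto)
  also have "\<dots> \<le> (\<Sum>j<J. 2 ^ Suc j * (real (k j) - 1))"
  proof (intro sum_mono)
    fix j
    have "(\<Sum>i\<in>Hj j. real (len i)) \<le> real (card (Hj j)) * 2 ^ Suc j"
    proof (intro sum_bounded_above)
      fix i assume "i \<in> Hj j"
      hence "len i \<le> 2 ^ Suc j" by (simp add: Hj_def shell_def len_def)
      thus "real (len i) \<le> 2 ^ Suc j" by (simp flip: of_nat_le_iff[where 'a = real])
    qed
    also have "\<dots> \<le> (real (k j) - 1) * 2 ^ Suc j"
      using cardH[of j] by (intro mult_right_mono) auto
    finally show "(\<Sum>i\<in>Hj j. real (len i)) \<le> 2 ^ Suc j * (real (k j) - 1)" by (simp add: mult.commute)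
  qed
  finally have short: "(\<Sum>i\<in>H. real (len i)) \<le> real m / 2" using sum by linarith
  have "real m \<le> (\<Sum>i<q. real (len i))" using q(2) by (simp flip: of_nat_sum)
  also have "\<dots> = (\<Sum>i\<in>{..<q} - H. real (len i)) + (\<Sum>i\<in>H. real (len i))"
    by (intro sum.subset_diff) (auto simp: H_def)
  finally have long: "real m / 2 \<le> (\<Sum>i\<in>{..<q} - H. real (len i))" using short by linarith
  have "c * (real m / 2) \<le> c * (\<Sum>i\<in>{..<q} - H. real (len i))"
    using long c by (intro mult_left_mono) auto
  also have "\<dots> \<le> (\<Sum>i\<in>{..<q} - H. cost r w (p ! i) (p ! Suc i))"
    unfolding sum_distrib_left
  proof (intro sum_mono)
    fix i assume i: "i \<in> {..<q} - H"
    have "r (len i) > 0" using r_lnorm_pos[of "p ! Suc i" "p ! i"] nz[of i] i q(1) by (auto simp: len_def)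
    moreover have "\<bar>w {p ! i, p ! Suc i}\<bar> > c * real (len i) * r (len i)" using i by (auto simp: H_def)
    ultimately show "c * real (len i) \<le> cost r w (p ! i) (p ! Suc i)"
      unfolding cost_alt lnorm_minus_commute[of "p ! i"] len_def[symmetric] by (simp add: pos_le_divide_eq)
  qed
  also have "\<dots> \<le> (\<Sum>i<n. cost r w (p ! i) (p ! Suc i))"
    using q(1) nz by (intro sum_mono2) (auto intro!: cost_nonneg)
  also have "\<dots> = walk_wt (cost r w) p" by (simp add: walk_wt_conv_sum n_def)
  finally show False using p(3) by simp
qed

section \<open>Positivity of the time constant\<close>

text \<open>About \<open>2 ^ (d * j)\<close> displacements of length about \<open>2 ^ j\<close> and
  rate at most \<open>C * (\<sigma> / 2 ^ (2 * d + 1)) ^ j\<close>: the powers of 2 combine to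
  \<open>2 ^ (- d * j)\<close>. This surplus is what the count of chain steps, of order
  \<open>a j ^ (- d)\<close>, uses up.\<close>

lemma (in fpp_rate) shell_sum_le:
  fixes C \<sigma> c :: real
  assumes mono: "\<And>k l. 1 \<le> k \<Longrightarrow> k \<le> l \<Longrightarrow> r l \<le> r k"
    and decay: "\<And>j. r (2 ^ j) \<le> C * (\<sigma> / 2 ^ (2 * CARD('d) + 1)) ^ j"
    and C: "C > 0" and \<sigma>: "\<sigma> > 0" and c: "c > 0"
  shows "(\<Sum>z\<in>(shell j :: (int ^ 'd) set). c * real (lnorm z) * r (lnorm z)) \<le>
           c * (exp 1 * 6 ^ CARD('d) * 2 * C) * (\<sigma> / 2 ^ CARD('d)) ^ j"
proof -
  define d where "d = CARD('d)"
  define A where "A = ((2::real) ^ d) ^ j"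
  define B where "B = (2::real) ^ j"
  have pos: "A > 0" "B > 0" by (simp_all add: A_def B_def)
  have D: "(2::real) ^ (2 * d + 1) = 2 ^ d * 2 ^ d * 2"
    by (simp only: power_add power_one_right power_mult power2_eq_square power_mult_distrib)
  have dec: "(\<sigma> / 2 ^ (2 * d + 1)) ^ j = \<sigma> ^ j / (A * A * B)"
    unfolding D by (simp add: A_def B_def power_divide power_mult_distrib)
  have "(\<Sum>z\<in>(shell j :: (int ^ 'd) set). c * real (lnorm z) * r (lnorm z)) \<le>
        (\<Sum>z\<in>(shell j :: (int ^ 'd) set). c * (2 * B) * (C * (\<sigma> ^ j / (A * A * B))))"
  proof (intro sum_mono)
    fix z :: "int ^ 'd" assume z: "z \<in> shell j"
    hence "lnorm z \<le> 2 ^ Suc j" by (simp add: shell_def)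
    from of_nat_mono[OF this, where 'a = real] have 1: "real (lnorm z) \<le> 2 * B" by (simp add: B_def)
    have "r (lnorm z) \<le> r (2 ^ j)" using z by (intro mono) (auto simp: shell_def)
    also have "\<dots> \<le> C * (\<sigma> ^ j / (A * A * B))" using decay[of j] by (simp only: dec d_def[symmetric])
    finally have 2: "r (lnorm z) \<le> C * (\<sigma> ^ j / (A * A * B))" .
    have "1 \<le> lnorm z" using z one_le_power[of "2::nat" j] unfolding shell_def by simp
    hence 3: "r (lnorm z) \<ge> 0" using r_pos by (simp add: less_imp_le)
    show "c * real (lnorm z) * r (lnorm z) \<le> c * (2 * B) * (C * (\<sigma> ^ j / (A * A * B)))"
      using 1 2 3 c pos by (intro mult_mono) auto
  qed
  also have "\<dots> = real (card (shell j :: (int ^ 'd) set)) * (c * (2 * B) * (C * (\<sigma> ^ j / (A * A * B))))"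
    by simp
  also have "\<dots> \<le> (exp 1 * (3 * 2 ^ Suc j) ^ CARD('d)) * (c * (2 * B) * (C * (\<sigma> ^ j / (A * A * B))))"
    using card_shell[where 'd = 'd, of j] c C \<sigma> pos by (intro mult_right_mono) auto
  also have "(3 * 2 ^ Suc j) ^ CARD('d) = 6 ^ d * A"
  proof -
    have "(3 * 2 ^ Suc j) ^ CARD('d) = (6 * 2 ^ j :: real) ^ d" by (simp add: d_def)
    also have "\<dots> = 6 ^ d * A" by (simp add: power_mult_distrib A_def mult.commute flip: power_mult)
    finally show ?thesis .
  qed
  also have "exp 1 * (6 ^ d * A) * (c * (2 * B) * (C * (\<sigma> ^ j / (A * A * B)))) = c * (exp 1 * 6 ^ d * 2 * C) * (\<sigma> ^ j / A)"
    using pos by (simp add: field_simps)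
  also have "\<sigma> ^ j / A = (\<sigma> / 2 ^ d) ^ j" by (simp add: A_def power_divide)
  finally show ?thesis by (simp add: d_def)
qed

text \<open>Below the scale \<open>2 ^ J\<close>, comparable to \<open>m\<close>, the rate \<open>a j\<close> makes the expected number of cheap edges per
  step of a chain at most \<open>exp (- 2)\<close>; the thresholds \<open>k j\<close> exceed \<open>a j * m\<close> by \<open>J - j\<close> so that the failure
  probabilities are summable in \<open>j\<close> uniformly in \<open>m\<close>. Above that scale no cheap edge occurs at all.\<close>
lemma (in fpp_rate) fpt_linear_growth:
  fixes C \<sigma> :: real
  assumes mono: "\<And>k l. 1 \<le> k \<Longrightarrow> k \<le> l \<Longrightarrow> r l \<le> r k"
    and decay: "\<And>j. r (2 ^ j) \<le> C * (\<sigma> / 2 ^ (2 * CARD('d) + 1)) ^ j"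
    and C: "C > 0" and \<sigma>: "0 < \<sigma>" "\<sigma> < 1"
  shows "\<exists>c>0. \<forall>m\<ge>64. measure conf {w \<in> space conf. \<forall>x :: int ^ 'd. lnorm x \<ge> m \<longrightarrow> c * real m \<le> fpt r w 0 x} \<ge> 1 / 2"
proof -
  define d where "d = CARD('d)"
  have d: "d \<ge> 1" by (simp add: d_def Suc_le_eq)
  \<comment> \<open>With \<open>a j\<close> proportional to \<open>(\<rho> / 2) ^ j\<close>, the
    choice \<open>\<rho> ^ d = \<sigma>\<close> makes \<open>a j ^ (- d)\<close> cancel
    \<open>(\<sigma> / 2 ^ d) ^ j\<close> exactly.\<close>
  define \<rho> where "\<rho> = root d \<sigma>"
  have \<rho>: "0 < \<rho>" "\<rho> < 1" "\<rho> ^ d = \<sigma>" using \<sigma> d by (simp_all add: \<rho>_def Suc_le_eq)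
  \<comment> \<open>Chosen so that the main parts \<open>a j * m\<close> of the thresholds amount to
    a length of at most \<open>m / 4\<close>.\<close>
  define \<kappa> where "\<kappa> = (1 - \<rho>) / 8"
  have \<kappa>: "0 < \<kappa>" "\<kappa> \<le> 1" using \<rho> by (simp_all add: \<kappa>_def)
  define C1 where "C1 = exp 1 * 6 ^ d * 2 * C"
  have C1: "C1 > 0" using C by (simp add: C1_def)
  \<comment> \<open>The first bound gives each cheap edge below scale \<open>J\<close> a factor
    \<open>exp (- 2)\<close>: one \<open>exp (- 1)\<close> per edge offsets
    \<open>exp (a j * m)\<close>, the other supplies the decay in \<open>J - j\<close>. The second
    bound makes cheap edges above that scale unlikely.\<close>
  define c where "c = min (exp (- 2) / (C1 * (3 / \<kappa>) ^ d)) ((1 - \<sigma>) / (4 * exp 1 * 192 ^ d * C1))"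
  have c: "c > 0" using C1 \<kappa> \<sigma> by (simp add: c_def)
  have c1: "(3 / \<kappa>) ^ d * (c * C1) \<le> exp (- 2)"
  proof -
    have "c \<le> exp (- 2) / (C1 * (3 / \<kappa>) ^ d)" by (simp add: c_def)
    thus ?thesis using C1 \<kappa> by (subst (asm) pos_le_divide_eq) (auto simp: mult_ac)
  qed
  have c2: "exp 1 * 192 ^ d * (c * C1) \<le> (1 - \<sigma>) / 4"
  proof -
    have "c \<le> (1 - \<sigma>) / (4 * exp 1 * 192 ^ d * C1)" by (simp add: c_def)
    thus ?thesis using C1 by (subst (asm) pos_le_divide_eq) (auto simp: mult_ac)
  qed
  define u where "u = (\<lambda>z :: int ^ 'd. c * real (lnorm z) * r (lnorm z))"
  have u0: "u z \<ge> 0" if "z \<in> shell j" for z j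
  proof -
    have "1 \<le> lnorm z" using that one_le_power[of "2::nat" j] unfolding shell_def by simp
    thus ?thesis using r_pos[of "lnorm z"] c by (simp add: u_def less_imp_le)
  qed
  have us: "(\<Sum>z\<in>shell j. u z) \<le> c * C1 * (\<sigma> / 2 ^ d) ^ j" for j
    using shell_sum_le[OF mono decay C \<sigma>(1) c, of j] unfolding u_def C1_def d_def by simp
  have us0: "(\<Sum>z\<in>shell j. u z) \<ge> 0" for j using u0 by (intro sum_nonneg) auto
  show ?thesis
  proof (intro exI[of _ "c / 2"] conjI allI impI)
    fix m :: nat assume m: "m \<ge> 64"
    obtain J where J: "32 * 2 ^ J \<le> m" "m < 64 * 2 ^ J" using exists_dyadic_scale[OF m] by blast
    \<comment> \<open>From scale \<open>J\<close> on one cheap edge is already too many. Its start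
      ranges over a ball of radius \<open>m\<close>, and \<open>a j = 1 / m\<close> bounds that
      count while keeping \<open>exp (a j * m) = exp 1\<close>.\<close>
    define a where "a j = (if j < J then \<kappa> * (\<rho> / 2) ^ j else 1 / real m)" for j
    define k where "k j = (if j < J then nat \<lceil>a j * real m\<rceil> + (J - j) + 2 else 1)" for j
    define Bad where "Bad j = chain_event u (shell j) (k j) m" for j
    have a: "0 < a j" "a j \<le> 1" for j
    proof -
      have "(\<rho> / 2) ^ j \<le> 1" using \<rho> by (intro power_le_one) auto
      thus "0 < a j" "a j \<le> 1" using \<rho> \<kappa> m by (auto simp: a_def intro: mult_le_one)
    qed
    have Bad_sets [measurable]: "Bad j \<in> sets conf" for j
      unfolding Bad_def by (intro chain_event_sets) auto
    have bad: "measure conf (Bad j) \<le> exp (a j * real m) * ((3 / a j) ^ d * (c * C1 * (\<sigma> / 2 ^ d) ^ j)) ^ k j" for j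
    proof -
      have "measure conf (Bad j) \<le> exp (a j * real m) * ((3 / a j) ^ d * (\<Sum>z\<in>shell j. u z)) ^ k j"
        unfolding Bad_def d_def using u0 a by (intro chain_event_prob) auto
      also have "\<dots> \<le> exp (a j * real m) * ((3 / a j) ^ d * (c * C1 * (\<sigma> / 2 ^ d) ^ j)) ^ k j"
        using us[of j] us0[of j] a[of j]
        by (intro mult_left_mono power_mono) (auto intro!: mult_nonneg_nonneg)
      finally show ?thesis .
    qed
    have bad_low: "measure conf (Bad j) \<le> (1 / 2) ^ (J - j + 2)" if j: "j < J" for j
    proof -
      have "(3 / a j) ^ d * (c * C1 * (\<sigma> / 2 ^ d) ^ j) = (3 / \<kappa>) ^ d * (c * C1) * (((2 / \<rho>) ^ j) ^ d * (\<sigma> / 2 ^ d) ^ j)"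
        using j \<rho> \<kappa> by (simp add: a_def power_divide power_mult_distrib field_simps)
      also have "((2 / \<rho>) ^ j) ^ d = (2 ^ d / \<sigma>) ^ j"
        by (simp add: power_divide flip: \<rho>(3) power_mult) (simp add: mult.commute)
      also have "(2 ^ d / \<sigma>) ^ j * (\<sigma> / 2 ^ d) ^ j = 1"
        using \<sigma> by (simp flip: power_mult_distrib)
      finally have "(3 / a j) ^ d * (c * C1 * (\<sigma> / 2 ^ d) ^ j) \<le> exp (- 2)"
        using c1 by (simp only: mult_1_right)
      moreover have "0 \<le> (3 / a j) ^ d * (c * C1 * (\<sigma> / 2 ^ d) ^ j)"
        using a[of j] c C1 \<sigma> by simp
      ultimately have "measure conf (Bad j) \<le> exp (a j * real m) * exp (- 2) ^ k j"
        using bad[of j] by (meson order_trans mult_left_mono power_mono exp_ge_zero)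
      also have "\<dots> = exp (a j * real m - 2 * real (k j))" by (simp flip: exp_of_nat_mult exp_add)
      also have "\<dots> \<le> exp (- real (J - j + 2))"
      proof -
        have "a j * real m + real (J - j + 2) \<le> real (k j)"
          using j real_nat_ceiling_ge[of "a j * real m"] by (simp add: k_def)
        thus ?thesis by (simp add: algebra_simps)
      qed
      also have "\<dots> = exp (- 1) ^ (J - j + 2)"
        using exp_of_nat_mult[of "J - j + 2" "- 1 :: real"] by (simp only: mult_minus1_right)
      also have "\<dots> \<le> (1 / 2) ^ (J - j + 2)"
        using exp_ge_add_one_self[of 1] by (intro power_mono) (auto simp: exp_minus field_simps)
      finally show ?thesis .
    qed
    have bad_high: "measure conf (Bad j) \<le> (1 - \<sigma>) / 4 * \<sigma> ^ j" if j: "J \<le> j" for j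
    proof -
      have m0: "real m > 0" using m by simp
      have "measure conf (Bad j) \<le> exp 1 * ((3 * real m) ^ d * (c * C1 * (\<sigma> / 2 ^ d) ^ j))"
        using bad[of j] j m0 by (simp add: a_def k_def)
      also have "(3 * real m) ^ d \<le> (192 * 2 ^ j) ^ d"
      proof (intro power_mono)
        have "m \<le> 64 * 2 ^ J" using J by simp
        also have "\<dots> \<le> 64 * 2 ^ j" using j by (intro mult_left_mono power_increasing) auto
        finally have "m \<le> 64 * 2 ^ j" .
        from of_nat_mono[OF this, where 'a = real] have "real m \<le> 64 * 2 ^ j" by simp
        thus "3 * real m \<le> 192 * 2 ^ j" by simp
      qed simp
      also have "exp 1 * ((192 * 2 ^ j) ^ d * (c * C1 * (\<sigma> / 2 ^ d) ^ j)) = exp 1 * 192 ^ d * (c * C1) * \<sigma> ^ j"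
        by (simp add: power_mult_distrib power_divide flip: power_mult) (simp add: mult.commute)
      also have "\<dots> \<le> (1 - \<sigma>) / 4 * \<sigma> ^ j" using c2 \<sigma> by (intro mult_right_mono) auto
      finally show ?thesis using c C1 \<sigma> by (simp add: mult_right_mono)
    qed
    \<comment> \<open>The total failure probability is at most 1/4 from the scales below
      \<open>J\<close> and 1/4 from the geometric series.\<close>
    define b where "b j = (if j \<in> {..<J} then (1 / 2) ^ (J - j + 2) else 0) + (1 - \<sigma>) / 4 * \<sigma> ^ j" for j
    have b: "measure conf (Bad j) \<le> b j" for j
    proof (cases "j < J")
      case True
      have "0 \<le> (1 - \<sigma>) / 4 * \<sigma> ^ j" using \<sigma> by simp
      thus ?thesis using bad_low[OF True] True by (simp add: b_def)
    qed (use bad_high in \<open>simp add: b_def\<close>)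
    have s1: "(\<lambda>j. if j \<in> {..<J} then (1 / 2 :: real) ^ (J - j + 2) else 0) sums (\<Sum>j<J. (1 / 2) ^ (J - j + 2))"
      by (rule sums_If_finite_set) simp
    have s2: "(\<lambda>j. (1 - \<sigma>) / 4 * \<sigma> ^ j) sums ((1 - \<sigma>) / 4 * (1 / (1 - \<sigma>)))"
      using \<sigma> by (intro sums_mult geometric_sums) simp
    have bs: "b sums ((\<Sum>j<J. (1 / 2) ^ (J - j + 2)) + (1 - \<sigma>) / 4 * (1 / (1 - \<sigma>)))"
      unfolding b_def[abs_def] by (rule sums_add[OF s1 s2])
    have low: "(\<Sum>j<J. (1 / 2 :: real) ^ (J - j + 2)) \<le> 1 / 4"
    proof -
      have "(\<Sum>j<J. (1 / 2 :: real) ^ (J - j + 2)) = (\<Sum>j<J. (1 / 2) ^ (J - Suc j + 3))"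
        by (intro sum.cong refl arg_cong[where f = "\<lambda>n. (1 / 2) ^ n"]) auto
      also have "\<dots> = (\<Sum>j<J. (1 / 2) ^ (j + 3))"
        by (rule sum.nat_diff_reindex)
      also have "\<dots> = 1 / 8 * (\<Sum>j<J. (1 / 2) ^ j)"
        by (simp add: power_add sum_distrib_left power3_eq_cube)
      also have "\<dots> \<le> 1 / 8 * 2"
        by (intro mult_left_mono) (simp_all add: sum_gp_strict)
      finally show ?thesis by simp
    qed
    have "measure conf (\<Union>j. Bad j) \<le> (\<Sum>j. measure conf (Bad j))"
    proof (rule conf.finite_measure_subadditive_countably)
      show "summable (\<lambda>j. measure conf (Bad j))"
        by (rule summable_comparison_test'[OF sums_summable[OF bs]]) (use b in auto)
    qed auto
    also have "\<dots> \<le> suminf b"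
      by (intro suminf_le b sums_summable[OF bs] summable_comparison_test'[OF sums_summable[OF bs]]) (use b in auto)
    also have "\<dots> \<le> 1 / 4 + 1 / 4"
    proof -
      have "1 - \<sigma> \<noteq> 0" using \<sigma> by simp
      hence "(1 - \<sigma>) / 4 * (1 / (1 - \<sigma>)) = 1 / 4" by (simp only: times_divide_times_eq mult_1_right) simp
      thus ?thesis using sums_unique[OF bs] low by linarith
    qed
    finally have Pbad: "measure conf (\<Union>j. Bad j) \<le> 1 / 2" by simp
    have ksum: "(\<Sum>j<J. 2 ^ Suc j * (real (k j) - 1)) \<le> real m / 2"
    proof -
      have "(\<Sum>j<J. 2 ^ Suc j * (real (k j) - 1)) \<le>
            (\<Sum>j<J. 2 * \<kappa> * real m * \<rho> ^ j + 2 * (2 ^ j * (real J - real j)) + 4 * 2 ^ j)"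
      proof (intro sum_mono)
        fix j assume "j \<in> {..<J}"
        hence j: "j < J" by simp
        have "real (nat \<lceil>a j * real m\<rceil>) \<le> a j * real m + 1" using a(1)[of j] by (simp add: of_nat_nat)
        hence "real (k j) - 1 \<le> a j * real m + (real J - real j) + 2" using j by (simp add: k_def of_nat_diff)
        hence "2 ^ Suc j * (real (k j) - 1) \<le> 2 ^ Suc j * (a j * real m + (real J - real j) + 2)"
          by (intro mult_left_mono) auto
        also have "\<dots> = 2 * \<kappa> * real m * \<rho> ^ j + 2 * (2 ^ j * (real J - real j)) + 4 * 2 ^ j"
          using j by (simp add: a_def power_divide field_simps)
        finally show "2 ^ Suc j * (real (k j) - 1) \<le> 2 * \<kappa> * real m * \<rho> ^ j + 2 * (2 ^ j * (real J - real j)) + 4 * 2 ^ j" .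
      qed
      also have "\<dots> = 2 * \<kappa> * real m * (\<Sum>j<J. \<rho> ^ j) + 2 * (\<Sum>j<J. 2 ^ j * (real J - real j)) + 4 * (\<Sum>j<J. 2 ^ j)"
        by (simp only: sum.distrib sum_distrib_left)
      also have "(\<Sum>j<J. \<rho> ^ j) \<le> 1 / (1 - \<rho>)"
        using \<rho> by (simp add: sum_gp_strict divide_right_mono)
      also have "(\<Sum>j<J. 2 ^ j * (real J - real j)) \<le> 2 * 2 ^ J" by (rule sum_power2_countdown)
      also have "(\<Sum>j<J. (2::real) ^ j) \<le> 2 ^ J" by (simp add: sum_gp_strict)
      finally have "(\<Sum>j<J. 2 ^ Suc j * (real (k j) - 1)) \<le> 2 * \<kappa> * real m * (1 / (1 - \<rho>)) + 2 * (2 * 2 ^ J) + 4 * 2 ^ J"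
        using \<kappa> by (simp add: mult_left_mono)
      also have "2 * \<kappa> * real m * (1 / (1 - \<rho>)) = real m / 4"
      proof -
        have "2 * (t / 8) * x * (1 / t) = x / 4" if "t \<noteq> 0" for t x :: real
          using that by (simp add: field_simps)
        moreover have "1 - \<rho> \<noteq> 0" using \<rho> by simp
        ultimately show ?thesis unfolding \<kappa>_def .
      qed
      also have "real m / 4 + 2 * (2 * 2 ^ J) + 4 * 2 ^ J \<le> real m / 2"
        using of_nat_mono[OF J(1), where 'a = real] by simp
      finally show ?thesis .
    qed
    have meas: "{w \<in> space conf. \<forall>x :: int ^ 'd. lnorm x \<ge> m \<longrightarrow> c / 2 * real m \<le> fpt r w 0 x} \<in> sets conf"
      by measurable
    have "space conf - (\<Union>j. Bad j) \<subseteq> {w \<in> space conf. \<forall>x :: int ^ 'd. lnorm x \<ge> m \<longrightarrow> c / 2 * real m \<le> fpt r w 0 x}"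
    proof clarify
      fix w and x :: "int ^ 'd" assume w: "w \<in> space conf" "w \<notin> (\<Union>j. Bad j)" and x: "m \<le> lnorm x"
      have "c * real m / 2 \<le> fpt r w 0 x"
      proof (rule fpt_ge_of_few_long_jumps[OF w(1) c _ _ _ ksum x])
        show "w \<notin> chain_event (\<lambda>z. c * real (lnorm z) * r (lnorm z)) (shell j) (k j) m" for j
          using w(2) unfolding Bad_def u_def by blast
      qed (simp_all add: k_def)
      thus "c / 2 * real m \<le> fpt r w 0 x" by simp
    qed
    hence "measure conf (space conf - (\<Union>j. Bad j)) \<le>
        measure conf {w \<in> space conf. \<forall>x :: int ^ 'd. lnorm x \<ge> m \<longrightarrow> c / 2 * real m \<le> fpt r w 0 x}"
      by (intro conf.finite_measure_mono meas)
    moreover have "measure conf (space conf - (\<Union>j. Bad j)) = 1 - measure conf (\<Union>j. Bad j)"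
      by (intro conf.prob_compl) auto
    ultimately show "measure conf {w \<in> space conf. \<forall>x :: int ^ 'd. lnorm x \<ge> m \<longrightarrow> c / 2 * real m \<le> fpt r w 0 x} \<ge> 1 / 2"
      using Pbad by linarith
  qed (use c in simp)
qed

lemma (in fpp_rate) mean_fpt_mult_le:
  "(\<integral>w. fpt r w 0 (lattice_smult n z) \<partial>conf) \<le> real n * (\<integral>w. fpt r w 0 z \<partial>conf)"
proof -
  have i: "integrable conf (\<lambda>w. fpt r (shift v w) 0 z)" for v
    by (rule integrable_shift[OF sqint_integrable[OF sqint_fpt]])
  have "(\<integral>w. fpt r w 0 (lattice_smult n z) \<partial>conf) \<le> (\<integral>w. (\<Sum>i<n. fpt r (shift (lattice_smult i z) w) 0 z) \<partial>conf)"
    using i by (intro integral_mono sqint_integrable[OF sqint_fpt] fpt_smult_le_sum) auto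
  also have "\<dots> = (\<Sum>i<n. \<integral>w. fpt r (shift (lattice_smult i z) w) 0 z \<partial>conf)"
    using i by (intro Bochner_Integration.integral_sum) auto
  also have "\<dots> = real n * (\<integral>w. fpt r w 0 z \<partial>conf)"
    by (simp add: integral_shift[of "\<lambda>w. fpt r w 0 z"])
  finally show ?thesis .
qed

text \<open>A linear lower bound holding with probability 1/2 costs only a factor 2 in the mean,
  because passage times are nonnegative.\<close>

lemma (in fpp_rate) time_const_lower:
  fixes C \<sigma> :: real
  assumes "\<And>k l. 1 \<le> k \<Longrightarrow> k \<le> l \<Longrightarrow> r l \<le> r k"
    and "\<And>j. r (2 ^ j) \<le> C * (\<sigma> / 2 ^ (2 * CARD('d) + 1)) ^ j"
    and "C > 0" "0 < \<sigma>" "\<sigma> < 1"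
  shows "\<exists>c>0. \<forall>z :: int ^ 'd. c * real (lnorm z) \<le> time_const r z"
proof -
  obtain c where c: "c > 0" and prob: "\<And>m. m \<ge> 64 \<Longrightarrow>
      measure conf {w \<in> space conf. \<forall>x :: int ^ 'd. lnorm x \<ge> m \<longrightarrow> c * real m \<le> fpt r w 0 x} \<ge> 1 / 2"
    using fpt_linear_growth[where 'd = 'd, OF assms] by blast
  have large: "c / 2 * real (lnorm x) \<le> (\<integral>w. fpt r w 0 x \<partial>conf)" if "lnorm x \<ge> 64" for x :: "int ^ 'd"
  proof -
    define G where "G = {w \<in> space conf. \<forall>y :: int ^ 'd. lnorm y \<ge> lnorm x \<longrightarrow> c * real (lnorm x) \<le> fpt r w 0 y}"
    have [measurable]: "G \<in> sets conf" unfolding G_def by measurable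
    have "c / 2 * real (lnorm x) \<le> c * real (lnorm x) * measure conf G"
      using prob[OF that] c mult_left_mono[of "1 / 2" "measure conf G" "c * real (lnorm x)"] by (simp add: G_def)
    also have "\<dots> = (\<integral>w. c * real (lnorm x) * indicator G w \<partial>conf)" by simp
    also have "\<dots> \<le> (\<integral>w. fpt r w 0 x \<partial>conf)"
    proof (intro integral_mono sqint_integrable[OF sqint_fpt])
      show "integrable conf (\<lambda>w. c * real (lnorm x) * indicator G w)"
        by (simp add: conf.emeasure_eq_measure)
      show "c * real (lnorm x) * indicator G w \<le> fpt r w 0 x" for w
        by (auto simp: G_def indicator_def fpt_nonneg)
    qed
    finally show ?thesis .
  qed
  have "c / 2 * real (lnorm z) \<le> time_const r z" for z :: "int ^ 'd"
  proof (cases "z = 0")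
    case True thus ?thesis by (simp add: time_const_nonneg)
  next
    case False
    hence z1: "lnorm z \<ge> 1" using lnorm_pos_iff by blast
    show ?thesis
    proof (rule time_const_ge)
      fix n :: nat assume n: "n \<ge> 1"
      \<comment> \<open>Multiplication by 64 brings every nonzero point into the range of
        \<open>large\<close>; subadditivity of the mean gives the factor back.\<close>
      have "64 \<le> 64 * (n * lnorm z)" using n z1 by simp
      hence "c / 2 * real (lnorm (lattice_smult 64 (lattice_smult n z))) \<le> (\<integral>w. fpt r w 0 (lattice_smult 64 (lattice_smult n z)) \<partial>conf)"
        by (intro large) (simp add: lnorm_smult)
      also have "\<dots> \<le> real 64 * (\<integral>w. fpt r w 0 (lattice_smult n z) \<partial>conf)"
        by (rule mean_fpt_mult_le)
      finally show "c / 2 * real (lnorm z) * real n \<le> (\<integral>w. fpt r w 0 (lattice_smult n z) \<partial>conf)"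
        by (simp add: lnorm_smult algebra_simps)
    qed
  qed
  thus ?thesis using c by (intro exI[of _ "c / 2"]) auto
qed

section \<open>The limit shape\<close>

lemma nonincreasing_from_Suc:
  fixes r :: "nat \<Rightarrow> real"
  assumes "\<forall>k\<ge>1. r (Suc k) \<le> r k" "1 \<le> k" "k \<le> l"
  shows "r l \<le> r k"
  using assms(3) by (induction l rule: dec_induct) (use assms order_trans in \<open>force+\<close>)

text \<open>Slow variation at ratio 2 makes \<open>r (2 ^ Suc j) / r (2 ^ j)\<close> tend to
  \<open>2 powr (- \<alpha>)\<close>, below \<open>2 powr (- D)\<close>, so the dyadic values decay
  geometrically from some \<open>N\<close> on. Positivity holds far out because \<open>L\<close> is
  eventually positive, and monotonicity carries it back.\<close>

lemma regularly_varying_dyadic_decay: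
  fixes r :: "nat \<Rightarrow> real" and L :: "real \<Rightarrow> real" and D :: nat
  assumes alpha: "\<alpha> > real D" and sv: "slowly_varying L"
    and r: "\<forall>k\<ge>1. r k = real k powr (- \<alpha>) * L (real k)"
    and nonneg: "\<forall>k\<ge>1. r k \<ge> 0" and dec: "\<forall>k\<ge>1. r (Suc k) \<le> r k"
  shows "\<forall>k\<ge>1. r k > 0"
    and "\<exists>C \<sigma>. C > 0 \<and> 0 < \<sigma> \<and> \<sigma> < 1 \<and> (\<forall>j. r (2 ^ j) \<le> C * (\<sigma> / 2 ^ D) ^ j)"
proof -
  have mono: "r l \<le> r k" if "1 \<le> k" "k \<le> l" for k l
    using nonincreasing_from_Suc[OF dec that] .
  have Lpos: "\<forall>\<^sub>F x in at_top. L x > 0" and Llim: "((\<lambda>x. L (2 * x) / L x) \<longlongrightarrow> 1) at_top"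
    using sv by (auto simp: slowly_varying_def)
  have ev: "\<forall>\<^sub>F k in sequentially. L (real k) > 0"
    using Lpos filterlim_real_sequentially by (rule eventually_compose_filterlim)
  show pos: "\<forall>k\<ge>1. r k > 0"
  proof (intro allI impI)
    fix k :: nat assume k: "k \<ge> 1"
    obtain l where l: "l \<ge> k" "L (real l) > 0"
      using eventually_happens[OF eventually_conj[OF eventually_ge_at_top[of k] ev]] by auto
    have "0 < r l" using l k r by simp
    also have "\<dots> \<le> r k" by (rule mono) (use k l in auto)
    finally show "0 < r k" .
  qed
  \<comment> \<open>Puts the exponent of \<open>\<theta> = \<sigma> / 2 ^ D\<close> halfway between
    \<open>D\<close> and \<open>\<alpha>\<close>.\<close>
  define \<sigma> where "\<sigma> = 2 powr (- ((\<alpha> - real D) / 2))"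
  have \<sigma>: "0 < \<sigma>" "\<sigma> < 1" using powr_less_mono[of "- ((\<alpha> - real D) / 2)" 0 2] alpha by (simp_all add: \<sigma>_def)
  define \<theta> where "\<theta> = \<sigma> / 2 ^ D"
  have \<theta>0: "\<theta> > 0" using \<sigma> by (simp add: \<theta>_def)
  have "\<sigma> / 2 ^ D \<le> \<sigma> / 1" using \<sigma> by (intro divide_left_mono) auto
  hence \<theta>1: "\<theta> \<le> 1" using \<sigma>(2) unfolding \<theta>_def div_by_1 by linarith
  have \<theta>_powr: "\<theta> = 2 powr (- ((\<alpha> + real D) / 2))"
  proof -
    have "\<theta> = 2 powr (- ((\<alpha> - real D) / 2) - real D)"
      by (simp add: \<theta>_def \<sigma>_def powr_diff powr_realpow)
    moreover have "- ((\<alpha> - real D) / 2) - real D = - ((\<alpha> + real D) / 2)" by (simp add: field_simps)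
    ultimately show ?thesis by (simp only:)
  qed
  have lim2: "filterlim (\<lambda>j::nat. (2::real) ^ j) at_top sequentially"
    by real_asymp
  have "((\<lambda>j::nat. 2 powr (- \<alpha>) * (L (2 * 2 ^ j) / L (2 ^ j))) \<longlongrightarrow> 2 powr (- \<alpha>) * 1) sequentially"
    using filterlim_compose[OF Llim lim2] by (intro tendsto_mult tendsto_const)
  moreover have "2 powr (- \<alpha>) * 1 < \<theta>" using alpha by (simp add: \<theta>_powr)
  ultimately have "\<forall>\<^sub>F j in sequentially. 2 powr (- \<alpha>) * (L (2 * 2 ^ j) / L (2 ^ j)) < \<theta>"
    by (rule order_tendstoD)
  then obtain N where N: "\<And>j. j \<ge> N \<Longrightarrow> 2 powr (- \<alpha>) * (L (2 * 2 ^ j) / L (2 ^ j)) < \<theta>"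
    by (auto simp: eventually_sequentially)
  have step: "r (2 ^ Suc j) \<le> \<theta> * r (2 ^ j)" if "j \<ge> N" for j
  proof -
    have a: "r (2 ^ j) = (2 ^ j) powr (- \<alpha>) * L (2 ^ j)"
      and b: "r (2 ^ Suc j) = (2 * 2 ^ j) powr (- \<alpha>) * L (2 * 2 ^ j)"
      using r[rule_format, of "2 ^ j"] r[rule_format, of "2 ^ Suc j"] by simp_all
    have "r (2 ^ j) > 0" using pos by simp
    hence Lj: "L (2 ^ j) > 0" unfolding a by (simp add: zero_less_mult_iff)
    have "r (2 ^ Suc j) = 2 powr (- \<alpha>) * (L (2 * 2 ^ j) / L (2 ^ j)) * r (2 ^ j)"
      unfolding a b using Lj by (subst powr_mult) auto
    also have "\<dots> \<le> \<theta> * r (2 ^ j)" using N[OF that] \<open>r (2 ^ j) > 0\<close> by (intro mult_right_mono) auto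
    finally show ?thesis .
  qed
  \<comment> \<open>Makes the bound true up to \<open>j = N\<close> by monotonicity alone, which
    also starts the induction beyond \<open>N\<close>.\<close>
  define C where "C = r 1 / \<theta> ^ N"
  have r1: "r 1 > 0" using pos by simp
  have "r (2 ^ j) \<le> C * \<theta> ^ j" for j
  proof (cases "j \<le> N")
    case True
    have "r (2 ^ j) \<le> r 1" by (rule mono) auto
    also have "r 1 = C * \<theta> ^ N" using \<theta>0 by (simp add: C_def)
    also have "\<dots> \<le> C * \<theta> ^ j"
      using True \<theta>0 \<theta>1 r1 by (intro mult_left_mono power_decreasing) (auto simp: C_def)
    finally show ?thesis .
  next
    case False
    hence "N \<le> j" by simp
    thus ?thesis
    proof (induction j rule: dec_induct)
      case base
      have "r (2 ^ N) \<le> r 1" by (rule mono) auto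
      thus ?case using \<theta>0 by (simp add: C_def)
    next
      case (step j)
      have "r (2 ^ Suc j) \<le> \<theta> * (C * \<theta> ^ j)"
        using assms step.IH \<theta>0 \<open>\<And>j. j \<ge> N \<Longrightarrow> r (2 ^ Suc j) \<le> \<theta> * r (2 ^ j)\<close>[OF step.hyps(1)]
        by (meson less_imp_le mult_left_mono order_trans)
      thus ?case by (simp add: mult_ac)
    qed
  qed
  moreover have "C > 0" using r1 \<theta>0 by (simp add: C_def)
  ultimately show "\<exists>C \<sigma>. C > 0 \<and> 0 < \<sigma> \<and> \<sigma> < 1 \<and> (\<forall>j. r (2 ^ j) \<le> C * (\<sigma> / 2 ^ D) ^ j)"
    using \<sigma> \<theta>_def by blast
qed

lemma (in prob_space) prob_tendsto_1_of_AE_eventually: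
  assumes [measurable]: "\<And>n. A n \<in> sets M" and "AE s in M. \<forall>\<^sub>F n in sequentially. s \<in> A n"
  shows "(\<lambda>n. measure M (A n)) \<longlonglongrightarrow> 1"
proof -
  have "(\<lambda>n. \<integral>s. indicator (A n) s \<partial>M) \<longlonglongrightarrow> (\<integral>s. (1::real) \<partial>M)"
  proof (rule integral_dominated_convergence[where w = "\<lambda>_. 1"])
    show "AE s in M. (\<lambda>n. indicator (A n) s :: real) \<longlonglongrightarrow> 1"
      using assms(2)
    proof eventually_elim
      case (elim s)
      hence "\<forall>\<^sub>F n in sequentially. (indicator (A n) s :: real) = 1" by eventually_elim simp
      thus ?case by (rule tendsto_eventually)
    qed
  qed (auto simp: indicator_def)
  thus ?thesis by (simp add: prob_space)
qed

section \<open>Homogeneous extension from the lattice to real vectors\<close>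

definition l1 :: "real ^ 'd \<Rightarrow> real" where
  "l1 y = (\<Sum>i\<in>UNIV. \<bar>y $ i\<bar>)"

lemma l1_nonneg: "l1 y \<ge> 0"
  by (simp add: l1_def sum_nonneg)

lemma l1_pos: "y \<noteq> 0 \<Longrightarrow> l1 y > 0"
proof -
  assume "y \<noteq> 0"
  then obtain i where "y $ i \<noteq> 0" by (auto simp: vec_eq_iff)
  thus ?thesis unfolding l1_def by (intro sum_pos2[of _ i]) auto
qed

lemma l1_triangle: "l1 (x + y) \<le> l1 x + l1 y"
  unfolding l1_def sum.distrib[symmetric] by (intro sum_mono) (simp add: abs_triangle_ineq)

lemma l1_scaleR: "l1 (a *\<^sub>R y) = \<bar>a\<bar> * l1 y"
  by (simp add: l1_def abs_mult sum_distrib_left)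

lemma l1_real_of_lattice: "l1 (real_of_lattice x) = real (lnorm x)"
  by (simp add: l1_def real_lnorm real_of_lattice_def)

lemma real_of_lattice_diff: "real_of_lattice (x - y) = real_of_lattice x - real_of_lattice y"
  by (simp add: real_of_lattice_def vec_eq_iff)

lemma real_of_lattice_smult: "real_of_lattice (lattice_smult n x) = real n *\<^sub>R real_of_lattice x"
  by (simp add: real_of_lattice_def lattice_smult_def vec_eq_iff)

text \<open>A McShane-type extension. Taking the infimum over all real dilations of lattice points, and not
  only over lattice points, makes the extension homogeneous.\<close>
definition norm_extension :: "real \<Rightarrow> (int ^ 'd \<Rightarrow> real) \<Rightarrow> real ^ 'd \<Rightarrow> real" where
  "norm_extension K f y = (INF (x, s)\<in>UNIV \<times> {0<..}. s * f x + K * l1 (y - s *\<^sub>R real_of_lattice x))"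

text \<open>The triangle inequality appears as a Lipschitz bound, since this is what the
  interpolation along nearest-neighbour paths delivers.\<close>

locale lattice_seminorm =
  fixes K :: real and f :: "int ^ 'd \<Rightarrow> real"
  assumes K: "K > 0" and nonneg: "f x \<ge> 0"
    and homogeneous: "f (lattice_smult n x) = real n * f x"
    and lipschitz: "f x \<le> f y + K * real (lnorm (x - y))"
begin

lemma norm_extension_le: "s > 0 \<Longrightarrow> norm_extension K f y \<le> s * f x + K * l1 (y - s *\<^sub>R real_of_lattice x)"
  unfolding norm_extension_def
  by (rule order_trans[OF cINF_lower[where x = "(x, s)"]])
     (use K nonneg l1_nonneg in \<open>auto intro!: bdd_belowI2[of _ 0] add_nonneg_nonneg mult_nonneg_nonneg\<close>)

lemma norm_extension_ge:
  "(\<And>x s. s > 0 \<Longrightarrow> c \<le> s * f x + K * l1 (y - s *\<^sub>R real_of_lattice x)) \<Longrightarrow> c \<le> norm_extension K f y"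
  unfolding norm_extension_def by (rule cINF_greatest) (auto intro: exI[of _ 1])

lemma norm_extension_nonneg: "norm_extension K f y \<ge> 0"
  using K nonneg l1_nonneg by (intro norm_extension_ge) (auto intro!: add_nonneg_nonneg mult_nonneg_nonneg)

lemma norm_extension_scaleR:
  assumes t: "t > 0"
  shows "norm_extension K f (t *\<^sub>R y) = t * norm_extension K f y"
proof -
  have le: "norm_extension K f (t *\<^sub>R y) \<le> t * norm_extension K f y" if t: "t > 0" for t y
  proof -
    have "norm_extension K f (t *\<^sub>R y) / t \<le> norm_extension K f y"
    proof (rule norm_extension_ge)
      fix x and s :: real assume s: "s > 0"
      have "norm_extension K f (t *\<^sub>R y) \<le> (t * s) * f x + K * l1 (t *\<^sub>R y - (t * s) *\<^sub>R real_of_lattice x)"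
        using t s by (intro norm_extension_le) simp
      also have "t *\<^sub>R y - (t * s) *\<^sub>R real_of_lattice x = t *\<^sub>R (y - s *\<^sub>R real_of_lattice x)"
        by (simp add: scaleR_right_diff_distrib)
      also have "(t * s) * f x + K * l1 (t *\<^sub>R (y - s *\<^sub>R real_of_lattice x)) =
          (s * f x + K * l1 (y - s *\<^sub>R real_of_lattice x)) * t"
        using t unfolding l1_scaleR by (simp add: ring_distribs)
      finally show "norm_extension K f (t *\<^sub>R y) / t \<le> s * f x + K * l1 (y - s *\<^sub>R real_of_lattice x)"
        using t by (simp only: pos_divide_le_eq)
    qed
    thus ?thesis using t by (simp add: pos_divide_le_eq mult.commute)
  qed
  have "norm_extension K f ((1 / t) *\<^sub>R (t *\<^sub>R y)) \<le> (1 / t) * norm_extension K f (t *\<^sub>R y)"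
    using t by (intro le) simp
  hence "t * norm_extension K f y \<le> norm_extension K f (t *\<^sub>R y)"
    using t by (simp add: pos_le_divide_eq mult.commute)
  with le[OF t, of y] show ?thesis by simp
qed

text \<open>For rational \<open>s = m / n\<close> the lower bound is the Lipschitz inequality
  between \<open>n\<close> times \<open>a\<close> and \<open>m\<close> times \<open>x\<close>,
  divided by \<open>n\<close>. Real \<open>s\<close> follows by continuity of \<open>l1\<close>,
  approximating \<open>s\<close> by \<open>nat \<lfloor>s * n\<rfloor> / n\<close>.\<close>

lemma norm_extension_lattice: "norm_extension K f (real_of_lattice a) = f a"
proof (rule antisym)
  show "norm_extension K f (real_of_lattice a) \<le> f a"
    using norm_extension_le[of 1 "real_of_lattice a" a] by (simp add: l1_def)
  show "f a \<le> norm_extension K f (real_of_lattice a)"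
  proof (rule norm_extension_ge)
    fix x and s :: real assume s: "s > 0"
    define m where "m n = nat \<lfloor>s * real n\<rfloor>" for n :: nat
    define q where "q n = real (m n) / real n" for n
    have "q \<longlonglongrightarrow> s" unfolding q_def m_def using s by real_asymp
    hence "(\<lambda>n. q n * f x + K * l1 (real_of_lattice a - q n *\<^sub>R real_of_lattice x)) \<longlonglongrightarrow>
        s * f x + K * l1 (real_of_lattice a - s *\<^sub>R real_of_lattice x)"
      unfolding l1_def by (auto intro!: tendsto_intros)
    moreover have "f a \<le> q n * f x + K * l1 (real_of_lattice a - q n *\<^sub>R real_of_lattice x)" if n: "n \<ge> 1" for n
    proof -
      have "real n * f a \<le> real (m n) * f x + K * real (lnorm (lattice_smult n a - lattice_smult (m n) x))"
        using lipschitz[of "lattice_smult n a" "lattice_smult (m n) x"] by (simp add: homogeneous)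
      also have "real (lnorm (lattice_smult n a - lattice_smult (m n) x)) =
          l1 (real n *\<^sub>R (real_of_lattice a - q n *\<^sub>R real_of_lattice x))"
        using n by (simp add: q_def real_of_lattice_diff real_of_lattice_smult scaleR_right_diff_distrib flip: l1_real_of_lattice)
      also have "\<dots> = real n * l1 (real_of_lattice a - q n *\<^sub>R real_of_lattice x)"
        by (simp add: l1_scaleR)
      also have "real (m n) * f x + K * (real n * l1 (real_of_lattice a - q n *\<^sub>R real_of_lattice x)) =
         real n * (q n * f x + K * l1 (real_of_lattice a - q n *\<^sub>R real_of_lattice x))"
        using n by (simp add: q_def algebra_simps)
      finally show ?thesis using n by simp
    qed
    ultimately show "f a \<le> s * f x + K * l1 (real_of_lattice a - s *\<^sub>R real_of_lattice x)"
      by (intro LIMSEQ_le_const[where X = "\<lambda>n. q n * f x + K * l1 (real_of_lattice a - q n *\<^sub>R real_of_lattice x)"]) blast+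
  qed
qed

text \<open>Part of \<open>y\<close> is charged at the rate of \<open>f\<close> and the rest at the
  slope \<open>K\<close> of the penalty, so a linear lower bound survives when its constant is at
  most both.\<close>

lemma norm_extension_lower:
  assumes c: "\<And>x. c * real (lnorm x) \<le> f x" "0 \<le> c" "c \<le> K"
  shows "c * l1 y \<le> norm_extension K f y"
proof (rule norm_extension_ge)
  fix x and s :: real assume s: "s > 0"
  have "c * l1 y \<le> c * (l1 (s *\<^sub>R real_of_lattice x) + l1 (y - s *\<^sub>R real_of_lattice x))"
    using l1_triangle[of "s *\<^sub>R real_of_lattice x" "y - s *\<^sub>R real_of_lattice x"] c by (intro mult_left_mono) auto
  also have "\<dots> = s * (c * real (lnorm x)) + c * l1 (y - s *\<^sub>R real_of_lattice x)"
    using s by (simp add: l1_scaleR l1_real_of_lattice algebra_simps)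
  also have "\<dots> \<le> s * f x + K * l1 (y - s *\<^sub>R real_of_lattice x)"
    using s c l1_nonneg by (intro add_mono mult_left_mono mult_right_mono) auto
  finally show "c * l1 y \<le> s * f x + K * l1 (y - s *\<^sub>R real_of_lattice x)" .
qed

end

context fpp_rate begin

text \<open>Divide the interpolation estimate between the \<open>n\<close>-th multiples of
  \<open>b\<close> and \<open>a\<close> by \<open>n\<close> and pass to the radial limits in one
  configuration.\<close>

lemma time_const_lipschitz:
  fixes a b :: "int ^ 'd"
  shows "time_const r a \<le> time_const r b + 4 * real (lnorm (a - b))"
proof (rule field_le_epsilon)
  fix \<eta> :: real assume \<eta>: "\<eta> > 0"
  \<comment> \<open>A deterministic inequality that holds almost surely under a probability measure
    is true.\<close>
  have "AE w in (conf :: ((int ^ 'd) set \<Rightarrow> real) measure). time_const r a \<le> time_const r b + 4 * real (lnorm (a - b)) + \<eta>"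
    using fpt_radial_limit[of a] fpt_radial_limit[of b] fpt_interpolation[OF \<eta>, of "lnorm (a - b)" b]
  proof eventually_elim
    case (elim w)
    have "(\<lambda>n. fpt r w 0 (lattice_smult n b) / real n + (\<eta> + 4 * real (lnorm (a - b)))) \<longlonglongrightarrow>
            time_const r b + (\<eta> + 4 * real (lnorm (a - b)))"
      by (intro tendsto_add elim tendsto_const)
    moreover have "\<forall>\<^sub>F n in sequentially. fpt r w 0 (lattice_smult n a) / real n \<le>
        fpt r w 0 (lattice_smult n b) / real n + (\<eta> + 4 * real (lnorm (a - b)))"
      using elim(3) eventually_gt_at_top[of 0]
    proof eventually_elim
      case (elim n)
      have e: "lattice_smult n b + lattice_smult n (a - b) = lattice_smult n a"
        by (simp add: lattice_smult_diff)
      have "fpt r w (lattice_smult n b) (lattice_smult n a) \<le> \<eta> * real n + 4 * real (n * lnorm (a - b))"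
        using elim(1)[rule_format, of "lattice_smult n (a - b)"] by (simp add: e lnorm_smult mult.commute)
      with fpt_triangle[of w 0 "lattice_smult n a" "lattice_smult n b"]
      have "fpt r w 0 (lattice_smult n a) \<le> fpt r w 0 (lattice_smult n b) + (\<eta> + 4 * real (lnorm (a - b))) * real n"
        by (simp add: algebra_simps)
      thus ?case using elim(2) by (simp add: field_simps)
    qed
    ultimately show ?case
      using tendsto_le[OF trivial_limit_sequentially _ elim(1)] by (auto simp: algebra_simps)
  qed
  thus "time_const r a \<le> time_const r b + 4 * real (lnorm (a - b)) + \<eta>" by simp
qed

lemma time_const_smult:
  fixes z :: "int ^ 'd"
  shows "time_const r (lattice_smult k z) = real k * time_const r z"
proof (cases "k = 0")
  case True
  have "time_const r (0 :: int ^ 'd) = 0"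
    using time_const_le[of 1 "0 :: int ^ 'd"] time_const_nonneg[of "0 :: int ^ 'd"] by simp
  thus ?thesis using True by simp
next
  case False
  have "AE w in (conf :: ((int ^ 'd) set \<Rightarrow> real) measure). time_const r (lattice_smult k z) = real k * time_const r z"
    using fpt_radial_limit[of z] fpt_radial_limit[of "lattice_smult k z"]
  proof eventually_elim
    case (elim w)
    have "filterlim (\<lambda>n. n * k) at_top sequentially"
      using False by (intro filterlim_subseq) (auto simp: strict_mono_def)
    from filterlim_compose[OF elim(1) this]
    have "(\<lambda>n. real k * (fpt r w 0 (lattice_smult (n * k) z) / real (n * k))) \<longlonglongrightarrow> real k * time_const r z"
      by (intro tendsto_mult tendsto_const)
    hence "(\<lambda>n. fpt r w 0 (lattice_smult n (lattice_smult k z)) / real n) \<longlonglongrightarrow> real k * time_const r z"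
      using False by (simp add: lattice_smult_mult)
    with elim(2) show ?case by (rule LIMSEQ_unique)
  qed
  thus ?thesis by simp
qed

lemma time_const_seminorm: "lattice_seminorm 4 (time_const r)"
  by unfold_locales (simp_all add: time_const_nonneg time_const_smult time_const_lipschitz)

text \<open>Write \<open>x\<close> as \<open>n\<close> times \<open>z\<close> plus \<open>y\<close>,
  dividing each coordinate by \<open>n\<close>, where \<open>n\<close> is about
  \<open>lnorm x / N\<close>. Then \<open>z\<close> ranges over a finite set, on which radial
  convergence is uniform, and \<open>y\<close> has norm at most \<open>d * n\<close>, a small
  fraction of \<open>lnorm x\<close> once \<open>N\<close> is large.\<close>

lemma fpt_uniform_limit:
  "AE w in conf. \<forall>\<epsilon>>0. \<exists>K. \<forall>x :: int ^ 'd. lnorm x \<ge> K \<longrightarrow>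
     \<bar>fpt r w 0 x - time_const r x\<bar> \<le> \<epsilon> * real (lnorm x)"
proof -
  define d where "d = CARD('d)"
  have "AE w in conf. \<forall>z :: int ^ 'd. (\<lambda>n. fpt r w 0 (lattice_smult n z) / real n) \<longlonglongrightarrow> time_const r z"
    unfolding AE_all_countable by (intro allI fpt_radial_limit)
  moreover have "AE w in conf. \<forall>z :: int ^ 'd. \<forall>\<^sub>F n in sequentially. \<forall>y. lnorm y \<le> d * n \<longrightarrow>
           fpt r w (lattice_smult n z) (lattice_smult n z + y) \<le> 1 * real n + 4 * real (lnorm y)"
    unfolding AE_all_countable by (intro allI fpt_interpolation) simp
  ultimately show ?thesis
  proof eventually_elim
    fix w
    assume lim: "\<forall>z :: int ^ 'd. (\<lambda>n. fpt r w 0 (lattice_smult n z) / real n) \<longlonglongrightarrow> time_const r z"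
      and inter: "\<forall>z :: int ^ 'd. \<forall>\<^sub>F n in sequentially. \<forall>y. lnorm y \<le> d * n \<longrightarrow>
           fpt r w (lattice_smult n z) (lattice_smult n z + y) \<le> 1 * real n + 4 * real (lnorm y)"
    show "\<forall>\<epsilon>>0. \<exists>K. \<forall>x :: int ^ 'd. lnorm x \<ge> K \<longrightarrow> \<bar>fpt r w 0 x - time_const r x\<bar> \<le> \<epsilon> * real (lnorm x)"
    proof (intro allI impI)
      fix \<epsilon> :: real assume \<epsilon>: "\<epsilon> > 0"
      \<comment> \<open>Per unit of \<open>n\<close>: 1 for the radial limit, 1 and
        \<open>4 * d\<close> for the interpolation, and \<open>4 * d\<close> for the Lipschitz
        bound. As \<open>N * n \<le> 2 * lnorm x\<close>, the condition on \<open>N\<close> makes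
        \<open>A * n\<close> at most \<open>\<epsilon> * lnorm x\<close>.\<close>
      define A where "A = 2 + 8 * real d"
      obtain N :: nat where N: "2 * A / \<epsilon> < real N" using reals_Archimedean2 by blast
      have "0 < 2 * A / \<epsilon>" using \<epsilon> by (simp add: A_def)
      hence N0: "N \<ge> 1" using N by linarith
      have "\<forall>\<^sub>F n in sequentially. \<forall>z\<in>{z :: int ^ 'd. lnorm z \<le> N + d}.
          \<bar>fpt r w 0 (lattice_smult n z) / real n - time_const r z\<bar> < 1 \<and>
          (\<forall>y. lnorm y \<le> d * n \<longrightarrow> fpt r w (lattice_smult n z) (lattice_smult n z + y) \<le> 1 * real n + 4 * real (lnorm y))"
      proof (intro eventually_ball_finite ballI eventually_conj)
        fix z :: "int ^ 'd"
        show "\<forall>\<^sub>F n in sequentially. \<bar>fpt r w 0 (lattice_smult n z) / real n - time_const r z\<bar> < 1"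
          using tendstoD[OF lim[rule_format, of z], of 1] by (simp add: dist_real_def)
        show "\<forall>\<^sub>F n in sequentially. \<forall>y. lnorm y \<le> d * n \<longrightarrow>
           fpt r w (lattice_smult n z) (lattice_smult n z + y) \<le> 1 * real n + 4 * real (lnorm y)"
          using inter by blast
      qed simp
      then obtain n0 where n0: "\<And>n z. n \<ge> n0 \<Longrightarrow> lnorm (z :: int ^ 'd) \<le> N + d \<Longrightarrow> \<bar>fpt r w 0 (lattice_smult n z) / real n - time_const r z\<bar> < 1"
         "\<And>n z y. n \<ge> n0 \<Longrightarrow> lnorm (z :: int ^ 'd) \<le> N + d \<Longrightarrow> lnorm y \<le> d * n \<Longrightarrow>
            fpt r w (lattice_smult n z) (lattice_smult n z + y) \<le> 1 * real n + 4 * real (lnorm y)"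
        unfolding eventually_sequentially by (metis (no_types, lifting) mem_Collect_eq)
      have "\<bar>fpt r w 0 x - time_const r x\<bar> \<le> \<epsilon> * real (lnorm x)" if x: "lnorm x \<ge> N * (n0 + 1)" for x :: "int ^ 'd"
      proof -
        \<comment> \<open>The added 1 gives \<open>lnorm x \<le> n * N\<close>, which confines
          \<open>z\<close>; once \<open>lnorm x \<ge> N\<close> it at most doubles
          \<open>N * n\<close>.\<close>
        define n where "n = lnorm x div N + 1"
        have xN: "lnorm x \<ge> N" using x by (simp add: algebra_simps)
        have n1: "n \<ge> 1" by (simp add: n_def)
        have "n0 + 1 \<le> lnorm x div N"
          using x N0 by (simp add: less_eq_div_iff_mult_less_eq mult.commute)
        hence nn0: "n \<ge> n0" by (simp add: n_def)
        have xn: "lnorm x \<le> n * N"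
          using N0 dividend_less_div_times[of N "lnorm x"] by (simp add: n_def)
        have "N * n \<le> lnorm x + N" by (simp add: n_def)
        hence nx: "N * n \<le> 2 * lnorm x" using xN by simp
        define z where "z = (\<chi> i. x $ i div int n)"
        define y where "y = x - lattice_smult n z"
        have xy: "x = lattice_smult n z + y" by (simp add: y_def)
        have "y $ i = x $ i mod int n" for i
          by (simp add: y_def z_def lattice_smult_def minus_mult_div_eq_mod)
        hence "\<bar>y $ i\<bar> \<le> int n" for i using n1 by (simp add: less_imp_le)
        hence "int (lnorm y) \<le> (\<Sum>i\<in>(UNIV :: 'd set). int n)" unfolding lnorm_alt by (intro sum_mono)
        hence ly: "lnorm y \<le> d * n" by (simp add: d_def flip: of_nat_mult)
        have "n * lnorm z = lnorm (x - y)" by (simp add: xy lnorm_smult)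
        also have "\<dots> \<le> lnorm x + lnorm y" using lnorm_triangle[of x "- y"] by simp
        also have "\<dots> \<le> n * (N + d)" using ly xn by (simp add: algebra_simps)
        finally have lz: "lnorm z \<le> N + d" using n1 by simp
        have 1: "fpt r w (lattice_smult n z) x \<le> real n + 4 * (real d * real n)"
        proof -
          have "fpt r w (lattice_smult n z) x \<le> 1 * real n + 4 * real (lnorm y)"
            using n0(2)[OF nn0 lz ly] by (simp add: xy)
          also have "real (lnorm y) \<le> real d * real n" using ly by (metis of_nat_le_iff of_nat_mult)
          finally show ?thesis by simp
        qed
        have 2: "\<bar>fpt r w 0 (lattice_smult n z) - real n * time_const r z\<bar> \<le> real n"
        proof -
          have "\<bar>fpt r w 0 (lattice_smult n z) - real n * time_const r z\<bar> = real n * \<bar>fpt r w 0 (lattice_smult n z) / real n - time_const r z\<bar>"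
            using n1 by (simp add: abs_mult_pos' field_simps)
          also have "\<dots> \<le> real n * 1" using n0(1)[OF nn0 lz] by (intro mult_left_mono) auto
          finally show ?thesis by simp
        qed
        have 3: "\<bar>real n * time_const r z - time_const r x\<bar> \<le> 4 * (real d * real n)"
        proof -
          have "\<bar>time_const r (lattice_smult n z) - time_const r x\<bar> \<le> 4 * real (lnorm y)"
            using time_const_lipschitz[of x "lattice_smult n z"] time_const_lipschitz[of "lattice_smult n z" x]
            by (simp add: y_def lnorm_minus_commute abs_le_iff)
          also have "real (lnorm y) \<le> real d * real n" using ly by (metis of_nat_le_iff of_nat_mult)
          finally show ?thesis by (simp add: time_const_smult)
        qed
        have 4: "\<bar>fpt r w 0 x - fpt r w 0 (lattice_smult n z)\<bar> \<le> fpt r w (lattice_smult n z) x"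
          using fpt_triangle[of w 0 x "lattice_smult n z"] fpt_triangle[of w 0 "lattice_smult n z" x]
          by (simp add: fpt_commute[of w x] abs_le_iff)
        have "\<bar>fpt r w 0 x - time_const r x\<bar> \<le> A * real n"
          using 1 2 3 4 by (simp add: A_def algebra_simps)
        also have "\<dots> \<le> \<epsilon> * real (lnorm x)"
        proof -
          have "2 * A \<le> \<epsilon> * real N" using N \<epsilon> by (simp add: pos_divide_less_eq mult.commute)
          hence "2 * A * real n \<le> \<epsilon> * real N * real n" by (intro mult_right_mono) auto
          also have "\<dots> = \<epsilon> * real (N * n)" by simp
          also have "\<dots> \<le> \<epsilon> * real (2 * lnorm x)" using nx \<epsilon> by (intro mult_left_mono) (auto simp only: of_nat_le_iff)
          finally show ?thesis by simp
        qed
        finally show ?thesis .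
      qed
      thus "\<exists>K. \<forall>x :: int ^ 'd. lnorm x \<ge> K \<longrightarrow> \<bar>fpt r w 0 x - time_const r x\<bar> \<le> \<epsilon> * real (lnorm x)" by blast
    qed
  qed
qed

end

text \<open>A rescaled ball consists of rescaled lattice points, so the inner inclusion can only be
  asked for on \<open>scale_lattice_set t UNIV\<close>. Both inclusions come from comparing
  \<open>T\<close> with \<open>f\<close>, where the linear lower bound on \<open>f\<close> turns the
  error into a relative one.\<close>

lemma shape_inclusions:
  fixes T f :: "int ^ 'd \<Rightarrow> real"
  assumes "lattice_seminorm K f" and c: "c > 0" "\<And>x. c * real (lnorm x) \<le> f x"
    and lim: "\<forall>\<epsilon>>0. \<exists>R. \<forall>x. lnorm x \<ge> R \<longrightarrow> \<bar>T x - f x\<bar> \<le> \<epsilon> * real (lnorm x)"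
    and \<epsilon>: "\<epsilon> > 0"
  shows "\<forall>\<^sub>F t in at_top.
     {y. norm_extension K f y \<le> 1 - \<epsilon>} \<inter> scale_lattice_set t UNIV \<subseteq> scale_lattice_set t {x. T x \<le> t} \<and>
     scale_lattice_set t {x. T x \<le> t} \<subseteq> {y. norm_extension K f y \<le> 1 + \<epsilon>}"
proof -
  interpret lattice_seminorm K f by fact
  \<comment> \<open>With relative error \<open>\<epsilon> / (1 + \<epsilon>)\<close>,
    \<open>T x \<le> t\<close> gives exactly \<open>f x \<le> (1 + \<epsilon>) * t\<close>.\<close>
  define \<delta> where "\<delta> = c * (\<epsilon> / (1 + \<epsilon>))"
  have \<delta>: "\<delta> > 0" using c \<epsilon> by (simp add: \<delta>_def)
  obtain R where R: "\<And>x. lnorm x \<ge> R \<Longrightarrow> \<bar>T x - f x\<bar> \<le> \<delta> * real (lnorm x)" using lim \<delta> by blast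
  \<comment> \<open>Near the origin the asymptotics say nothing; these finitely many points are
    settled by taking \<open>t > m\<close>.\<close>
  define m where "m = Max (insert 0 ((\<lambda>x. max (T x) (f x)) ` {x. lnorm x \<le> R}))"
  have m: "T x \<le> m" "f x \<le> m" if "lnorm x \<le> R" for x
  proof -
    have "max (T x) (f x) \<le> m" unfolding m_def using that by (intro Max_ge) auto
    thus "T x \<le> m" "f x \<le> m" by auto
  qed
  have close: "\<bar>T x - f x\<bar> \<le> \<epsilon> / (1 + \<epsilon>) * f x" if "lnorm x \<ge> R" for x
  proof -
    have "\<delta> * real (lnorm x) = \<epsilon> / (1 + \<epsilon>) * (c * real (lnorm x))" by (simp add: \<delta>_def)
    also have "\<dots> \<le> \<epsilon> / (1 + \<epsilon>) * f x" using \<epsilon> c by (intro mult_left_mono) auto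
    finally show ?thesis using R[OF that] by simp
  qed
  have scale: "norm_extension K f ((1 / t) *\<^sub>R real_of_lattice x) = f x / t" if "t > 0" for x t
    using norm_extension_scaleR[of "1 / t" "real_of_lattice x"] that by (simp add: norm_extension_lattice)
  show ?thesis
    using eventually_gt_at_top[of "max 0 m"]
  proof eventually_elim
    case (elim t)
    hence t: "t > 0" "t > m" by auto
    have inner: "T x \<le> t" if fx: "f x \<le> (1 - \<epsilon>) * t" for x
    proof (cases "lnorm x \<ge> R")
      case True
      have "T x \<le> f x + \<epsilon> / (1 + \<epsilon>) * f x" using close[OF True] by simp
      also have "\<dots> \<le> f x + \<epsilon> * f x"
      proof -
        have "\<epsilon> / (1 + \<epsilon>) \<le> \<epsilon>" using divide_left_mono[of 1 "1 + \<epsilon>" \<epsilon>] \<epsilon> by simp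
        thus ?thesis by (intro add_left_mono mult_right_mono nonneg)
      qed
      also have "\<dots> = (1 + \<epsilon>) * f x" by (simp add: algebra_simps)
      also have "\<dots> \<le> (1 + \<epsilon>) * ((1 - \<epsilon>) * t)" using fx \<epsilon> by (intro mult_left_mono) auto
      also have "\<dots> = t - \<epsilon> * \<epsilon> * t" by (simp add: algebra_simps)
      also have "\<dots> \<le> t" using t by simp
      finally show ?thesis .
    qed (use m[of x] t in auto)
    have outer: "f x \<le> (1 + \<epsilon>) * t" if Tx: "T x \<le> t" for x
    proof (cases "lnorm x \<ge> R")
      case True
      have "f x \<le> t + \<epsilon> / (1 + \<epsilon>) * f x" using close[OF True] Tx by simp
      hence "(1 + \<epsilon>) * f x \<le> (1 + \<epsilon>) * (t + \<epsilon> / (1 + \<epsilon>) * f x)" using \<epsilon> by (intro mult_left_mono) auto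
      also have "\<dots> = (1 + \<epsilon>) * t + \<epsilon> * f x" using \<epsilon> by (simp add: distrib_left)
      finally show ?thesis by (simp add: algebra_simps)
    next
      case False
      hence "f x \<le> t" using m[of x] t by simp
      also have "\<dots> \<le> (1 + \<epsilon>) * t" using \<epsilon> t by simp
      finally show ?thesis .
    qed
    show ?case
    proof (intro conjI subsetI)
      fix y assume "y \<in> {y. norm_extension K f y \<le> 1 - \<epsilon>} \<inter> scale_lattice_set t UNIV"
      then obtain x where x: "y = (1 / t) *\<^sub>R real_of_lattice x" "norm_extension K f y \<le> 1 - \<epsilon>"
        by (auto simp: scale_lattice_set_def)
      hence "f x \<le> (1 - \<epsilon>) * t" using scale[OF t(1), of x] t by (simp add: pos_divide_le_eq)
      hence "T x \<le> t" by (rule inner)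
      thus "y \<in> scale_lattice_set t {x. T x \<le> t}" using x(1) by (auto simp: scale_lattice_set_def)
    next
      fix y assume "y \<in> scale_lattice_set t {x. T x \<le> t}"
      then obtain x where x: "y = (1 / t) *\<^sub>R real_of_lattice x" "T x \<le> t"
        by (auto simp: scale_lattice_set_def)
      have "f x / t \<le> 1 + \<epsilon>" using outer[OF x(2)] t by (simp add: pos_divide_le_eq)
      thus "y \<in> {y. norm_extension K f y \<le> 1 + \<epsilon>}" using scale[OF t(1), of x] x(1) by simp
    qed
  qed
qed

section \<open>Transfer to an arbitrary family of exponential weights\<close>

lemma passage_time_restrict: "passage_time r (restrict w lattice_edges) a b = passage_time r w a b"
proof -
  have "path_weight r (restrict w lattice_edges) p = path_weight r w p" if "is_path p a b" for p
    unfolding path_weight_def using that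
    by (intro sum.cong) (auto simp: edge_weight_def is_path_def)
  thus ?thesis unfolding passage_time_def by (intro arg_cong[where f = Inf]) (metis (no_types, lifting))
qed

lemma (in prob_space) distr_exponential_family:
  fixes \<omega> :: "(int ^ 'd) set \<Rightarrow> 'a \<Rightarrow> real"
  assumes indep: "indep_vars (\<lambda>_. borel) \<omega> lattice_edges"
    and expo: "\<forall>e\<in>lattice_edges. distributed M lborel (\<omega> e) (exponential_density 1)"
  shows "(\<lambda>s. \<lambda>e\<in>lattice_edges. \<omega> e s) \<in> measurable M conf"
    and "distr M conf (\<lambda>s. \<lambda>e\<in>lattice_edges. \<omega> e s) = conf"
proof -
  have rv: "\<omega> e \<in> borel_measurable M" if "e \<in> lattice_edges" for e
    using indep that by (auto simp: indep_vars_def)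
  have s: "sets conf = sets (PiM (lattice_edges :: (int ^ 'd) set set) (\<lambda>_. borel :: real measure))"
    unfolding conf_def by (intro sets_PiM_cong) auto
  show m: "(\<lambda>s. \<lambda>e\<in>lattice_edges. \<omega> e s) \<in> measurable M conf"
    using rv by (subst measurable_cong_sets[OF refl s]) (auto intro!: measurable_restrict)
  have "distr M conf (\<lambda>s. \<lambda>e\<in>lattice_edges. \<omega> e s) = distr M (PiM lattice_edges (\<lambda>_. borel)) (\<lambda>s. \<lambda>e\<in>lattice_edges. \<omega> e s)"
    by (intro distr_cong s) auto
  also have "\<dots> = PiM lattice_edges (\<lambda>e. distr M borel (\<omega> e))"
    using indep_vars_iff_distr_eq_PiM'[where M' = "\<lambda>_. borel" and X = \<omega>, OF lattice_edges_nonempty rv] indep by simp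
  also have "\<dots> = conf"
    unfolding conf_def
  proof (rule PiM_cong)
    fix e :: "(int ^ 'd) set" assume "e \<in> lattice_edges"
    hence "distr M lborel (\<omega> e) = density lborel (exponential_density 1)"
      using expo by (auto simp: distributed_def)
    moreover have "distr M borel (\<omega> e) = distr M lborel (\<omega> e)" by (intro distr_cong) auto
    ultimately show "distr M borel (\<omega> e) = edge_law" by (simp add: edge_law_def)
  qed simp
  finally show "distr M conf (\<lambda>s. \<lambda>e\<in>lattice_edges. \<omega> e s) = conf" .
qed

theorem theorem1p6:
  fixes M :: "'a measure"
    and \<omega> :: "(int ^ 'd) set \<Rightarrow> 'a \<Rightarrow> real"
    and r :: "nat \<Rightarrow> real"
    and L :: "real \<Rightarrow> real"
    and \<alpha> :: real
  assumes P: "prob_space M"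
    and indep: "prob_space.indep_vars M (\<lambda>_. borel) \<omega> lattice_edges"
    and expo: "\<forall>e\<in>lattice_edges. distributed M lborel (\<omega> e) (exponential_density 1)"
    and alpha: "\<alpha> > 2 * real CARD('d) + 1"
    and L_sv: "slowly_varying L"
    and L1: "L 1 = 1"
    and r_def: "\<forall>k\<ge>1. r k = real k powr (- \<alpha>) * L (real k)"
    and r_nonneg: "\<forall>k\<ge>1. r k \<ge> 0"
    and r_noninc: "\<forall>k\<ge>1. r (Suc k) \<le> r k"
  shows "\<exists>\<nu> :: real ^ 'd \<Rightarrow> real.
     (\<forall>y. \<nu> y \<ge> 0) \<and> (\<forall>y. y \<noteq> 0 \<longrightarrow> \<nu> y \<noteq> 0) \<and>
     (\<forall>x :: int ^ 'd. x \<noteq> 0 \<longrightarrow> \<nu> (real_of_lattice x) > 0 \<and>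
        (\<forall>\<epsilon>>0. ((\<lambda>n::nat. measure M {s \<in> space M.
            (1 - \<epsilon>) * \<nu> (real_of_lattice x)
              \<le> passage_time r (\<lambda>e. \<omega> e s) 0 (lattice_smult n x) / real n \<and>
            passage_time r (\<lambda>e. \<omega> e s) 0 (lattice_smult n x) / real n
              \<le> (1 + \<epsilon>) * \<nu> (real_of_lattice x)}) \<longlongrightarrow> 1) sequentially)) \<and>
     (\<forall>\<epsilon>>0. AE s in M. \<forall>\<^sub>F t in at_top.
        {y. \<nu> y \<le> 1 - \<epsilon>} \<inter> scale_lattice_set t UNIV
          \<subseteq> scale_lattice_set t (fpp_ball r (\<lambda>e. \<omega> e s) t) \<and>
        scale_lattice_set t (fpp_ball r (\<lambda>e. \<omega> e s) t) \<subseteq> {y. \<nu> y \<le> 1 + \<epsilon>})"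
proof -
  interpret prob_space M by fact
  have alpha': "\<alpha> > real (2 * CARD('d) + 1)" using alpha by simp
  note decay = regularly_varying_dyadic_decay[OF alpha' L_sv r_def r_nonneg r_noninc]
  interpret fpp_rate r
    by unfold_locales (use decay(1) r_def L1 in auto)
  obtain C \<sigma> where C: "C > 0" "0 < \<sigma>" "\<sigma> < 1" "\<And>j. r (2 ^ j) \<le> C * (\<sigma> / 2 ^ (2 * CARD('d) + 1)) ^ j"
    using decay(2) by blast
  obtain c0 where c0: "c0 > 0" "\<And>z :: int ^ 'd. c0 * real (lnorm z) \<le> time_const r z"
    using time_const_lower[where 'd = 'd, OF nonincreasing_from_Suc[OF r_noninc] C(4,1,2,3)] by blast
  \<comment> \<open>The minimum with 4 keeps the constant below the penalty slope, as
    \<open>norm_extension_lower\<close> requires.\<close>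
  define c where "c = min c0 4"
  have c: "0 < c" "c \<le> 4" using c0(1) by (auto simp: c_def)
  have c_le: "c * real (lnorm z) \<le> time_const r z" for z :: "int ^ 'd"
    using c0(2)[of z] mult_right_mono[of c c0 "real (lnorm z)"] by (simp add: c_def)
  interpret \<nu>: lattice_seminorm 4 "time_const r :: int ^ 'd \<Rightarrow> real" by (rule time_const_seminorm)
  define \<nu> where "\<nu> = norm_extension 4 (time_const r :: int ^ 'd \<Rightarrow> real)"
  have \<nu>_lattice: "\<nu> (real_of_lattice x) = time_const r x" for x
    unfolding \<nu>_def by (rule \<nu>.norm_extension_lattice)
  have \<nu>_lower: "c * l1 y \<le> \<nu> y" for y
    unfolding \<nu>_def using c c_le by (intro \<nu>.norm_extension_lower) auto
  \<comment> \<open>The restriction puts the weights into the space of \<open>conf\<close>; paths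
    use genuine edges, so passage times do not change.\<close>
  define X where "X s = (\<lambda>e\<in>lattice_edges. \<omega> e s)" for s
  have X: "X \<in> measurable M conf" "distr M conf X = conf"
    using distr_exponential_family[OF indep expo] by (simp_all add: X_def[abs_def])
  have XT: "passage_time r (\<lambda>e. \<omega> e s) a b = passage_time r (X s) a b" for s a b
    unfolding X_def by (rule passage_time_restrict[symmetric])
  have transfer: "AE s in M. P (X s)" if "AE w in conf. P w" for P
  proof (rule AE_distrD[OF X(1)])
    show "AE w in distr M conf X. P w" unfolding X(2) by (rule that)
  qed
  have eq: "AE s in M. \<forall>a b. passage_time r (X s) a b = fpt r (X s) a b"
    by (rule transfer[OF AE_fpt_eq])
  have meas [measurable]: "(\<lambda>s. passage_time r (\<lambda>e. \<omega> e s) a b) \<in> borel_measurable M" for a b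
  proof (rule measurable_passage_time)
    fix x y :: "int ^ 'd" assume "x \<noteq> y"
    hence [measurable]: "\<omega> {x, y} \<in> borel_measurable M" using indep by (auto simp: indep_vars_def)
    show "(\<lambda>s. edge_weight r (\<lambda>e. \<omega> e s) x y) \<in> borel_measurable M"
      unfolding edge_weight_def by measurable
  qed
  have weak: "((\<lambda>n::nat. measure M {s \<in> space M.
            (1 - \<epsilon>) * \<nu> (real_of_lattice x)
              \<le> passage_time r (\<lambda>e. \<omega> e s) 0 (lattice_smult n x) / real n \<and>
            passage_time r (\<lambda>e. \<omega> e s) 0 (lattice_smult n x) / real n
              \<le> (1 + \<epsilon>) * \<nu> (real_of_lattice x)}) \<longlongrightarrow> 1) sequentially"
    if \<epsilon>: "\<epsilon> > 0" and pos: "\<nu> (real_of_lattice x) > 0" for \<epsilon> x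
  proof (rule prob_tendsto_1_of_AE_eventually)
    show "AE s in M. \<forall>\<^sub>F n in sequentially. s \<in> {s \<in> space M.
            (1 - \<epsilon>) * \<nu> (real_of_lattice x)
              \<le> passage_time r (\<lambda>e. \<omega> e s) 0 (lattice_smult n x) / real n \<and>
            passage_time r (\<lambda>e. \<omega> e s) 0 (lattice_smult n x) / real n
              \<le> (1 + \<epsilon>) * \<nu> (real_of_lattice x)}"
      using transfer[OF fpt_radial_limit[of x]] eq AE_space
    proof eventually_elim
      case (elim s)
      have lim: "(\<lambda>n. fpt r (X s) 0 (lattice_smult n x) / real n) \<longlonglongrightarrow> \<nu> (real_of_lattice x)"
        using elim(1) by (simp add: \<nu>_lattice)
      have "(1 - \<epsilon>) * \<nu> (real_of_lattice x) < \<nu> (real_of_lattice x)" "\<nu> (real_of_lattice x) < (1 + \<epsilon>) * \<nu> (real_of_lattice x)"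
        using pos \<epsilon> by (simp_all add: algebra_simps)
      from order_tendstoD(1)[OF lim this(1)] order_tendstoD(2)[OF lim this(2)] show ?case
        by eventually_elim (use elim in \<open>simp add: XT less_imp_le\<close>)
    qed
  qed measurable
  have shape: "AE s in M. \<forall>\<^sub>F t in at_top.
        {y. \<nu> y \<le> 1 - \<epsilon>} \<inter> scale_lattice_set t UNIV
          \<subseteq> scale_lattice_set t (fpp_ball r (\<lambda>e. \<omega> e s) t) \<and>
        scale_lattice_set t (fpp_ball r (\<lambda>e. \<omega> e s) t) \<subseteq> {y. \<nu> y \<le> 1 + \<epsilon>}" if \<epsilon>: "\<epsilon> > 0" for \<epsilon>
    using transfer[OF fpt_uniform_limit] eq
  proof eventually_elim
    case (elim s)
    have "fpp_ball r (\<lambda>e. \<omega> e s) t = {x. fpt r (X s) 0 x \<le> t}" for t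
      using elim(2) by (simp add: fpp_ball_def XT)
    thus ?case
      using shape_inclusions[OF \<nu>.lattice_seminorm_axioms c(1) c_le elim(1) \<epsilon>] by (simp add: \<nu>_def)
  qed
  show ?thesis
  proof (intro exI[of _ \<nu>] conjI allI impI)
    show "\<nu> y \<ge> 0" for y unfolding \<nu>_def by (rule \<nu>.norm_extension_nonneg)
    show "\<nu> y \<noteq> 0" if "y \<noteq> 0" for y
      using \<nu>_lower[of y] l1_pos[OF that] c(1) mult_pos_pos[of c "l1 y"] by linarith
    show "\<nu> (real_of_lattice x) > 0" if "x \<noteq> 0" for x
    proof -
      have "0 < c * real (lnorm x)" using that c(1) by (intro mult_pos_pos) (simp_all add: neq0_conv[symmetric] del: neq0_conv)
      also note c_le[of x]
      finally show ?thesis by (simp add: \<nu>_lattice)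
    qed
    thus "((\<lambda>n::nat. measure M {s \<in> space M.
            (1 - \<epsilon>) * \<nu> (real_of_lattice x)
              \<le> passage_time r (\<lambda>e. \<omega> e s) 0 (lattice_smult n x) / real n \<and>
            passage_time r (\<lambda>e. \<omega> e s) 0 (lattice_smult n x) / real n
              \<le> (1 + \<epsilon>) * \<nu> (real_of_lattice x)}) \<longlongrightarrow> 1) sequentially"
      if "x \<noteq> 0" "\<epsilon> > 0" for x \<epsilon>
      using that by (intro weak) auto
  qed (rule shape)
qed

end
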